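(* Let $\nu>-1/2$ and $p_0=\frac{4(\nu+1)}{2\nu+3+2\delta}$. If $0<\delta<\nu+1/2$, there is $C>0$ such that for all sufficiently large $R$, $$\sup_{E\subset(0,1)}\frac{\|\mathcal{B}_R^\delta\chi_E\|_{L^{p_0}((0,1),d\mu_\nu)}}{\|\chi_E\|_{L^{p_0}((0,1),d\mu_\nu)}}\ge C(\log R)^{1/p_0},$$ the supremum being over measurable $E$ with $\mu_\nu(E)>0$; and if $\delta=\nu+1/2$, there is $C>0$ such that for all sufficiently large $R$, $$\sup_{\|f\|_{L^{1}((0,1),d\mu_\nu)}=1}\|\mathcal{B}_R^\delta f\|_{L^{1}((0,1),d\mu_\nu)}\ge C\log R.$$
   Context: Let $J_\nu$ be the Bessel function of order $\nu$, $0<s_1<s_2<\dots$ its successive positive zeros, $d\mu_\nu(x)=x^{2\nu+1}dx$ on $(0,1)$, $\psi_j(x)=\frac{\sqrt2}{|J_{\nu+1}(s_j)|}x^{-\nu}J_\nu(s_jx)$, $a_j(f)=\int_0^1 f\psi_j\,d\mu_\nu$. For $\delta>0$, $R>0$, $\mathcal{B}_R^\delta f(x)=\sum_{j\ge1}(1-s_j^2/R^2)_+^\delta a_j(f)\psi_j(x)$ with $(1-s^2)_+=\max\{1-s^2,0\}$. $\chi_E$ is the indicator of $E$. *)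

theory Defs
  imports "HOL-Analysis.Analysis"
begin

text \<open>Bessel function of the first kind of order nu (power series; used for x > 0).\<close>
definition besselJ :: "real \<Rightarrow> real \<Rightarrow> real" where
  "besselJ nu x = (\<Sum>m. (-1) ^ m / (fact m * Gamma (real m + nu + 1)) * (x / 2) powr (2 * real m + nu))"

text \<open>The positive zeros s_1 < s_2 < ... ; here indexed from 0: bessel_zero nu j is the (j+1)-th
  positive zero, i.e. the positive zero having exactly j positive zeros below it.\<close>
definition bessel_zero :: "real \<Rightarrow> nat \<Rightarrow> real" where
  "bessel_zero nu j = (THE s. 0 < s \<and> besselJ nu s = 0 \<and>
      card {t. 0 < t \<and> t < s \<and> besselJ nu t = 0} = j)"

definition bessel_psi :: "real \<Rightarrow> nat \<Rightarrow> real \<Rightarrow> real" where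
  "bessel_psi nu j x = sqrt 2 / \<bar>besselJ (nu + 1) (bessel_zero nu j)\<bar>
      * x powr (- nu) * besselJ nu (bessel_zero nu j * x)"

definition bessel_coeff :: "real \<Rightarrow> (real \<Rightarrow> real) \<Rightarrow> nat \<Rightarrow> real" where
  "bessel_coeff nu f j = (LINT x:{0<..<1}|lborel. f x * bessel_psi nu j x * x powr (2 * nu + 1))"

definition bochner_riesz :: "real \<Rightarrow> real \<Rightarrow> real \<Rightarrow> (real \<Rightarrow> real) \<Rightarrow> real \<Rightarrow> real" where
  "bochner_riesz nu delta R f x =
     (\<Sum>j\<in>{j. bessel_zero nu j < R}.
        (1 - (bessel_zero nu j)\<^sup>2 / R\<^sup>2) powr delta * bessel_coeff nu f j * bessel_psi nu j x)"

definition mu_nu :: "real \<Rightarrow> real set \<Rightarrow> ennreal" where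
  "mu_nu nu E = (\<integral>\<^sup>+ x\<in>E. ennreal (x powr (2 * nu + 1)) \<partial>lborel)"

text \<open>L^p((0,1), d mu_nu) norm (for finite norms).\<close>
definition Lp_nu :: "real \<Rightarrow> real \<Rightarrow> (real \<Rightarrow> real) \<Rightarrow> real" where
  "Lp_nu nu p g = enn2real (\<integral>\<^sup>+ x\<in>{0<..<1}. ennreal (\<bar>g x\<bar> powr p * x powr (2 * nu + 1)) \<partial>lborel) powr (1 / p)"

end

(*
  Test on E = (0, eta/R) with a small constant eta. Writing x = z/R, the mean B_R chi_E (x) is,
  up to a constant, R^(-1) times the sum of phi(s/R) / w(s)^2 over the zeros s < R of J_nu, where
  w is the derivative of v(s) = 2^nu sqrt(s) J_nu(s) and phi is a fixed profile on [0,1] that depends on z.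
  Since v'' = (c/s^2 - 1) v, v(s) is A cos(s - th) + O(1/s); hence the
  zeros are asymptotically equidistant with w(s)^2 -> A^2, and the sum is the integral of phi / (pi A^2)
  up to an error O((z + ln R)/R). Sonine's integral and a Taylor expansion in 1 - t^2 show that
  the integral of phi is a constant times z^(-lam) J_lam(z), lam = nu + delta + 1, plus lower order
  terms, so it has size z^(-nu-delta-3/2) away from the zeros of a cosine. The error is negligible
  for z between a constant and a small power of R. As (nu + delta + 3/2) p_0 = 2 nu + 2, the p_0-th
  power of the norm over this range of z is bounded below by mu(E) times a multiple of the integral
  of dz/z, that is of log R.
*)
theory Submission
  imports Defs
begin

section \<open>The Bessel--Clifford function\<close>

text \<open>\<open>clifford mu\<close> is the entire function with J_mu(x) = (x/2)^mu *
  \<open>clifford mu (x^2/4)\<close> for x > 0. Without the power of x there is no branch point at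
  0, and differentiation just shifts the order by one up to sign; eigenfunctions, coefficients and
  Sonine's integral are all expressed through it. Length eta/R is the scale on which no frequency s
  < R oscillates: the coefficient contributes only the factor
  \<open>clifford (nu + 1) (a * t^2)\<close>, a = eta^2/4. A small a keeps it positive at t = 1 and
  makes the expansion in 1 - t^2 contract. The expansion is centred at t = 1 because the singularity
  of (1 - t^2)^delta there dictates the decay in z; each further power of 1 - t^2 raises the Bessel
  order by one. The obstacle is uniformity over infinitely many orders: asymptotics with unspecified
  constants are used for two orders only, and the recurrence carries the bound to all higher ones.
  Stopping at z = R^q is harmless, as ln(R^q) = q ln R. The endpoint delta = nu + 1/2 is the case
  p_0 = 1 of the same estimate.\<close>

definition clifford :: "real \<Rightarrow> real \<Rightarrow> real" where
  "clifford mu u = (\<Sum>m. (-1) ^ m * rGamma (real m + mu + 1) / fact m * u ^ m)"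

lemma rGamma_Suc: "rGamma (real (Suc m) + mu + 1) * (real m + mu + 1) = rGamma (real m + mu + 1)"
  using rGamma_plus1[of "real m + mu + 1"] by (simp add: algebra_simps)

lemma rGamma_pos: "x > 0 \<Longrightarrow> rGamma (x::real) > 0"
  using Gamma_real_pos[of x] by (simp add: rGamma_inverse_Gamma)

lemma clifford_summable:
  assumes "mu > -1"
  shows "summable (\<lambda>m. (-1) ^ m * rGamma (real m + mu + 1) / fact m * u ^ m)"
\<comment> \<open>From this N on, (n + 1)(mu + 1) \<ge> 2|u|, so the ratio |u| / ((n + 1)(n + mu +
  1)) of consecutive terms is at most 1/2.\<close>
proof (rule summable_ratio_test[where c = "1/2" and N = "nat \<lceil>2 * \<bar>u\<bar> / (mu + 1)\<rceil>"])
  fix n assume "n \<ge> nat \<lceil>2 * \<bar>u\<bar> / (mu + 1)\<rceil>"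
  then have "real n \<ge> 2 * \<bar>u\<bar> / (mu + 1)" by linarith
  then have n: "2 * \<bar>u\<bar> \<le> (real n + 1) * (mu + 1)"
    using assms by (simp add: field_simps)
  also have "\<dots> \<le> (real n + 1) * (real n + mu + 1)"
    using assms by (intro mult_left_mono) auto
  finally have "2 * \<bar>u\<bar> \<le> (real n + 1) * (real n + mu + 1)" .
  moreover have "(real n + 1) * (real n + mu + 1) > 0"
    using assms by (intro mult_pos_pos) auto
  ultimately have le: "\<bar>u\<bar> / ((real n + 1) * (real n + mu + 1)) \<le> 1/2"
    by (subst pos_divide_le_eq) auto
  define c where "c = rGamma (real n + mu + 1)"
  have c': "rGamma (real (Suc n) + mu + 1) = c / (real n + mu + 1)"
    using rGamma_Suc[of n mu] assms by (simp add: c_def field_simps)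
  have "norm ((-1) ^ Suc n * rGamma (real (Suc n) + mu + 1) / fact (Suc n) * u ^ Suc n)
     = \<bar>u\<bar> / ((real n + 1) * (real n + mu + 1)) * norm ((-1) ^ n * c / fact n * u ^ n)"
    unfolding c' using assms by (simp add: abs_mult power_abs mult_ac add_ac)
  also have "\<dots> \<le> 1/2 * norm ((-1) ^ n * c / fact n * u ^ n)"
    by (intro mult_right_mono le) auto
  finally show "norm ((-1) ^ Suc n * rGamma (real (Suc n) + mu + 1) / fact (Suc n) * u ^ Suc n)
      \<le> 1/2 * norm ((-1) ^ n * rGamma (real n + mu + 1) / fact n * u ^ n)"
    by (simp add: c_def)
qed simp

lemma diffs_clifford:
  "diffs (\<lambda>m. (-1) ^ m * rGamma (real m + mu + 1) / fact m) m
    = - ((-1) ^ m * rGamma (real m + (mu + 1) + 1) / fact m)"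
  by (simp add: diffs_def field_simps del: of_nat_Suc) (simp add: algebra_simps)

lemma clifford_has_deriv:
  assumes "mu > -1"
  shows "(clifford mu has_real_derivative - clifford (mu + 1) u) (at u)"
proof -
  have "((\<lambda>u. \<Sum>m. (-1) ^ m * rGamma (real m + mu + 1) / fact m * u ^ m) has_real_derivative
      (\<Sum>m. diffs (\<lambda>m. (-1) ^ m * rGamma (real m + mu + 1) / fact m) m * u ^ m)) (at u)"
    using clifford_summable[OF assms] by (intro termdiffs_strong_converges_everywhere)
  moreover have "(\<Sum>m. - ((-1) ^ m * rGamma (real m + (mu + 1) + 1) / fact m) * u ^ m)
      = - clifford (mu + 1) u"
    using suminf_minus[OF clifford_summable[of "mu + 1" u]] assms
    by (simp add: clifford_def)
  ultimately show ?thesis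
    by (simp add: clifford_def[abs_def] diffs_clifford)
qed

lemmas clifford_deriv [derivative_intros] = DERIV_chain2[OF clifford_has_deriv]

lemma clifford_continuous [continuous_intros]:
  assumes "mu > -1" "continuous_on S f"
  shows "continuous_on S (\<lambda>x. clifford mu (f x))"
proof -
  have "continuous_on UNIV (clifford mu)"
    using clifford_has_deriv[OF assms(1)]
    by (intro continuous_at_imp_continuous_on) (auto intro: DERIV_isCont)
  then show ?thesis
    using assms(2) continuous_on_compose2 by blast
qed

text \<open>This is J_mu + J_(mu+2) = (2(mu + 1)/x) J_(mu+1). Since rGamma(m + mu + 1) = (m + mu +
  1) rGamma(m + mu + 2), each coefficient splits into a part with factor mu + 1 and a part with
  factor m; the latter sums to u times the derivative of \<open>clifford (mu + 1)\<close>.\<close>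

lemma clifford_rec:
  assumes "mu > -1"
  shows "clifford mu u = (mu + 1) * clifford (mu + 1) u - u * clifford (mu + 2) u"
proof -
  let ?c = "\<lambda>mu m. (-1) ^ m * rGamma (real m + mu + 1) / fact m"
  have s1: "(\<lambda>m. ?c (mu + 1) m * u ^ m) sums clifford (mu + 1) u"
    unfolding clifford_def using clifford_summable[of "mu+1" u] assms by (simp add: summable_sums)
  have "(\<lambda>m. ?c (mu + 2) m * u ^ m) sums clifford (mu + 2) u"
    unfolding clifford_def using clifford_summable[of "mu+2" u] assms by (simp add: summable_sums)
  from sums_minus[OF this] have "(\<lambda>m. - ?c (mu + 2) m * u ^ m) sums - clifford (mu + 2) u"
    by simp
  moreover have "- ?c (mu + 2) m = diffs (?c (mu + 1)) m" for m
    by (subst diffs_clifford) (simp add: algebra_simps)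
  ultimately have "(\<lambda>m. diffs (?c (mu + 1)) m * u ^ m) sums - clifford (mu + 2) u"
    by (simp only:)
  then have "(\<lambda>m. u * (diffs (?c (mu + 1)) m * u ^ m)) sums (u * - clifford (mu + 2) u)"
    by (rule sums_mult)
  then have "(\<lambda>m. real (Suc m) * ?c (mu + 1) (Suc m) * u ^ Suc m) sums (u * - clifford (mu + 2) u)"
    by (simp add: diffs_def mult_ac del: of_nat_Suc)
  then have s2: "(\<lambda>m. real m * ?c (mu + 1) m * u ^ m) sums (u * - clifford (mu + 2) u)"
    by (subst (asm) sums_Suc_iff) simp
  have "(\<lambda>m. (mu + 1) * (?c (mu + 1) m * u ^ m) + real m * ?c (mu + 1) m * u ^ m) sums
      ((mu + 1) * clifford (mu + 1) u + u * - clifford (mu + 2) u)"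
    by (intro sums_add sums_mult s1 s2)
  moreover have "(mu + 1) * (?c (mu + 1) m * u ^ m) + real m * ?c (mu + 1) m * u ^ m = ?c mu m * u ^ m" for m
  proof -
    have "rGamma (real m + (mu + 1) + 1) * (real m + mu + 1) = rGamma (real m + mu + 1)"
      using rGamma_Suc[of m mu] by (simp add: algebra_simps)
    then have "?c mu m * u ^ m = (-1) ^ m * (rGamma (real m + (mu + 1) + 1) * (real m + mu + 1)) / fact m * u ^ m"
      by simp
    then show ?thesis by (simp add: field_simps)
  qed
  ultimately show ?thesis
    by (simp add: clifford_def sums_iff)
qed

lemma clifford_0: "clifford mu 0 = rGamma (mu + 1)"
  unfolding clifford_def by (subst powser_zero) simp

lemma rGamma_add_nat_le:
  assumes "x \<ge> 1"
  shows "rGamma (x + real m) \<le> rGamma x"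
proof (induction m)
  case (Suc m)
  have "1 * rGamma (x + real (Suc m)) \<le> (x + real m) * rGamma (x + real (Suc m))"
    using assms rGamma_pos[of "x + real (Suc m)"] by (intro mult_right_mono) auto
  also have "\<dots> = rGamma (x + real m)"
    using rGamma_plus1[of "x + real m"] by (simp add: add_ac)
  finally show ?case using Suc by simp
qed simp

text \<open>Termwise comparison with the exponential series. Crude in u, but the order enters only
  through \<open>rGamma (mu + 1)\<close>, which makes it usable along all the orders mu + k of a
  Taylor expansion.\<close>

lemma clifford_bound_exp:
  assumes "mu \<ge> 0"
  shows "\<bar>clifford mu u\<bar> \<le> rGamma (mu + 1) * exp \<bar>u\<bar>"
proof -
  have s: "(\<lambda>m. rGamma (mu + 1) * (\<bar>u\<bar> ^ m / fact m)) sums (rGamma (mu + 1) * exp \<bar>u\<bar>)"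
    using exp_converges[of "\<bar>u\<bar>"] by (intro sums_mult) (simp add: field_simps)
  have "norm (clifford mu u) \<le> (\<Sum>m. rGamma (mu + 1) * (\<bar>u\<bar> ^ m / fact m))"
    unfolding clifford_def
  proof (rule norm_suminf_le)
    fix m
    have "rGamma (mu + 1 + real m) \<le> rGamma (mu + 1)" "0 < rGamma (mu + 1 + real m)"
      using assms by (auto intro: rGamma_add_nat_le rGamma_pos)
    then show "norm ((-1) ^ m * rGamma (real m + mu + 1) / fact m * u ^ m)
        \<le> rGamma (mu + 1) * (\<bar>u\<bar> ^ m / fact m)"
      by (auto simp: abs_mult power_abs add_ac divide_right_mono mult_right_mono)
  qed (use s in \<open>simp add: sums_iff\<close>)
  then show ?thesis using s by (simp add: sums_iff)
qed

section \<open>Perturbed harmonic oscillators\<close>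

text \<open>Since K/s^2 is the derivative of -K/s, the function f - K/s increases and f + K/s
  decreases; the supremum of the former separates the two.\<close>

lemma limit_of_deriv_bound:
  fixes f :: "real \<Rightarrow> real"
  assumes d: "\<And>s. s \<ge> 1 \<Longrightarrow> (f has_real_derivative f' s) (at s)"
    and b: "\<And>s. s \<ge> 1 \<Longrightarrow> \<bar>f' s\<bar> \<le> K / s\<^sup>2"
  obtains L where "\<And>s. s \<ge> 1 \<Longrightarrow> \<bar>f s - L\<bar> \<le> K / s"
proof -
  have K: "K \<ge> 0" using b[of 1] by simp
  have up: "f s - K / s \<le> f t - K / t" if "1 \<le> s" "s \<le> t" for s t
  proof (rule DERIV_nonneg_imp_nondecreasing[OF that(2)])
    fix x assume x: "s \<le> x" "x \<le> t"
    then have "((\<lambda>s. f s - K / s) has_real_derivative (f' x + K / x\<^sup>2)) (at x)"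
      using that by (auto intro!: derivative_eq_intros d simp: power2_eq_square)
    then show "\<exists>y. ((\<lambda>s. f s - K / s) has_real_derivative y) (at x) \<and> 0 \<le> y"
      using b[of x] x that by (intro exI[of _ "f' x + K / x\<^sup>2"]) auto
  qed
  have down: "f t + K / t \<le> f s + K / s" if "1 \<le> s" "s \<le> t" for s t
  proof (rule DERIV_nonpos_imp_nonincreasing[OF that(2)])
    fix x assume x: "s \<le> x" "x \<le> t"
    then have "((\<lambda>s. f s + K / s) has_real_derivative (f' x - K / x\<^sup>2)) (at x)"
      using that by (auto intro!: derivative_eq_intros d simp: power2_eq_square)
    then show "\<exists>y. ((\<lambda>s. f s + K / s) has_real_derivative y) (at x) \<and> y \<le> 0"
      using b[of x] x that by (intro exI[of _ "f' x - K / x\<^sup>2"]) auto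
  qed
  have cross: "f s - K / s \<le> f t + K / t" if "1 \<le> s" "1 \<le> t" for s t
  proof (cases "s \<le> t")
    case True
    then have "f s - K / s \<le> f t - K / t" using up that by blast
    also have "\<dots> \<le> f t + K / t" using K that by simp
    finally show ?thesis .
  next
    case False
    have "f s - K / s \<le> f s + K / s" using K that by simp
    also have "\<dots> \<le> f t + K / t" using False down that by simp
    finally show ?thesis .
  qed
  define L where "L = (SUP s\<in>{1..}. f s - K / s)"
  have bdd: "bdd_above ((\<lambda>s. f s - K / s) ` {1..})"
    using cross[of _ 1] by (intro bdd_aboveI2[of _ _ "f 1 + K / 1"]) auto
  show ?thesis
  proof (rule that[of L])
    fix s :: real assume s: "s \<ge> 1"
    have "f s - K / s \<le> L" unfolding L_def using s bdd by (intro cSUP_upper) auto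
    moreover have "L \<le> f s + K / s" unfolding L_def using s cross by (intro cSUP_least) auto
    ultimately show "\<bar>f s - L\<bar> \<le> K / s" by linarith
  qed
qed

text \<open>The equation v'' = (c/s^2 - 1) v as a first-order system. The point \<open>s0\<close>
  excludes the zero solution.\<close>

locale perturbed_oscillator =
  fixes v w :: "real \<Rightarrow> real" and c s0 :: real
  assumes dv: "\<And>s. s > 0 \<Longrightarrow> (v has_real_derivative w s) (at s)"
    and dw: "\<And>s. s > 0 \<Longrightarrow> (w has_real_derivative (c / s\<^sup>2 - 1) * v s) (at s)"
    and s0: "s0 > 0" "v s0 \<noteq> 0"
begin

definition energy :: "real \<Rightarrow> real" where "energy s = (v s)\<^sup>2 + (w s)\<^sup>2"

lemma energy_nonneg: "energy s \<ge> 0"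
  by (simp add: energy_def)

lemma energy_deriv:
  assumes "s > 0"
  shows "(energy has_real_derivative 2 * c * v s * w s / s\<^sup>2) (at s)"
  unfolding energy_def[abs_def] using assms
  by (auto intro!: derivative_eq_intros dv dw simp: field_simps power2_eq_square)

lemma energy_deriv_le: "\<bar>2 * c * v s * w s / s\<^sup>2\<bar> \<le> energy s * \<bar>c\<bar> / s\<^sup>2"
proof -
  have "0 \<le> (\<bar>v s\<bar> - \<bar>w s\<bar>)\<^sup>2" by simp
  then have "2 * \<bar>v s\<bar> * \<bar>w s\<bar> \<le> energy s"
    by (simp add: energy_def power2_diff)
  then have "2 * \<bar>v s\<bar> * \<bar>w s\<bar> * (\<bar>c\<bar> / s\<^sup>2) \<le> energy s * (\<bar>c\<bar> / s\<^sup>2)"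
    by (intro mult_right_mono) auto
  then show ?thesis by (simp add: abs_mult mult_ac)
qed

text \<open>Gronwall's inequality in integrated form: the energy is constant for c = 0, and in
  general its relative rate of change is at most |c|/s^2, whose primitive -|c|/s stays bounded as s
  grows.\<close>

lemma energy_up:
  assumes "0 < s" "s \<le> t"
  shows "energy s * exp (- \<bar>c\<bar> / s) \<le> energy t * exp (- \<bar>c\<bar> / t)"
proof (rule DERIV_nonneg_imp_nondecreasing[OF assms(2)])
  fix x assume x: "s \<le> x" "x \<le> t"
  let ?D = "(2 * c * v x * w x / x\<^sup>2 + energy x * \<bar>c\<bar> / x\<^sup>2) * exp (- \<bar>c\<bar> / x)"
  have "((\<lambda>s. energy s * exp (- \<bar>c\<bar> / s)) has_real_derivative ?D) (at x)"
    using assms x by (auto intro!: derivative_eq_intros energy_deriv simp: field_simps power2_eq_square)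
  moreover have "?D \<ge> 0"
    using abs_le_D2[OF energy_deriv_le[of x]] by (intro mult_nonneg_nonneg) (linarith, simp)
  ultimately show "\<exists>y. ((\<lambda>s. energy s * exp (- \<bar>c\<bar> / s)) has_real_derivative y) (at x) \<and> 0 \<le> y"
    by blast
qed

lemma energy_down:
  assumes "0 < s" "s \<le> t"
  shows "energy t * exp (\<bar>c\<bar> / t) \<le> energy s * exp (\<bar>c\<bar> / s)"
proof (rule DERIV_nonpos_imp_nonincreasing[OF assms(2)])
  fix x assume x: "s \<le> x" "x \<le> t"
  let ?D = "(2 * c * v x * w x / x\<^sup>2 - energy x * \<bar>c\<bar> / x\<^sup>2) * exp (\<bar>c\<bar> / x)"
  have "((\<lambda>s. energy s * exp (\<bar>c\<bar> / s)) has_real_derivative ?D) (at x)"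
    using assms x by (auto intro!: derivative_eq_intros energy_deriv simp: field_simps power2_eq_square)
  moreover have "?D \<le> 0"
    using abs_le_D1[OF energy_deriv_le[of x]] by (intro mult_nonpos_nonneg) (linarith, simp)
  ultimately show "\<exists>y. ((\<lambda>s. energy s * exp (\<bar>c\<bar> / s)) has_real_derivative y) (at x) \<and> y \<le> 0"
    by blast
qed

text \<open>The two Gronwall inequalities carry nontriviality from \<open>s0\<close> to the right
  and to the left. Hence v and w never vanish together: the zeros of v are simple.\<close>

lemma energy_pos:
  assumes "s > 0"
  shows "energy s > 0"
proof -
  have e0: "energy s0 > 0" using s0 by (simp add: energy_def add_pos_nonneg)
  show ?thesis
  proof (cases "s0 \<le> s")
    case True
    have "0 < energy s0 * exp (- \<bar>c\<bar> / s0)" using e0 by simp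
    also have "\<dots> \<le> energy s * exp (- \<bar>c\<bar> / s)" using s0 True by (intro energy_up)
    finally show ?thesis by (simp add: zero_less_mult_iff)
  next
    case False
    have "0 < energy s0 * exp (\<bar>c\<bar> / s0)" using e0 by simp
    also have "\<dots> \<le> energy s * exp (\<bar>c\<bar> / s)" using assms False by (intro energy_down) auto
    finally show ?thesis by (simp add: zero_less_mult_iff)
  qed
qed

lemma energy_le:
  assumes "s \<ge> 1"
  shows "energy s \<le> energy 1 * exp \<bar>c\<bar>"
proof -
  have "energy s * 1 \<le> energy s * exp (\<bar>c\<bar> / s)"
    using assms energy_nonneg by (intro mult_left_mono) auto
  also have "\<dots> \<le> energy 1 * exp \<bar>c\<bar>" using energy_down[of 1 s] assms by simp
  finally show ?thesis by simp
qed

lemma energy_ge: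
  assumes "s \<ge> 1"
  shows "energy 1 * exp (- \<bar>c\<bar>) \<le> energy s"
proof -
  have "energy 1 * exp (- \<bar>c\<bar>) \<le> energy s * exp (- \<bar>c\<bar> / s)" using energy_up[of 1 s] assms by simp
  also have "\<dots> \<le> energy s * 1"
    using assms energy_nonneg by (intro mult_left_mono) auto
  finally show ?thesis by simp
qed

lemma asymptotics:
  obtains A th K where "A > 0" "K > 0"
    "\<And>s. s \<ge> 1 \<Longrightarrow> \<bar>v s - A * cos (s - th)\<bar> \<le> K / s"
    "\<And>s. s \<ge> 1 \<Longrightarrow> \<bar>w s + A * sin (s - th)\<bar> \<le> K / s"
proof -
  define B where "B = sqrt (energy 1 * exp \<bar>c\<bar>)"
  have v_le: "\<bar>v s\<bar> \<le> B" if "s \<ge> 1" for s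
  proof -
    have "(v s)\<^sup>2 \<le> energy 1 * exp \<bar>c\<bar>"
      using energy_le[OF that] by (auto simp: energy_def intro: order_trans[rotated])
    then have "sqrt ((v s)\<^sup>2) \<le> B" unfolding B_def by (rule real_sqrt_le_mono)
    then show ?thesis by simp
  qed
  have B: "B \<ge> 0" using v_le[of 1] by linarith
  define K where "K = \<bar>c\<bar> * B"
  have K: "K \<ge> 0" using B by (simp add: K_def)
  \<comment> \<open>Variation of constants: (a, b) is (v, w) seen in the frame rotating with the
    free motion. For v = A cos(s - th) it would be the constant A (cos th, sin th); the perturbation
    gives it a derivative of size 1/s^2.\<close>
  define a where "a s = v s * cos s - w s * sin s" for s
  define b where "b s = v s * sin s + w s * cos s" for s
  have da: "(a has_real_derivative - (c / s\<^sup>2 * v s * sin s)) (at s)" if "s \<ge> 1" for s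
    unfolding a_def[abs_def] using that
    by (auto intro!: derivative_eq_intros dv dw simp: algebra_simps)
  have db: "(b has_real_derivative (c / s\<^sup>2 * v s * cos s)) (at s)" if "s \<ge> 1" for s
    unfolding b_def[abs_def] using that
    by (auto intro!: derivative_eq_intros dv dw simp: algebra_simps)
  have bound: "\<bar>c / s\<^sup>2 * v s * q\<bar> \<le> K / s\<^sup>2" if "s \<ge> 1" "\<bar>q\<bar> \<le> 1" for s q
  proof -
    have "\<bar>v s\<bar> * \<bar>q\<bar> \<le> B * 1" using that v_le B by (intro mult_mono) auto
    then have "\<bar>c\<bar> / s\<^sup>2 * (\<bar>v s\<bar> * \<bar>q\<bar>) \<le> \<bar>c\<bar> / s\<^sup>2 * (B * 1)" by (intro mult_left_mono) auto
    then show ?thesis by (simp add: K_def abs_mult mult_ac)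
  qed
  obtain La where La: "\<And>s. s \<ge> 1 \<Longrightarrow> \<bar>a s - La\<bar> \<le> K / s"
    using limit_of_deriv_bound[of a, OF da] bound by (metis abs_minus_cancel abs_sin_le_one)
  obtain Lb where Lb: "\<And>s. s \<ge> 1 \<Longrightarrow> \<bar>b s - Lb\<bar> \<le> K / s"
    using limit_of_deriv_bound[of b, OF db] bound by (metis abs_cos_le_one)
  have ab: "(a s)\<^sup>2 + (b s)\<^sup>2 = energy s" for s
  proof -
    have "(a s)\<^sup>2 + (b s)\<^sup>2 = energy s * ((sin s)\<^sup>2 + (cos s)\<^sup>2)"
      unfolding a_def b_def energy_def by algebra
    then show ?thesis by simp
  qed
  define A where "A = sqrt (La\<^sup>2 + Lb\<^sup>2)"
  have "La\<^sup>2 + Lb\<^sup>2 \<noteq> 0"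
  proof
    assume "La\<^sup>2 + Lb\<^sup>2 = 0"
    then have 0: "La = 0" "Lb = 0" by (auto simp: sum_power2_eq_zero_iff)
    define e where "e = energy 1 * exp (- \<bar>c\<bar>)"
    have e: "e > 0" using energy_pos[of 1] by (simp add: e_def)
    \<comment> \<open>If both limits vanished, the energy would be at most 2(K/s)^2 and at least e,
      so e s \<le> e s^2 \<le> 2 K^2. This s violates that, as e s = e + 2 K^2.\<close>
    define s where "s = 1 + 2 * K\<^sup>2 / e"
    have s: "s \<ge> 1" using e by (simp add: s_def)
    have "(a s)\<^sup>2 \<le> (K / s)\<^sup>2" "(b s)\<^sup>2 \<le> (K / s)\<^sup>2"
      using La[OF s] Lb[OF s] 0 s K by (auto intro: abs_le_square_iff[THEN iffD1])
    then have "e \<le> 2 * (K / s)\<^sup>2" using ab[of s] energy_ge[OF s] by (simp add: e_def)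
    then have "e * s\<^sup>2 \<le> 2 * K\<^sup>2" using s by (simp add: field_simps power_divide)
    moreover have "e * s \<le> e * s\<^sup>2" using s e by (intro mult_left_mono) (auto simp: power2_eq_square)
    moreover have "e * s = e + 2 * K\<^sup>2" using e by (simp add: s_def field_simps)
    ultimately show False using e by linarith
  qed
  then have A2: "La\<^sup>2 + Lb\<^sup>2 > 0" by (smt (verit) zero_le_power2)
  then have A: "A > 0" by (simp add: A_def)
  have "A\<^sup>2 = La\<^sup>2 + Lb\<^sup>2" using A2 by (simp add: A_def)
  then have "(La / A)\<^sup>2 + (Lb / A)\<^sup>2 = 1" using A2
    by (simp add: power_divide add_divide_distrib[symmetric] del: sum_power2_eq_zero_iff)
  then obtain th where th: "La / A = cos th" "Lb / A = sin th"
    using sincos_total_2pi by metis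
  then have LaLb: "La = A * cos th" "Lb = A * sin th" using A by (auto simp: field_simps)
  have tri: "\<bar>x * p + y * q\<bar> \<le> 2 * (K / s)" if "\<bar>x\<bar> \<le> K / s" "\<bar>y\<bar> \<le> K / s" "\<bar>p\<bar> \<le> 1" "\<bar>q\<bar> \<le> 1" for x y p q s :: real
  proof -
    have "\<bar>x * p\<bar> \<le> K / s * 1" "\<bar>y * q\<bar> \<le> K / s * 1"
      unfolding abs_mult using that by (intro mult_mono; force)+
    then show ?thesis by linarith
  qed
  show ?thesis
  \<comment> \<open>The factor 2 is for the two components a and b; the extra 1 keeps the constant
    positive when c = 0 makes K vanish.\<close>
  proof (rule that[of A "2 * K + 1" th])
    fix s :: real assume s: "s \<ge> 1"
    have le: "2 * (K / s) \<le> (2 * K + 1) / s" using s by (simp add: field_simps)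
    have sc: "(sin s)\<^sup>2 = 1 - (cos s)\<^sup>2" using sin_squared_eq by blast
    have "v s = a s * cos s + b s * sin s"
      unfolding a_def b_def using sc by algebra
    then have "v s - A * cos (s - th) = (a s - La) * cos s + (b s - Lb) * sin s"
      by (simp add: cos_diff LaLb algebra_simps)
    then show "\<bar>v s - A * cos (s - th)\<bar> \<le> (2 * K + 1) / s"
      using tri[OF La[OF s] Lb[OF s], of "cos s" "sin s"] le by simp
    have "w s = a s * - sin s + b s * cos s"
      unfolding a_def b_def using sc by algebra
    then have "w s + A * sin (s - th) = (a s - La) * - sin s + (b s - Lb) * cos s"
      by (simp add: sin_diff LaLb algebra_simps)
    then show "\<bar>w s + A * sin (s - th)\<bar> \<le> (2 * K + 1) / s"
      using tri[OF La[OF s] Lb[OF s], of "- sin s" "cos s"] le by simp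
  qed (use A K in auto)
qed

end

section \<open>Location and simplicity of the zeros of an oscillator\<close>

lemma sum_inverse_le_ln:
  assumes "M \<ge> 1"
  shows "(\<Sum>k<M. 1 / (real k + 1)) \<le> 1 + ln (real M)"
  using assms
proof (induction M rule: dec_induct)
  case (step M)
  have "ln (real M / (real M + 1)) \<le> real M / (real M + 1) - 1"
    using step by (intro ln_le_minus_one) auto
  then have "1 / (real M + 1) \<le> ln (real M + 1) - ln (real M)"
    using step by (simp add: ln_div field_simps)
  then show ?case using step by (simp add: add_ac)
qed simp

lemma tendsto_frequently_unique:
  fixes f :: "'a \<Rightarrow> 'b :: t1_space"
  assumes "(f \<longlongrightarrow> l) F" "\<exists>\<^sub>F x in F. f x = c"
  shows "l = c"
  using tendsto_imp_eventually_ne[OF assms(1)] assms(2) unfolding frequently_def by blast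

text \<open>At an accumulation point of zeros both v and its difference quotients along those zeros
  vanish, so the point would be a double zero. Accumulation at 0, where the derivative is not
  controlled, is ruled out separately by \<open>near0\<close>.\<close>

lemma finite_zeros_of_simple:
  fixes v w :: "real \<Rightarrow> real"
  assumes d: "\<And>s. s > 0 \<Longrightarrow> (v has_real_derivative w s) (at s)"
    and simple: "\<And>s. s > 0 \<Longrightarrow> v s = 0 \<Longrightarrow> w s \<noteq> 0"
    and near0: "e > 0" "\<And>s. 0 < s \<Longrightarrow> s < e \<Longrightarrow> v s \<noteq> 0"
  shows "finite {s. 0 < s \<and> s \<le> b \<and> v s = 0}"
proof (rule ccontr)
  let ?Z = "{s. 0 < s \<and> s \<le> b \<and> v s = 0}"
  assume "infinite ?Z"
  moreover have "?Z \<subseteq> {e..b}" using near0 by force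
  moreover have "compact {e..b}" by simp
  ultimately obtain p where p: "p \<in> {e..b}" "p islimpt ?Z"
    unfolding compact_eq_Bolzano_Weierstrass by blast
  then have p0: "p > 0" using near0 by simp
  have freq: "\<exists>\<^sub>F s in at p. s \<in> ?Z"
    using p(2) by (simp add: islimpt_conv_frequently_at)
  have "(v \<longlongrightarrow> v p) (at p)"
    using d[OF p0] by (simp add: DERIV_isCont isContD)
  then have vp: "v p = 0"
  proof (rule tendsto_frequently_unique)
    show "\<exists>\<^sub>F s in at p. v s = 0" using freq by (rule frequently_elim1) simp
  qed
  have "((\<lambda>s. (v s - v p) / (s - p)) \<longlongrightarrow> w p) (at p)"
    using d[OF p0] by (simp add: has_field_derivative_iff)
  moreover have "\<exists>\<^sub>F s in at p. (v s - v p) / (s - p) = 0"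
    using freq by (rule frequently_elim1) (simp add: vp)
  ultimately have "w p = 0" by (rule tendsto_frequently_unique)
  then show False using simple[OF p0 vp] by simp
qed

context perturbed_oscillator
begin

text \<open>The points th + pi k are the extrema of the limiting cosine, where v has the sign of
  (-1)^k; hence a zero in each window. Uniqueness is Rolle's theorem against the asymptotics of w.
  At a zero of v the cosine is O(1/s), so the sine has modulus near 1 and w^2 differs from A^2 by
  O(1/s).\<close>

lemma zero_windows:
  obtains A th K N where "A > 0" "K > 0"
    "\<And>k. k \<ge> N \<Longrightarrow> th + pi * real k \<ge> 1"
    "\<And>k. k \<ge> N \<Longrightarrow> v (th + pi * real k) \<noteq> 0"
    "\<And>k. k \<ge> N \<Longrightarrow> \<exists>!s. th + pi * real k < s \<and> s < th + pi * real (Suc k) \<and> v s = 0"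
    "\<And>k s. k \<ge> N \<Longrightarrow> th + pi * real k < s \<Longrightarrow> v s = 0 \<Longrightarrow>
       \<bar>1 / (w s)\<^sup>2 - 1 / A\<^sup>2\<bar> \<le> K / (real k + 1)"
proof -
  obtain A th K where A: "A > 0" and K: "K > 0"
    and va: "\<And>s. s \<ge> 1 \<Longrightarrow> \<bar>v s - A * cos (s - th)\<bar> \<le> K / s"
    and wa: "\<And>s. s \<ge> 1 \<Longrightarrow> \<bar>w s + A * sin (s - th)\<bar> \<le> K / s"
    using asymptotics by metis
  \<comment> \<open>As pi k \<ge> 2 k, the part |th| + 1 gives th + pi k \<ge> k + 1; the part 4 K/A
    then makes the asymptotic error K/s at most A/4 in all windows from N on.\<close>
  define N where "N = nat \<lceil>\<bar>th\<bar> + 1 + 4 * K / A\<rceil>"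
  have AK: "0 \<le> 4 * K / A" using A K by simp
  have N1: "th + pi * real k \<ge> real k + 1" and N2: "4 * K / A \<le> real k" if "k \<ge> N" for k
  proof -
    have k: "real k \<ge> \<bar>th\<bar> + 1 + 4 * K / A" using that unfolding N_def by linarith
    have "pi * real k \<ge> 2 * real k" using pi_ge_two by (intro mult_right_mono) auto
    then show "th + pi * real k \<ge> real k + 1" using k AK by linarith
    show "4 * K / A \<le> real k" using k by linarith
  qed
  have small: "K / s \<le> A / 4" if "k \<ge> N" "s \<ge> th + pi * real k" for k s
  proof -
    have "4 * K / A \<le> s" "s > 0" using N1[OF that(1)] N2[OF that(1)] that(2) by linarith+
    then show ?thesis using A by (simp add: field_simps)
  qed
  have sgn_v: "\<bar>v (th + pi * real k) - A * (-1) ^ k\<bar> \<le> A / 4" if "k \<ge> N" for k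
    using order_trans[OF va small[OF that order_refl]] N1[OF that]
    by (simp add: cos_npi2 mult.commute)
  have cos_small: "(cos (s - th))\<^sup>2 \<le> 1 / 16" if "k \<ge> N" "s \<ge> th + pi * real k" "v s = 0" for k s
  proof -
    have "\<bar>A * cos (s - th)\<bar> \<le> A / 4"
      using order_trans[OF va small[OF that(1,2)]] N1[OF that(1)] that by simp
    then have "\<bar>cos (s - th)\<bar> \<le> 1 / 4" using A by (simp add: abs_mult)
    then have "\<bar>cos (s - th)\<bar>\<^sup>2 \<le> (1 / 4)\<^sup>2" by (intro power_mono) auto
    then show ?thesis by (simp add: power2_eq_square)
  qed
  have sin_small: "(sin (s - th))\<^sup>2 \<le> 1 / 16" if "k \<ge> N" "s \<ge> th + pi * real k" "w s = 0" for k s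
  proof -
    have "\<bar>A * sin (s - th)\<bar> \<le> A / 4"
      using order_trans[OF wa small[OF that(1,2)]] N1[OF that(1)] that by simp
    then have "\<bar>sin (s - th)\<bar> \<le> 1 / 4" using A by (simp add: abs_mult)
    then have "\<bar>sin (s - th)\<bar>\<^sup>2 \<le> (1 / 4)\<^sup>2" by (intro power_mono) auto
    then show ?thesis by (simp add: power2_eq_square)
  qed
  have cont: "continuous_on {a..b} v" if "a > 0" for a b
    using that by (intro continuous_at_imp_continuous_on ballI DERIV_isCont[OF dv]) auto
  have ex: "\<exists>s. th + pi * real k < s \<and> s < th + pi * real (Suc k) \<and> v s = 0" if k: "k \<ge> N" for k
  proof -
    let ?a = "th + pi * real k" and ?b = "th + pi * real (Suc k)"
    have ab: "?a \<le> ?b" by (simp add: algebra_simps)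
    have a0: "?a > 0" using N1[OF k] by linarith
    have s1: "\<bar>v ?a - A * (-1) ^ k\<bar> \<le> A / 4" "\<bar>v ?b + A * (-1) ^ k\<bar> \<le> A / 4"
      using sgn_v[OF k] sgn_v[of "Suc k"] k by auto
    obtain s where s: "?a \<le> s" "s \<le> ?b" "v s = 0"
    proof (cases "even k")
      case True
      then have "\<bar>v ?a - A\<bar> \<le> A / 4" "\<bar>v ?b + A\<bar> \<le> A / 4" using s1 by simp_all
      then have "v ?a \<ge> 0" "v ?b \<le> 0" using A by linarith+
      then show ?thesis using IVT2'[of v ?b 0 ?a] ab cont[OF a0] that by metis
    next
      case False
      then have "\<bar>v ?a + A\<bar> \<le> A / 4" "\<bar>v ?b - A\<bar> \<le> A / 4" using s1 by simp_all
      then have "v ?a \<le> 0" "v ?b \<ge> 0" using A by linarith+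
      then show ?thesis using IVT'[of v ?a 0 ?b] ab cont[OF a0] that by metis
    qed
    moreover have "v ?a \<noteq> 0" "v ?b \<noteq> 0" using s1 A by (cases "even k"; auto)+
    ultimately have "?a \<noteq> s" "?b \<noteq> s" by metis+
    then show ?thesis using s by (intro exI[of _ s]) linarith
  qed
  have uniq: False if k: "k \<ge> N" and s: "th + pi * real k < s" "s < t" "t < th + pi * real (Suc k)" "v s = 0" "v t = 0"
    for k s t
  proof -
    have s0: "s > 0" using N1[OF k] s by linarith
    have "\<exists>z>s. z < t \<and> v t - v s = (t - s) * w z"
      using s s0 by (intro MVT2 dv) auto
    then obtain z where z: "s < z" "z < t" "w z = 0" using s by auto
    define f where "f x = x - th - pi * real k" for x
    have sf: "(sin (x - th))\<^sup>2 = (sin (f x))\<^sup>2" for x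
    proof -
      have "x - th = f x + real k * pi" by (simp add: f_def)
      then show ?thesis by (simp add: sin_add power_mult_distrib power2_eq_square flip: power_add)
    qed
    have ran: "0 < f s" "f s < f z" "f z < f t" "f t < pi"
      using s z by (auto simp: f_def algebra_simps)
    have big: "(sin (f x))\<^sup>2 \<ge> 15 / 16" if "x \<ge> s" "v x = 0" for x
      using cos_small[OF k, of x] that s sin_squared_eq[of "x - th"] sf[of x] by auto
    \<comment> \<open>On (0, pi) the sine rises and then falls, so at z it is at least its value at
      one of the zeros s, t, where its square is at least 15/16. But w z = 0 forces the square to be
      at most 1/16.\<close>
    have "15 / 16 \<le> (sin (f z))\<^sup>2"
    proof (cases "f z \<le> pi / 2")
      case True
      have "sin (f s) \<le> sin (f z)" using ran True by (intro sin_monotone_2pi_le) auto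
      moreover have "sin (f s) \<ge> 0" using ran by (intro sin_ge_zero) auto
      ultimately have "(sin (f s))\<^sup>2 \<le> (sin (f z))\<^sup>2" by (intro power_mono)
      then show ?thesis using big[of s] s by linarith
    next
      case False
      have "sin (pi - f t) \<le> sin (pi - f z)" using ran False by (intro sin_monotone_2pi_le) auto
      then have "sin (f t) \<le> sin (f z)" by simp
      moreover have "sin (f t) \<ge> 0" using ran by (intro sin_ge_zero) auto
      ultimately have "(sin (f t))\<^sup>2 \<le> (sin (f z))\<^sup>2" by (intro power_mono)
      then show ?thesis using big[of t] s by linarith
    qed
    then show False using sin_small[OF k, of z] z s sf[of z] by auto
  qed
  show ?thesis
  \<comment> \<open>The bound |w^2 - A^2| \<le> 3 A K/s is divided by w^2 A^2 \<ge> A^4/4, and s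
    \<ge> k + 1.\<close>
  proof (rule that[of A "12 * K / A ^ 3" N th])
    fix k assume k: "k \<ge> N"
    show "th + pi * real k \<ge> 1" using N1[OF k] by linarith
    show "v (th + pi * real k) \<noteq> 0" using sgn_v[OF k] A by (cases "even k") auto
    show "\<exists>!s. th + pi * real k < s \<and> s < th + pi * real (Suc k) \<and> v s = 0"
      using ex[OF k] uniq[OF k] by (metis linorder_neqE)
  next
    fix k s assume k: "k \<ge> N" and s: "th + pi * real k < s" "v s = 0"
    have s1: "s \<ge> 1" "s \<ge> real k + 1" using N1[OF k] s by linarith+
    have sm: "K / s \<le> A / 4" using small[OF k] s by simp
    have "\<bar>A * cos (s - th)\<bar> \<le> K / s" using va[OF s1(1)] s by simp
    then have "\<bar>A * cos (s - th)\<bar>\<^sup>2 \<le> (K / s)\<^sup>2" by (intro power_mono) auto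
    also have "\<dots> \<le> A / 4 * (K / s)"
      unfolding power2_eq_square using K s1 sm by (intro mult_right_mono) auto
    finally have c: "A\<^sup>2 * (cos (s - th))\<^sup>2 \<le> A / 4 * (K / s)"
      by (simp add: power_mult_distrib)
    have "\<bar>A * sin (s - th)\<bar> \<le> A * 1" unfolding abs_mult using A by (intro mult_mono) auto
    then have "\<bar>w s - A * sin (s - th)\<bar> \<le> 9 * A / 4" using wa[OF s1(1)] sm by linarith
    then have "\<bar>w s + A * sin (s - th)\<bar> * \<bar>w s - A * sin (s - th)\<bar> \<le> K / s * (9 * A / 4)"
      using wa[OF s1(1)] by (intro mult_mono) auto
    then have X: "\<bar>(w s + A * sin (s - th)) * (w s - A * sin (s - th))\<bar> \<le> 9 / 4 * (A * (K / s))"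
      by (simp add: abs_mult mult_ac)
    have Y: "0 \<le> A\<^sup>2 * (cos (s - th))\<^sup>2" "A\<^sup>2 * (cos (s - th))\<^sup>2 \<le> 1 / 4 * (A * (K / s))"
      using c by auto
    have "(w s)\<^sup>2 - A\<^sup>2 = (w s + A * sin (s - th)) * (w s - A * sin (s - th)) - A\<^sup>2 * (cos (s - th))\<^sup>2"
      using sin_squared_eq[of "s - th"] by algebra
    then have "\<bar>(w s)\<^sup>2 - A\<^sup>2\<bar> \<le> 3 * (A * (K / s))"
      using X Y by linarith
    then have d: "\<bar>(w s)\<^sup>2 - A\<^sup>2\<bar> \<le> 3 * A * (K / s)"
      by simp
    also have "\<dots> \<le> 3 * A * (A / 4)" using sm A by (intro mult_left_mono) auto
    also have "\<dots> = 3 / 4 * A\<^sup>2" by (simp add: power2_eq_square)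
    finally have w: "(w s)\<^sup>2 \<ge> A\<^sup>2 / 4" by linarith
    have A2: "A\<^sup>2 > 0" using A by simp
    then have w0: "(w s)\<^sup>2 > 0" using w by linarith
    have "\<bar>1 / (w s)\<^sup>2 - 1 / A\<^sup>2\<bar> = \<bar>(w s)\<^sup>2 - A\<^sup>2\<bar> / ((w s)\<^sup>2 * A\<^sup>2)"
      using A2 w0 by (simp add: field_simps abs_minus_commute abs_div)
    also have "\<dots> \<le> 3 * A * (K / s) / (A\<^sup>2 / 4 * A\<^sup>2)"
      using d w A2 w0 A K s1 by (intro frac_le mult_right_mono mult_pos_pos) auto
    also have "\<dots> = 12 * K / A ^ 3 / s" using A s1 by (simp add: field_simps power2_eq_square power3_eq_cube)
    also have "\<dots> \<le> 12 * K / A ^ 3 / (real k + 1)" using A K s1 by (intro divide_left_mono) auto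
    finally show "\<bar>1 / (w s)\<^sup>2 - 1 / A\<^sup>2\<bar> \<le> 12 * K / A ^ 3 / (real k + 1)" .
  qed (use A K in auto)
qed

end

section \<open>Sums over the zeros of an oscillator\<close>

context perturbed_oscillator
begin

lemma zeros_unbounded: "\<exists>s>b. v s = 0"
proof -
  obtain A th K N where z: "\<And>k. k \<ge> N \<Longrightarrow> \<exists>!s. th + pi * real k < s \<and> s < th + pi * real (Suc k) \<and> v s = 0"
    using zero_windows by metis
  define k where "k = N + nat \<lceil>\<bar>b\<bar> + \<bar>th\<bar>\<rceil>"
  have "1 * real k \<le> pi * real k" using pi_ge_two by (intro mult_right_mono) auto
  moreover have "real k \<ge> \<bar>b\<bar> + \<bar>th\<bar>" unfolding k_def by linarith
  ultimately have b: "b \<le> th + pi * real k" by linarith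
  have "k \<ge> N" by (simp add: k_def)
  then obtain s where "th + pi * real k < s" "v s = 0" using z by blast
  then show ?thesis using b by (intro exI[of _ s]) auto
qed

text \<open>A Riemann sum with one node per window of length pi and weights tending to 1/A^2, whence
  the density 1/(pi A^2). \<open>H\<close> is a monotone majorant of the variation of
  \<open>phi\<close>; its increments over the windows telescope, which replaces a derivative bound.
  The vanishing of \<open>phi\<close> on [1, 2] lets the last window overrun R. The constants are
  chosen before \<open>phi\<close>, so they serve a whole family of profiles.\<close>

lemma sum_over_zeros_approx:
  assumes fin: "\<And>b. finite {s. 0 < s \<and> s \<le> b \<and> v s = 0}"
  obtains A D R0 where "A > 0" "D > 0"
    "\<And>R phi H C. R \<ge> R0 \<Longrightarrow> C \<ge> 0 \<Longrightarrow> continuous_on {0..2} phi \<Longrightarrow>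
       (\<And>t. 1 \<le> t \<Longrightarrow> t \<le> 2 \<Longrightarrow> phi t = 0) \<Longrightarrow>
       (\<And>t. 0 \<le> t \<Longrightarrow> t \<le> 2 \<Longrightarrow> \<bar>phi t\<bar> \<le> C) \<Longrightarrow>
       (\<And>s t. 0 \<le> s \<Longrightarrow> s \<le> t \<Longrightarrow> t \<le> 2 \<Longrightarrow> H s \<le> H t \<and> \<bar>phi t - phi s\<bar> \<le> C * (H t - H s)) \<Longrightarrow>
       \<bar>(\<Sum>s\<in>{s. 0 < s \<and> s < R \<and> v s = 0}. 1 / (w s)\<^sup>2 * phi (s / R) / R)
           - 1 / (pi * A\<^sup>2) * integral {0..1} phi\<bar> \<le> D * C * (1 + (H 2 - H 0) + ln R) / R"
proof -
  obtain A th K N where A: "A > 0" and K: "K > 0"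
    and p1: "\<And>k. k \<ge> N \<Longrightarrow> th + pi * real k \<ge> 1"
    and pnz: "\<And>k. k \<ge> N \<Longrightarrow> v (th + pi * real k) \<noteq> 0"
    and win: "\<And>k. k \<ge> N \<Longrightarrow> \<exists>!s. th + pi * real k < s \<and> s < th + pi * real (Suc k) \<and> v s = 0"
    and wt: "\<And>k s. k \<ge> N \<Longrightarrow> th + pi * real k < s \<Longrightarrow> v s = 0 \<Longrightarrow>
       \<bar>1 / (w s)\<^sup>2 - 1 / A\<^sup>2\<bar> \<le> K / (real k + 1)"
    by (rule zero_windows) (rule that)
  define p where "p k = th + pi * real k" for k
  have pS: "p (Suc k) = p k + pi" for k by (simp add: p_def algebra_simps)
  define Z where "Z b = {s. 0 < s \<and> s \<le> b \<and> v s = 0}" for b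
  have finZ: "finite (Z b)" for b unfolding Z_def by (rule fin)
  define q where "q s = 1 / (w s)\<^sup>2" for s
  have q0: "q s \<ge> 0" for s by (simp add: q_def)
  define c where "c = 1 / (pi * A\<^sup>2)"
  have c: "c > 0" using A by (simp add: c_def)
  have cpi: "c * pi = 1 / A\<^sup>2" by (simp add: c_def)
  define D0 where "D0 = (\<Sum>s\<in>Z (p N). q s) + c * p N"
  have D0: "D0 \<ge> 0" unfolding D0_def using q0 c p1[of N]
    by (intro add_nonneg_nonneg sum_nonneg mult_nonneg_nonneg) (auto simp: p_def)
  \<comment> \<open>Large enough for R to lie beyond p N, for the last window to end before 2 R, and
    for the number of windows to be at most R.\<close>
  define R0 where "R0 = p N + 6 + 2 * \<bar>th\<bar>"
  show ?thesis
  proof (rule that[of A "D0 + K + 1 / A\<^sup>2" R0])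
    show "A > 0" by (rule A)
    show "D0 + K + 1 / A\<^sup>2 > 0" using A K D0 by (simp add: add_nonneg_pos)
  next
    fix R C :: real and phi H :: "real \<Rightarrow> real"
    assume R: "R \<ge> R0" and C: "C \<ge> (0::real)" and cont: "continuous_on {0..2} phi"
      and zero: "\<And>t. 1 \<le> t \<Longrightarrow> t \<le> 2 \<Longrightarrow> phi t = (0::real)"
      and bd: "\<And>t. 0 \<le> t \<Longrightarrow> t \<le> 2 \<Longrightarrow> \<bar>phi t\<bar> \<le> C"
      and var: "\<And>s t. 0 \<le> s \<Longrightarrow> s \<le> t \<Longrightarrow> t \<le> 2 \<Longrightarrow> H s \<le> H t \<and> \<bar>phi t - phi s\<bar> \<le> C * (H t - H s)"
    have R6: "R \<ge> 6 + 2 * \<bar>th\<bar>" "R \<ge> p N" using R p1[of N] unfolding R0_def p_def by auto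
    have Rp: "R > 0" using R6 by linarith
    have intg: "phi integrable_on {a..b}" if "0 \<le> a" "b \<le> 2" for a b
      using that by (intro integrable_continuous_real continuous_on_subset[OF cont]) auto
    \<comment> \<open>Induction over windows. In window M the weight at the zero is replaced by
      1/A^2, at cost K/(M + 1), and the value of \<open>phi\<close> there by its mean over the
      window, at the cost of an increment of \<open>H\<close>. \<open>D0\<close> pays for everything
      below p N, where the zeros are not located.\<close>
    have main: "\<bar>(\<Sum>s\<in>Z (p M). q s * phi (s / R) / R) - c * integral {0..p M / R} phi\<bar>
        \<le> C / R * (D0 + (\<Sum>k\<in>{N..<M}. K / (real k + 1)) + (H (p M / R) - H (p N / R)) / A\<^sup>2)"
      if "M \<ge> N" "p M \<le> 2 * R" for M
      using that
    proof (induction M rule: dec_induct)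
      case base
      have "\<bar>\<Sum>s\<in>Z (p N). q s * phi (s / R) / R\<bar> \<le> (\<Sum>s\<in>Z (p N). q s * C / R)"
      proof (rule sum_abs[THEN order_trans], rule sum_mono)
        fix s assume "s \<in> Z (p N)"
        then have "0 \<le> s / R" "s / R \<le> 2" using Rp base by (auto simp: Z_def field_simps)
        then have "\<bar>phi (s / R)\<bar> \<le> C" by (rule bd)
        then show "\<bar>q s * phi (s / R) / R\<bar> \<le> q s * C / R"
          using Rp q0[of s] by (auto simp: abs_mult intro!: divide_right_mono mult_left_mono)
      qed
      moreover have pN: "0 \<le> p N / R" "p N / R \<le> 2"
        using base Rp p1[of N] by (auto simp: p_def field_simps)
      have "norm (integral {0..p N / R} phi) \<le> C * (p N / R - 0)"
        using pN bd by (intro integral_bound continuous_on_subset[OF cont]) auto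
      then have "c * \<bar>integral {0..p N / R} phi\<bar> \<le> c * (C * (p N / R))"
        using c by (intro mult_left_mono) auto
      ultimately have "\<bar>(\<Sum>s\<in>Z (p N). q s * phi (s / R) / R) - c * integral {0..p N / R} phi\<bar>
         \<le> (\<Sum>s\<in>Z (p N). q s * C / R) + c * (C * (p N / R))"
        using abs_mult[of c "integral {0..p N / R} phi"] c by auto
      also have "\<dots> = C / R * D0"
        unfolding D0_def by (simp add: sum_distrib_left sum_divide_distrib algebra_simps)
      finally show ?case by simp
    next
      case (step M)
      let ?a = "p M / R" and ?b = "p (Suc M) / R"
      have M: "M \<ge> N" "p M \<ge> 1" using step p1[of M] by (auto simp: p_def)
      have ab: "0 \<le> ?a" "?a \<le> ?b" "?b \<le> 2"
        using M step Rp pS[of M] by (auto simp: field_simps)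
      have IH: "\<bar>(\<Sum>s\<in>Z (p M). q s * phi (s / R) / R) - c * integral {0..?a} phi\<bar>
        \<le> C / R * (D0 + (\<Sum>k\<in>{N..<M}. K / (real k + 1)) + (H ?a - H (p N / R)) / A\<^sup>2)"
        using step.prems pS[of M] pi_gt_zero by (intro step.IH) linarith
      obtain z where z: "p M < z" "z < p (Suc M)" "v z = 0"
        and zu: "\<And>s. p M < s \<Longrightarrow> s < p (Suc M) \<Longrightarrow> v s = 0 \<Longrightarrow> s = z"
        using win[OF M(1)] unfolding p_def by metis
      \<comment> \<open>\<open>Z b\<close> contains its right endpoint, whereas the zero of a window
        lies strictly inside; so the endpoint itself must not be a zero.\<close>
      have "v (p (Suc M)) \<noteq> 0" using pnz[of "Suc M"] M by (simp add: p_def)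
      then have Zeq: "Z (p (Suc M)) = insert z (Z (p M))"
      proof (intro set_eqI iffI)
        fix x assume x: "x \<in> Z (p (Suc M))"
        show "x \<in> insert z (Z (p M))"
        proof (cases "x \<le> p M")
          case True
          then show ?thesis using x by (simp add: Z_def)
        next
          case False
          moreover have "x < p (Suc M)" "v x = 0"
            using x \<open>v (p (Suc M)) \<noteq> 0\<close> by (auto simp: Z_def order_le_less)
          ultimately show ?thesis using zu[of x] by simp
        qed
      next
        fix x assume "x \<in> insert z (Z (p M))"
        then show "x \<in> Z (p (Suc M))"
          using z M pS[of M] pi_gt_zero by (auto simp: Z_def simp del: pi_gt_zero)
      qed
      have zin: "z \<notin> Z (p M)" using z by (auto simp: Z_def)
      have zR: "?a \<le> z / R" "z / R \<le> ?b" using z Rp by (auto simp: field_simps)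
      have I: "integral {0..?b} phi = integral {0..?a} phi + integral {?a..?b} phi"
        using ab intg by (intro Henstock_Kurzweil_Integration.integral_combine[symmetric]) auto
      have dev: "\<bar>phi t - phi (z / R)\<bar> \<le> C * (H ?b - H ?a)" if "t \<in> {?a..?b}" for t
      proof (cases "t \<le> z / R")
        case True
        then have "\<bar>phi (z / R) - phi t\<bar> \<le> C * (H (z / R) - H t)"
          using var[of t "z / R"] that ab zR by auto
        also have "\<dots> \<le> C * (H ?b - H ?a)"
          using var[of ?a t] var[of "z / R" ?b] that ab zR C by (intro mult_left_mono) auto
        finally show ?thesis by (simp add: abs_minus_commute)
      next
        case False
        then have "\<bar>phi t - phi (z / R)\<bar> \<le> C * (H t - H (z / R))"
          using var[of "z / R" t] that ab zR by auto
        also have "\<dots> \<le> C * (H ?b - H ?a)"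
          using var[of ?a "z / R"] var[of t ?b] that ab zR C by (intro mult_left_mono) auto
        finally show ?thesis .
      qed
      have "norm (integral {?a..?b} (\<lambda>t. phi t - phi (z / R))) \<le> C * (H ?b - H ?a) * (?b - ?a)"
        using ab dev by (intro integral_bound continuous_intros continuous_on_subset[OF cont]) auto
      moreover have "integral {?a..?b} (\<lambda>t. phi t - phi (z / R)) = integral {?a..?b} phi - phi (z / R) * (?b - ?a)"
        using ab intg by (subst integral_diff) auto
      moreover have len: "?b - ?a = pi / R" using pS[of M] by (simp add: diff_divide_distrib[symmetric])
      ultimately have int: "\<bar>integral {?a..?b} phi - phi (z / R) * (pi / R)\<bar> \<le> C * (H ?b - H ?a) * (pi / R)"
        by simp
      have "c * \<bar>integral {?a..?b} phi - phi (z / R) * (pi / R)\<bar> \<le> c * (C * (H ?b - H ?a) * (pi / R))"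
        using int c by (intro mult_left_mono) auto
      also have "\<dots> = C / R * ((H ?b - H ?a) * (c * pi))" by simp
      also have "\<dots> = C / R * ((H ?b - H ?a) / A\<^sup>2)" unfolding cpi by simp
      finally have e1: "\<bar>c * integral {?a..?b} phi - phi (z / R) / (R * A\<^sup>2)\<bar> \<le> C / R * ((H ?b - H ?a) / A\<^sup>2)"
      proof -
        assume "c * \<bar>integral {?a..?b} phi - phi (z / R) * (pi / R)\<bar> \<le> C / R * ((H ?b - H ?a) / A\<^sup>2)"
        moreover have "c * \<bar>integral {?a..?b} phi - phi (z / R) * (pi / R)\<bar>
            = \<bar>c * (integral {?a..?b} phi - phi (z / R) * (pi / R))\<bar>" using c by (simp add: abs_mult)
        moreover have "c * (integral {?a..?b} phi - phi (z / R) * (pi / R))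
            = c * integral {?a..?b} phi - phi (z / R) / R * (c * pi)"
          by (simp add: right_diff_distrib)
        moreover have "phi (z / R) / R * (c * pi) = phi (z / R) / (R * A\<^sup>2)"
          unfolding cpi by simp
        ultimately show ?thesis by simp
      qed
      have "\<bar>q z - 1 / A\<^sup>2\<bar> \<le> K / (real M + 1)" using wt[OF M(1)] z by (simp add: q_def p_def)
      moreover have "\<bar>phi (z / R)\<bar> \<le> C" using ab zR by (intro bd) auto
      ultimately have "\<bar>q z - 1 / A\<^sup>2\<bar> * \<bar>phi (z / R)\<bar> \<le> K / (real M + 1) * C"
        using K by (intro mult_mono) auto
      then have "\<bar>(q z - 1 / A\<^sup>2) * phi (z / R)\<bar> / R \<le> K / (real M + 1) * C / R"
        using Rp by (intro divide_right_mono) (auto simp: abs_mult)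
      then have "\<bar>(q z - 1 / A\<^sup>2) * phi (z / R) / R\<bar> \<le> C / R * (K / (real M + 1))"
        using Rp by (simp add: mult_ac)
      moreover have "(q z - 1 / A\<^sup>2) * phi (z / R) / R = q z * phi (z / R) / R - phi (z / R) / (R * A\<^sup>2)"
        by (simp add: algebra_simps diff_divide_distrib)
      ultimately have e2: "\<bar>q z * phi (z / R) / R - phi (z / R) / (R * A\<^sup>2)\<bar> \<le> C / R * (K / (real M + 1))"
        by simp
      have "(\<Sum>s\<in>Z (p (Suc M)). q s * phi (s / R) / R) - c * integral {0..?b} phi
         = ((\<Sum>s\<in>Z (p M). q s * phi (s / R) / R) - c * integral {0..?a} phi)
           + (q z * phi (z / R) / R - phi (z / R) / (R * A\<^sup>2))
           - (c * integral {?a..?b} phi - phi (z / R) / (R * A\<^sup>2))"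
        unfolding Zeq I using zin finZ by (simp add: algebra_simps)
      then have "\<bar>(\<Sum>s\<in>Z (p (Suc M)). q s * phi (s / R) / R) - c * integral {0..?b} phi\<bar>
         \<le> C / R * (D0 + (\<Sum>k\<in>{N..<M}. K / (real k + 1)) + (H ?a - H (p N / R)) / A\<^sup>2)
          + C / R * (K / (real M + 1)) + C / R * ((H ?b - H ?a) / A\<^sup>2)"
        using IH e1 e2 by linarith
      also have "\<dots> = C / R * (D0 + (\<Sum>k\<in>{N..<Suc M}. K / (real k + 1)) + (H ?b - H (p N / R)) / A\<^sup>2)"
        using M by (simp add: algebra_simps diff_divide_distrib add_divide_distrib)
      finally show ?case .
    qed
    \<comment> \<open>The first window endpoint at or beyond R. Since \<open>phi\<close> vanishes
      beyond 1, the overshoot changes neither the sum nor the integral.\<close>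
    define M where "M = nat \<lceil>(R - th) / pi\<rceil>"
    have "real N \<le> (R - th) / pi" using R6 by (simp add: p_def field_simps)
    then have x: "(R - th) / pi \<ge> 0" "real N \<le> (R - th) / pi" by linarith+
    have MN: "M \<ge> N" unfolding M_def using x by linarith
    have M1: "(R - th) / pi \<le> real M" "real M < (R - th) / pi + 1" unfolding M_def using x by linarith+
    have pM: "R \<le> p M" "p M < R + pi" using M1 by (auto simp: p_def field_simps)
    then have pM2: "p M \<le> 2 * R" using R6 pi_less_4 by linarith
    have "(R - th) / pi \<le> (R + \<bar>th\<bar>) / 2" using pi_ge_two R6 by (intro frac_le) auto
    from less_le_trans[OF M1(2) add_right_mono[OF this]] have "real M < (R + \<bar>th\<bar>) / 2 + 1" .
    then have MR: "real M \<le> R" using R6(1) by argo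
    have Zsum: "(\<Sum>s\<in>{s. 0 < s \<and> s < R \<and> v s = 0}. 1 / (w s)\<^sup>2 * phi (s / R) / R)
        = (\<Sum>s\<in>Z (p M). q s * phi (s / R) / R)"
      unfolding q_def[symmetric]
    proof (rule sum.mono_neutral_left)
      show "\<forall>i\<in>Z (p M) - {s. 0 < s \<and> s < R \<and> v s = 0}. q i * phi (i / R) / R = 0"
        using pM2 Rp by (auto simp: Z_def not_less field_simps intro!: zero)
    qed (use finZ pM in \<open>auto simp: Z_def\<close>)
    have "integral {0..p M / R} phi = integral {0..1} phi + integral {1..p M / R} phi"
      using pM pM2 Rp intg by (intro Henstock_Kurzweil_Integration.integral_combine[symmetric]) (auto simp: field_simps)
    moreover have "integral {1..p M / R} phi = integral {1..p M / R} (\<lambda>t. 0)"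
    proof (intro integral_cong zero)
      fix t assume "t \<in> {1..p M / R}"
      moreover have "p M / R \<le> 2" using pM2 Rp by (simp add: field_simps)
      ultimately show "1 \<le> t" "t \<le> 2" by auto
    qed
    ultimately have Int: "integral {0..p M / R} phi = integral {0..1} phi" by simp
    have harm: "(\<Sum>k\<in>{N..<M}. K / (real k + 1)) \<le> K * (1 + ln R)"
    proof (cases "M = 0")
      case True
      then show ?thesis using K R6 by simp
    next
      case False
      have "(\<Sum>k\<in>{N..<M}. K / (real k + 1)) \<le> (\<Sum>k<M. K / (real k + 1))"
        using K by (intro sum_mono2) auto
      also have "\<dots> = K * (\<Sum>k<M. 1 / (real k + 1))" by (simp add: sum_distrib_left)
      also have "\<dots> \<le> K * (1 + ln (real M))" using False K sum_inverse_le_ln[of M]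
        by (intro mult_left_mono) auto
      also have "\<dots> \<le> K * (1 + ln R)" using False K MR by (intro mult_left_mono) auto
      finally show ?thesis .
    qed
    have "0 \<le> p M / R" "p M / R \<le> 2" "0 \<le> p N / R" "p N / R \<le> 2"
      using Rp pM pM2 R6 p1[of N] by (auto simp: p_def field_simps)
    then have HH: "H (p M / R) \<le> H 2" "H 0 \<le> H (p N / R)" "H 0 \<le> H 2"
      using var[of "p M / R" 2] var[of 0 "p N / R"] var[of 0 2] by auto
    then have Hd: "(H (p M / R) - H (p N / R)) / A\<^sup>2 \<le> (H 2 - H 0) / A\<^sup>2"
      by (intro divide_right_mono) auto
    have lnR: "ln R \<ge> 0" using R6 by simp
    have "(D0 + K + 1 / A\<^sup>2) * (1 + (H 2 - H 0) + ln R) - (D0 + K * (1 + ln R) + (H 2 - H 0) / A\<^sup>2)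
       = D0 * (H 2 - H 0 + ln R) + K * (H 2 - H 0) + 1 / A\<^sup>2 * (1 + ln R)"
      by (simp add: algebra_simps add_divide_distrib diff_divide_distrib)
    moreover have "0 \<le> D0 * (H 2 - H 0 + ln R)" "0 \<le> K * (H 2 - H 0)" "0 \<le> 1 / A\<^sup>2 * (1 + ln R)"
      using D0 K HH lnR by auto
    ultimately have "D0 + K * (1 + ln R) + (H 2 - H 0) / A\<^sup>2 \<le> (D0 + K + 1 / A\<^sup>2) * (1 + (H 2 - H 0) + ln R)"
      by linarith
    then have "D0 + (\<Sum>k\<in>{N..<M}. K / (real k + 1)) + (H (p M / R) - H (p N / R)) / A\<^sup>2
       \<le> (D0 + K + 1 / A\<^sup>2) * (1 + (H 2 - H 0) + ln R)"
      using harm Hd by linarith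
    then have "C / R * (D0 + (\<Sum>k\<in>{N..<M}. K / (real k + 1)) + (H (p M / R) - H (p N / R)) / A\<^sup>2)
       \<le> C / R * ((D0 + K + 1 / A\<^sup>2) * (1 + (H 2 - H 0) + ln R))"
      using C Rp by (intro mult_left_mono) auto
    then show "\<bar>(\<Sum>s\<in>{s. 0 < s \<and> s < R \<and> v s = 0}. 1 / (w s)\<^sup>2 * phi (s / R) / R)
           - 1 / (pi * A\<^sup>2) * integral {0..1} phi\<bar> \<le> (D0 + K + 1 / A\<^sup>2) * C * (1 + (H 2 - H 0) + ln R) / R"
      using main[OF MN pM2] unfolding Zsum Int c_def[symmetric] by (simp add: mult_ac)
  qed
qed

end

section \<open>Numbering the zeros\<close>

lemma bij_betw_rank:
  fixes Z :: "'a :: linorder set"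
  assumes fin: "\<And>b. finite {t \<in> Z. t < b}" and inf: "infinite Z"
  shows "bij_betw (\<lambda>s. card {t \<in> Z. t < s}) Z UNIV"
proof -
  define rank where "rank s = card {t \<in> Z. t < s}" for s
  have mono: "rank s < rank t" if "s \<in> Z" "s < t" for s t
    unfolding rank_def using that fin by (intro psubset_card_mono) auto
  have inj: "inj_on rank Z"
    by (rule inj_onI) (metis mono linorder_neqE nat_neq_iff)
  \<comment> \<open>The ranks are unbounded, and they leave no gaps: the elements below s have
    rank(s) distinct ranks, all below rank(s), hence every number below it.\<close>
  have "rank ` Z = UNIV"
  proof (intro set_eqI iffI UNIV_I)
    fix m
    have "infinite (rank ` Z)" using inf inj by (simp add: finite_image_iff)
    then obtain s where s: "s \<in> Z" "rank s > m"
      by (metis (no_types, lifting) finite_nat_set_iff_bounded_le imageE not_le)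
    let ?B = "{t \<in> Z. t < s}"
    have "inj_on rank ?B" using inj by (rule inj_on_subset) auto
    then have "card (rank ` ?B) = rank s" unfolding rank_def[of s] by (rule card_image)
    moreover have "rank ` ?B \<subseteq> {..<rank s}" using mono by auto
    ultimately have "rank ` ?B = {..<rank s}" by (intro card_subset_eq) auto
    then show "m \<in> rank ` Z" using s by (metis (no_types, lifting) imageE imageI lessThan_iff mem_Collect_eq)
  qed
  then show ?thesis using inj unfolding bij_betw_def rank_def by simp
qed

text \<open>The definite description in \<open>bessel_zero\<close> denotes something only if each
  rank is attained exactly once. With finitely many zeros below each bound and infinitely many in
  all, it is the inverse of the rank function.\<close>

lemma bessel_zero_bij:
  assumes fin: "\<And>b. finite {t. 0 < t \<and> t < b \<and> besselJ nu t = 0}"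
    and inf: "infinite {t. 0 < t \<and> besselJ nu t = 0}"
  shows "bij_betw (bessel_zero nu) UNIV {t. 0 < t \<and> besselJ nu t = 0}"
proof -
  define Z where "Z = {t. 0 < t \<and> besselJ nu t = 0}"
  define rank where "rank s = card {t \<in> Z. t < s}" for s
  have below: "{t \<in> Z. t < s} = {t. 0 < t \<and> t < s \<and> besselJ nu t = 0}" for s
    by (auto simp: Z_def)
  have b: "bij_betw rank Z UNIV"
    unfolding rank_def using bij_betw_rank[of Z] fin inf by (simp add: below Z_def[symmetric])
  have "bessel_zero nu j = inv_into Z rank j" for j
    unfolding bessel_zero_def
  proof (rule the_equality)
    show "0 < inv_into Z rank j \<and> besselJ nu (inv_into Z rank j) = 0 \<and>
       card {t. 0 < t \<and> t < inv_into Z rank j \<and> besselJ nu t = 0} = j"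
      using bij_betw_inv_into_right[OF b, of j] inv_into_into[of j rank Z] b
      unfolding rank_def below by (auto simp: bij_betw_def Z_def)
  next
    fix s assume "0 < s \<and> besselJ nu s = 0 \<and> card {t. 0 < t \<and> t < s \<and> besselJ nu t = 0} = j"
    then have "s \<in> Z" "rank s = j" unfolding rank_def below by (auto simp: Z_def)
    then show "s = inv_into Z rank j" using bij_betw_inv_into_left[OF b] by auto
  qed
  then have "bessel_zero nu = inv_into Z rank" by auto
  then show ?thesis using bij_betw_inv_into[OF b] by (simp add: Z_def)
qed

section \<open>Bessel functions as oscillators\<close>

lemma besselJ_eq_clifford:
  assumes "mu > -1" "x > 0"
  shows "besselJ mu x = (x / 2) powr mu * clifford mu (x\<^sup>2 / 4)"
proof -
  have "(-1) ^ m / (fact m * Gamma (real m + mu + 1)) * (x / 2) powr (2 * real m + mu)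
      = (x / 2) powr mu * ((-1) ^ m * rGamma (real m + mu + 1) / fact m * (x\<^sup>2 / 4) ^ m)" for m
  proof -
    have "(x / 2) powr (2 * real m + mu) = (x / 2) powr mu * (x / 2) powr real (2 * m)"
      by (simp add: powr_add[symmetric] add_ac)
    also have "(x / 2) powr real (2 * m) = (x / 2) ^ (2 * m)"
      using assms by (subst powr_realpow) auto
    also have "\<dots> = (x\<^sup>2 / 4) ^ m" by (simp add: power_mult power_divide)
    finally show ?thesis by (simp add: Gamma_def field_simps)
  qed
  then show ?thesis
    unfolding besselJ_def clifford_def
    using suminf_mult[OF clifford_summable[OF assms(1)], of "(x / 2) powr mu" "x\<^sup>2 / 4"] by simp
qed

lemma clifford_pos_near_0:
  assumes "mu > -1"
  obtains e where "e > 0" "\<And>u. 0 \<le> u \<Longrightarrow> u \<le> e \<Longrightarrow> clifford mu u > 0"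
proof -
  have "(clifford mu \<longlongrightarrow> clifford mu 0) (at 0)"
    using clifford_has_deriv[OF assms, of 0] by (simp add: DERIV_isCont isContD)
  moreover have p: "clifford mu 0 > 0" using assms by (simp add: clifford_0 rGamma_pos)
  ultimately have "eventually (\<lambda>u. clifford mu u > 0) (at 0)" by (rule order_tendstoD)
  then obtain d where d: "d > 0" "\<And>u. u \<noteq> 0 \<Longrightarrow> dist u 0 < d \<Longrightarrow> clifford mu u > 0"
    unfolding eventually_at by auto
  show ?thesis
  proof (rule that[of "d / 2"])
    fix u :: real assume "0 \<le> u" "u \<le> d / 2"
    then show "clifford mu u > 0" using d(2)[of u] d(1) p by (cases "u = 0") (auto simp: dist_real_def)
  qed (use d in simp)
qed

text \<open>\<open>bessel_v mu s\<close> is \<open>2 powr mu * sqrt s * besselJ mu s\<close>, and \<open>bessel_w mu\<close> is its derivative; this normalisation removes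
  the first-order term from Bessel's equation.\<close>

definition bessel_v :: "real \<Rightarrow> real \<Rightarrow> real" where
  "bessel_v mu s = s powr (mu + 1/2) * clifford mu (s\<^sup>2 / 4)"

definition bessel_w :: "real \<Rightarrow> real \<Rightarrow> real" where
  "bessel_w mu s = (mu + 1/2) * s powr (mu - 1/2) * clifford mu (s\<^sup>2 / 4)
     - s powr (mu + 3/2) / 2 * clifford (mu + 1) (s\<^sup>2 / 4)"

lemma bessel_v_pos_near_0:
  assumes "mu > -1"
  obtains e where "e > 0" "\<And>s. 0 < s \<Longrightarrow> s \<le> e \<Longrightarrow> bessel_v mu s > 0"
proof -
  obtain e where e: "e > 0" "\<And>u. 0 \<le> u \<Longrightarrow> u \<le> e \<Longrightarrow> clifford mu u > 0"
    using clifford_pos_near_0[OF assms] by metis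
  show ?thesis
  proof (rule that[of "sqrt (4 * e)"])
    fix s assume s: "0 < s" "s \<le> sqrt (4 * e)"
    then have "s\<^sup>2 \<le> (sqrt (4 * e))\<^sup>2" by (intro power_mono) auto
    then have "s\<^sup>2 / 4 \<le> e" using e by simp
    then show "bessel_v mu s > 0" unfolding bessel_v_def using s e(2)[of "s\<^sup>2 / 4"] by simp
  qed (use e in simp)
qed

text \<open>In the second derivative the terms of orders mu + 1 and mu + 2 are exactly -s^2 times
  the right side of \<open>clifford_rec\<close>, up to a common power of s, and so collapse to order
  mu. The value \<open>s0\<close> comes from positivity near 0.\<close>

lemma bessel_oscillator:
  assumes mu: "mu > -1"
  obtains s0 where "perturbed_oscillator (bessel_v mu) (bessel_w mu) (mu\<^sup>2 - 1/4) s0"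
proof -
  obtain e where e: "e > 0" "\<And>s. 0 < s \<Longrightarrow> s \<le> e \<Longrightarrow> bessel_v mu s > 0"
    using bessel_v_pos_near_0[OF mu] by metis
  show ?thesis
  proof (rule that[of e], unfold_locales)
    fix s :: real assume s: "s > 0"
    \<comment> \<open>The lowest power of s that occurs; every other one is q times a monomial,
      which leaves a polynomial identity.\<close>
    define q where "q = s powr (mu - 3/2)"
    have q: "s powr (mu - 1/2) = q * s" "s powr (mu + 1/2) = q * s\<^sup>2" "s powr (mu + 3/2) = q * s ^ 3"
      using s powr_add[of s "mu - 3/2" 1] powr_add[of s "mu - 3/2" 2] powr_add[of s "mu - 3/2" 3]
      by (simp_all add: q_def add.commute)
    have q': "s powr (mu + 1/2 - 1) = q * s" "s powr (mu - 1/2 - 1) = q" "s powr (mu + 3/2 - 1) = q * s\<^sup>2"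
      using q by (simp_all add: q_def add.commute)
    have rec: "clifford mu (s\<^sup>2 / 4) = (mu + 1) * clifford (mu + 1) (s\<^sup>2 / 4) - s\<^sup>2 / 4 * clifford (mu + 2) (s\<^sup>2 / 4)"
      using clifford_rec[OF mu] .
    show "(bessel_v mu has_real_derivative bessel_w mu s) (at s)"
      unfolding bessel_v_def[abs_def] bessel_w_def
      using s mu
      by (auto intro!: derivative_eq_intros clifford_deriv simp: q q' power2_eq_square power3_eq_cube algebra_simps)
    show "(bessel_w mu has_real_derivative ((mu\<^sup>2 - 1/4) / s\<^sup>2 - 1) * bessel_v mu s) (at s)"
    proof -
      have "(bessel_w mu has_real_derivative
         (mu + 1/2) * ((mu - 1/2) * s powr (mu - 1/2 - 1)) * clifford mu (s\<^sup>2 / 4)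
         + (mu + 1/2) * s powr (mu - 1/2) * (- clifford (mu + 1) (s\<^sup>2 / 4) * (s / 2))
         - ((mu + 3/2) * s powr (mu + 3/2 - 1) / 2 * clifford (mu + 1) (s\<^sup>2 / 4)
            + s powr (mu + 3/2) / 2 * (- clifford (mu + 1 + 1) (s\<^sup>2 / 4) * (s / 2)))) (at s)"
        unfolding bessel_w_def[abs_def]
        using s mu
        by (auto intro!: derivative_eq_intros clifford_deriv
              simp: q q_def[symmetric] power2_eq_square power3_eq_cube field_simps)
      moreover have "(mu + 1/2) * ((mu - 1/2) * s powr (mu - 1/2 - 1)) * clifford mu (s\<^sup>2 / 4)
         + (mu + 1/2) * s powr (mu - 1/2) * (- clifford (mu + 1) (s\<^sup>2 / 4) * (s / 2))
         - ((mu + 3/2) * s powr (mu + 3/2 - 1) / 2 * clifford (mu + 1) (s\<^sup>2 / 4)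
            + s powr (mu + 3/2) / 2 * (- clifford (mu + 1 + 1) (s\<^sup>2 / 4) * (s / 2)))
         = (mu\<^sup>2 - 1/4) * q * clifford mu (s\<^sup>2 / 4)
         - q * s\<^sup>2 * ((mu + 1) * clifford (mu + 1) (s\<^sup>2 / 4) - s\<^sup>2 / 4 * clifford (mu + 2) (s\<^sup>2 / 4))"
        unfolding q q' by (simp add: power2_eq_square power3_eq_cube field_simps)
      moreover have "\<dots> = ((mu\<^sup>2 - 1/4) / s\<^sup>2 - 1) * bessel_v mu s"
        unfolding rec[symmetric] bessel_v_def q using s by (simp add: field_simps)
      ultimately show ?thesis by simp
    qed
  qed (use e in auto, use e(2)[of e] in auto)
qed

lemma bessel_v_eq_0_iff: "s > 0 \<Longrightarrow> bessel_v mu s = 0 \<longleftrightarrow> clifford mu (s\<^sup>2 / 4) = 0"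
  by (simp add: bessel_v_def)

lemma besselJ_eq_0_iff: "mu > -1 \<Longrightarrow> s > 0 \<Longrightarrow> besselJ mu s = 0 \<longleftrightarrow> bessel_v mu s = 0"
  by (simp add: bessel_v_def besselJ_eq_clifford)

section \<open>Asymptotics and decay of the Bessel--Clifford functions\<close>

lemma clifford_asymptotics:
  assumes mu: "mu > -1"
  obtains A th K where "A > 0" "K > 0"
    "\<And>s. s \<ge> 1 \<Longrightarrow> \<bar>clifford mu (s\<^sup>2 / 4) - s powr (- mu - 1/2) * (A * cos (s - th))\<bar> \<le> K * s powr (- mu - 3/2)"
proof -
  obtain s0 where "perturbed_oscillator (bessel_v mu) (bessel_w mu) (mu\<^sup>2 - 1/4) s0"
    using bessel_oscillator[OF mu] .
  then interpret perturbed_oscillator "bessel_v mu" "bessel_w mu" "mu\<^sup>2 - 1/4" s0 .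
  obtain A th K where A: "A > 0" "K > 0"
    and v: "\<And>s. s \<ge> 1 \<Longrightarrow> \<bar>bessel_v mu s - A * cos (s - th)\<bar> \<le> K / s"
    using asymptotics by metis
  show ?thesis
  proof (rule that[OF A])
    fix s :: real assume s: "s \<ge> 1"
    have "s powr (- mu - 1/2) * s powr (mu + 1/2) = 1" using s by (simp flip: powr_add)
    then have "clifford mu (s\<^sup>2 / 4) - s powr (- mu - 1/2) * (A * cos (s - th))
       = s powr (- mu - 1/2) * (bessel_v mu s - A * cos (s - th))"
      unfolding bessel_v_def by (simp add: right_diff_distrib mult.assoc[symmetric])
    then have "\<bar>clifford mu (s\<^sup>2 / 4) - s powr (- mu - 1/2) * (A * cos (s - th))\<bar>
       \<le> s powr (- mu - 1/2) * (K / s)"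
      using mult_left_mono[OF v[OF s], of "s powr (- mu - 1/2)"] by (simp add: abs_mult)
    also have "s powr (- mu - 1/2) * (K / s) = K * s powr (- mu - 3/2)"
    proof -
      have "- mu - 1/2 = (- mu - 3/2) + 1" by simp
      then have "s powr (- mu - 1/2) = s powr (- mu - 3/2) * s"
        using s powr_add[of s "- mu - 3/2" 1] by (simp only:) simp
      then show ?thesis using s by simp
    qed
    finally show "\<bar>clifford mu (s\<^sup>2 / 4) - s powr (- mu - 1/2) * (A * cos (s - th))\<bar> \<le> K * s powr (- mu - 3/2)" .
  qed
qed

lemma clifford_decay:
  assumes mu: "mu > -1"
  obtains C where "C > 0" "\<And>s. s \<ge> 1 \<Longrightarrow> \<bar>clifford mu (s\<^sup>2 / 4)\<bar> \<le> C * s powr (- mu - 1/2)"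
proof -
  obtain A th K where A: "A > 0" "K > 0" and
    a: "\<And>s. s \<ge> 1 \<Longrightarrow> \<bar>clifford mu (s\<^sup>2 / 4) - s powr (- mu - 1/2) * (A * cos (s - th))\<bar> \<le> K * s powr (- mu - 3/2)"
    using clifford_asymptotics[OF mu] by metis
  show ?thesis
  proof (rule that[of "A + K"])
    fix s :: real assume s: "s \<ge> 1"
    have "s powr (- mu - 3/2) \<le> s powr (- mu - 1/2)" using s by (intro powr_mono) auto
    then have "K * s powr (- mu - 3/2) \<le> K * s powr (- mu - 1/2)" using A by simp
    moreover have "\<bar>s powr (- mu - 1/2) * (A * cos (s - th))\<bar> \<le> s powr (- mu - 1/2) * (A * 1)"
      unfolding abs_mult using A by (intro mult_mono) auto
    ultimately show "\<bar>clifford mu (s\<^sup>2 / 4)\<bar> \<le> (A + K) * s powr (- mu - 1/2)"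
      using a[OF s] by (simp add: algebra_simps)
  qed (use A in simp)
qed

text \<open>The decay exponent mu + 1/2 absorbs k powers of s at infinity, and [0, 1] is compact.
  With k = 1 it keeps the t-derivative of \<open>clifford nu (z^2/4 * t^2)\<close> linear in z
  although the chain rule produces z^2.\<close>

lemma clifford_bounded:
  assumes mu: "mu > -1" and k: "real k \<le> mu + 1/2"
  obtains C where "C > 0" "\<And>s. s \<ge> 0 \<Longrightarrow> s ^ k * \<bar>clifford mu (s\<^sup>2 / 4)\<bar> \<le> C"
proof -
  obtain C where C: "C > 0" "\<And>s. s \<ge> 1 \<Longrightarrow> \<bar>clifford mu (s\<^sup>2 / 4)\<bar> \<le> C * s powr (- mu - 1/2)"
    using clifford_decay[OF mu] by metis
  have "continuous_on {0..1} (\<lambda>s. s ^ k * clifford mu (s\<^sup>2 / 4))"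
    using mu by (intro continuous_intros) auto
  then have "bounded ((\<lambda>s. s ^ k * clifford mu (s\<^sup>2 / 4)) ` {0..1::real})"
    by (intro compact_imp_bounded compact_continuous_image) auto
  then obtain B where B: "\<forall>s\<in>{0..1}. \<bar>s ^ k * clifford mu (s\<^sup>2 / 4)\<bar> \<le> B"
    unfolding bounded_iff by auto
  show ?thesis
  proof (rule that[of "C + \<bar>B\<bar>"])
    fix s :: real assume s: "s \<ge> 0"
    show "s ^ k * \<bar>clifford mu (s\<^sup>2 / 4)\<bar> \<le> C + \<bar>B\<bar>"
    proof (cases "s \<le> 1")
      case True
      then have "\<bar>s ^ k * clifford mu (s\<^sup>2 / 4)\<bar> \<le> B" using B s by auto
      then show ?thesis using s C by (simp add: abs_mult)
    next
      case False
      then have "s ^ k * \<bar>clifford mu (s\<^sup>2 / 4)\<bar> \<le> s ^ k * (C * s powr (- mu - 1/2))"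
        using C by (intro mult_left_mono) auto
      also have "\<dots> = C * s powr (real k - mu - 1/2)"
        using False by (simp flip: powr_realpow powr_add add: add_diff_eq)
      also have "\<dots> \<le> C * s powr 0" using C False k by (intro mult_left_mono powr_mono) auto
      finally show ?thesis using False by simp
    qed
  qed (use C in simp)
qed

lemma clifford_bounded_nonneg:
  assumes mu: "mu \<ge> -1/2"
  obtains C where "C > 0" "\<And>u. u \<ge> 0 \<Longrightarrow> \<bar>clifford mu u\<bar> \<le> C"
proof -
  obtain C where C: "C > 0" "\<And>s. s \<ge> 0 \<Longrightarrow> s ^ 0 * \<bar>clifford mu (s\<^sup>2 / 4)\<bar> \<le> C"
    using clifford_bounded[of mu 0] mu by auto
  show ?thesis
  proof (rule that[OF C(1)])
    fix u :: real assume "u \<ge> 0"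
    then show "\<bar>clifford mu u\<bar> \<le> C" using C(2)[of "2 * sqrt u"] by (simp add: power_mult_distrib)
  qed
qed

section \<open>The profile of the Bochner--Riesz means\<close>

text \<open>Arises from the sum over zeros \<open>s\<close> defining the mean, with \<open>t = s / R\<close>, \<open>a = eta^2 / 4\<close> and \<open>y = z^2 / 4\<close>, where the set is
  \<open>(0, eta / R)\<close> and the point is \<open>z / R\<close>.\<close>

definition riesz_profile :: "real \<Rightarrow> real \<Rightarrow> real \<Rightarrow> real \<Rightarrow> real \<Rightarrow> real" where
  "riesz_profile nu delta a y t =
     max 0 (1 - t\<^sup>2) powr delta * t powr (2 * nu + 1)
       * (clifford (nu + 1) (a * t\<^sup>2) * clifford nu (y * t\<^sup>2))"

lemma riesz_profile_continuous:
  assumes "nu > -1/2" "delta > 0"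
  shows "continuous_on {0..b} (riesz_profile nu delta a y)"
  unfolding riesz_profile_def[abs_def] using assms
  by (intro continuous_intros continuous_on_powr') auto

text \<open>The factors (1 - t^2)^delta and t^(2 nu + 1) need not be Lipschitz at t = 1 and t = 0,
  but both are monotone and bounded, so they enter through their own increments. Only the smooth
  product of Clifford functions goes through the mean value theorem, which costs 1 + z. The three
  increments together form the majorant \<open>H\<close> for the sum over zeros, with C independent
  of z.\<close>

lemma riesz_profile_bounds:
  assumes nu: "nu > -1/2" and delta: "delta > 0" and a: "a \<ge> 0"
  obtains C where "C > 0"
    "\<And>z t. z \<ge> 0 \<Longrightarrow> 0 \<le> t \<Longrightarrow> t \<le> 2 \<Longrightarrow> \<bar>riesz_profile nu delta a (z\<^sup>2 / 4) t\<bar> \<le> C"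
    "\<And>z s t. z \<ge> 0 \<Longrightarrow> 0 \<le> s \<Longrightarrow> s \<le> t \<Longrightarrow> t \<le> 2 \<Longrightarrow>
       \<bar>riesz_profile nu delta a (z\<^sup>2 / 4) t - riesz_profile nu delta a (z\<^sup>2 / 4) s\<bar>
         \<le> C * ((max 0 (1 - s\<^sup>2) powr delta - max 0 (1 - t\<^sup>2) powr delta)
                + (t powr (2 * nu + 1) - s powr (2 * nu + 1)) + (1 + z) * (t - s))"
proof -
  have nus: "nu \<ge> -1/2" "nu + 1 \<ge> -1/2" "nu + 2 \<ge> -1/2" "nu + 1 > -1" "real 1 \<le> nu + 1 + 1/2"
    using nu by auto
  obtain C1 where C1: "C1 > 0" "\<And>u. u \<ge> 0 \<Longrightarrow> \<bar>clifford (nu + 1) u\<bar> \<le> C1"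
    using clifford_bounded_nonneg[OF nus(2)] by metis
  obtain C2 where C2: "C2 > 0" "\<And>u. u \<ge> 0 \<Longrightarrow> \<bar>clifford nu u\<bar> \<le> C2"
    using clifford_bounded_nonneg[OF nus(1)] by metis
  obtain C3 where C3: "C3 > 0" "\<And>u. u \<ge> 0 \<Longrightarrow> \<bar>clifford (nu + 2) u\<bar> \<le> C3"
    using clifford_bounded_nonneg[OF nus(3)] by metis
  obtain C4 where C4: "C4 > 0" "\<And>s. s \<ge> 0 \<Longrightarrow> s ^ 1 * \<bar>clifford (nu + 1) (s\<^sup>2 / 4)\<bar> \<le> C4"
    using clifford_bounded[OF nus(4,5)] by metis
  define L where "L = 4 * a * C3 * C2 + C1 * C4"
  have L: "L \<ge> 0" using a C1 C2 C3 C4 by (simp add: L_def)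
  define B0 where "B0 = 2 powr (2 * nu + 1)"
  have B0: "B0 > 0" by (simp add: B0_def)
  define A where "A t = max 0 (1 - t\<^sup>2) powr delta" for t :: real
  define B where "B t = t powr (2 * nu + 1)" for t :: real
  define D where "D z t = clifford (nu + 1) (a * t\<^sup>2) * clifford nu (z\<^sup>2 / 4 * t\<^sup>2)" for z t :: real
  have phi: "riesz_profile nu delta a (z\<^sup>2 / 4) t = A t * B t * D z t" for z t
    by (simp add: riesz_profile_def A_def B_def D_def)
  have A: "0 \<le> A t" "A t \<le> 1" for t
  proof -
    have "max 0 (1 - t\<^sup>2) powr delta \<le> 1 powr delta" using delta by (intro powr_mono2) auto
    then show "0 \<le> A t" "A t \<le> 1" by (auto simp: A_def)
  qed
  have A_anti: "A t \<le> A s" if "0 \<le> s" "s \<le> t" for s t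
  proof -
    have "s\<^sup>2 \<le> t\<^sup>2" using that by (intro power_mono)
    then show ?thesis unfolding A_def using delta by (intro powr_mono2) auto
  qed
  have B: "0 \<le> B t" "B t \<le> B0" if "0 \<le> t" "t \<le> 2" for t
    unfolding B_def B0_def using nu that by (auto intro!: powr_mono2)
  have B_mono: "B s \<le> B t" if "0 \<le> s" "s \<le> t" for s t
    unfolding B_def using nu that by (intro powr_mono2) auto
  have D: "\<bar>D z t\<bar> \<le> C1 * C2" for z t
    unfolding D_def abs_mult using a C1 C2 by (intro mult_mono) auto
  have D_diff: "\<bar>D z t - D z s\<bar> \<le> L * (1 + z) * (t - s)" if z: "z \<ge> 0" and st: "0 \<le> s" "s < t" "t \<le> 2" for z s t
  proof -
    define D' where "D' t = - clifford (nu + 2) (a * t\<^sup>2) * (2 * a * t) * clifford nu (z\<^sup>2 / 4 * t\<^sup>2)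
        + clifford (nu + 1) (a * t\<^sup>2) * (- clifford (nu + 1) (z\<^sup>2 / 4 * t\<^sup>2) * (z\<^sup>2 / 4 * (2 * t)))" for t
    have "(D z has_real_derivative D' t) (at t)" for t
    proof -
      have "nu + 1 + 1 = nu + 2" by simp
      then show ?thesis
        unfolding D_def[abs_def] D'_def using nu
        by (auto intro!: derivative_eq_intros clifford_deriv simp: algebra_simps)
    qed
    then have "\<exists>x>s. x < t \<and> D z t - D z s = (t - s) * D' x"
      using st by (intro MVT2) auto
    then obtain x where x: "s < x" "x < t" "D z t - D z s = (t - s) * D' x" by blast
    have "\<bar>clifford (nu + 2) (a * x\<^sup>2)\<bar> * (2 * a * x) * \<bar>clifford nu (z\<^sup>2 / 4 * x\<^sup>2)\<bar> \<le> C3 * (2 * a * 2) * C2"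
      using x st a C3 C2 by (intro mult_mono mult_nonneg_nonneg) auto
    then have t1: "\<bar>- clifford (nu + 2) (a * x\<^sup>2) * (2 * a * x) * clifford nu (z\<^sup>2 / 4 * x\<^sup>2)\<bar> \<le> 4 * a * C3 * C2"
      using x st a by (simp add: abs_mult mult_ac)
    have "(z * x) ^ 1 * \<bar>clifford (nu + 1) ((z * x)\<^sup>2 / 4)\<bar> \<le> C4" using z x st by (intro C4) auto
    then have "\<bar>clifford (nu + 1) (a * x\<^sup>2)\<bar> * (z * (z * x * \<bar>clifford (nu + 1) ((z * x)\<^sup>2 / 4)\<bar>)) \<le> C1 * (z * C4)"
      using x st a C1 C4 z by (intro mult_mono mult_nonneg_nonneg) auto
    then have t2: "\<bar>clifford (nu + 1) (a * x\<^sup>2) * (- clifford (nu + 1) (z\<^sup>2 / 4 * x\<^sup>2) * (z\<^sup>2 / 4 * (2 * x)))\<bar> * 2 \<le> C1 * (z * C4)"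
      using x st z by (simp add: abs_mult power_mult_distrib mult_ac power2_eq_square)
    have "0 \<le> C1 * (z * C4)" using C1 C4 z by simp
    then have "\<bar>D' x\<bar> \<le> 4 * a * C3 * C2 + C1 * (z * C4)" using t1 t2 unfolding D'_def by linarith
    also have "\<dots> \<le> L * (1 + z)" using a C1 C2 C3 C4 z by (simp add: L_def algebra_simps)
    finally have "\<bar>D' x\<bar> * (t - s) \<le> L * (1 + z) * (t - s)" using st by (intro mult_right_mono) auto
    then show ?thesis using x st by (simp add: abs_mult mult_ac)
  qed
  define C where "C = B0 * (C1 * C2) + C1 * C2 + B0 * L"
  show ?thesis
  proof (rule that[of C])
    show "C > 0" using B0 C1 C2 L by (simp add: C_def add_pos_nonneg)
  next
    fix z t :: real assume t: "z \<ge> 0" "0 \<le> t" "t \<le> 2"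
    have "\<bar>A t * B t * D z t\<bar> \<le> 1 * B0 * (C1 * C2)"
      unfolding abs_mult using A[of t] B[OF t(2,3)] D[of z t] C1 C2 B0 by (intro mult_mono mult_nonneg_nonneg) auto
    also have "\<dots> \<le> C" using B0 C1 C2 L by (simp add: C_def)
    finally show "\<bar>riesz_profile nu delta a (z\<^sup>2 / 4) t\<bar> \<le> C" unfolding phi .
  next
    fix z s t :: real assume z: "z \<ge> 0" and st: "0 \<le> s" "s \<le> t" "t \<le> 2"
    define X where "X = A s - A t"
    define Y where "Y = B t - B s"
    define W where "W = (1 + z) * (t - s)"
    have X: "X \<ge> 0" using A_anti st by (simp add: X_def)
    have Y: "Y \<ge> 0" using B_mono st by (simp add: Y_def)
    have W: "W \<ge> 0" using z st by (simp add: W_def)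
    have dD: "\<bar>D z t - D z s\<bar> \<le> L * W"
      using D_diff[OF z, of s t] st by (cases "s = t") (auto simp: W_def)
    have "\<bar>(A t - A s) * B t * D z t\<bar> \<le> X * B0 * (C1 * C2)"
      unfolding abs_mult using B[of t] D[of z t] st C1 C2 B0 X
      by (intro mult_mono mult_nonneg_nonneg) (auto simp: X_def)
    moreover have "\<bar>A s * (B t - B s) * D z t\<bar> \<le> 1 * Y * (C1 * C2)"
      unfolding abs_mult using A[of s] D[of z t] st C1 C2 Y
      by (intro mult_mono mult_nonneg_nonneg) (auto simp: Y_def)
    moreover have "\<bar>A s * B s * (D z t - D z s)\<bar> \<le> 1 * B0 * (L * W)"
      unfolding abs_mult using A[of s] B[of s] dD st B0 L W
      by (intro mult_mono mult_nonneg_nonneg) auto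
    moreover have "A t * B t * D z t - A s * B s * D z s
       = (A t - A s) * B t * D z t + A s * (B t - B s) * D z t + A s * B s * (D z t - D z s)"
      by (simp add: algebra_simps)
    ultimately have "\<bar>A t * B t * D z t - A s * B s * D z s\<bar>
       \<le> B0 * (C1 * C2) * X + C1 * C2 * Y + B0 * L * W"
      by (simp add: mult_ac)
    also have "\<dots> \<le> C * X + C * Y + C * W"
      using X Y W B0 C1 C2 L by (intro add_mono mult_right_mono) (auto simp: C_def)
    finally show "\<bar>riesz_profile nu delta a (z\<^sup>2 / 4) t - riesz_profile nu delta a (z\<^sup>2 / 4) s\<bar>
         \<le> C * ((max 0 (1 - s\<^sup>2) powr delta - max 0 (1 - t\<^sup>2) powr delta)
                + (t powr (2 * nu + 1) - s powr (2 * nu + 1)) + (1 + z) * (t - s))"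
      unfolding phi by (simp add: X_def Y_def W_def A_def B_def algebra_simps)
  qed
qed

section \<open>Fourier--Bessel coefficients of an interval at the origin\<close>

lemma clifford_moment:
  assumes nu: "nu > -1/2" and e: "e > 0"
  shows "((\<lambda>x. x powr (2 * nu + 1) * clifford nu (b * x\<^sup>2)) has_integral
           e powr (2 * nu + 2) / 2 * clifford (nu + 1) (b * e\<^sup>2)) {0..e}"
proof -
  \<comment> \<open>The primitive is the identity d/dx (x^(nu+1) J_(nu+1)(x)) = x^(nu+1) J_nu(x) in
    Clifford form; the recurrence collapses its derivative to order nu.\<close>
  define F where "F x = x powr (2 * nu + 2) / 2 * clifford (nu + 1) (b * x\<^sup>2)" for x
  have "((\<lambda>x. x powr (2 * nu + 1) * clifford nu (b * x\<^sup>2)) has_integral F e - F 0) {0..e}"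
  proof (rule fundamental_theorem_of_calculus_interior)
    show "continuous_on {0..e} F"
      unfolding F_def using nu by (intro continuous_intros continuous_on_powr') auto
    fix x assume x: "x \<in> {0<..<e}"
    have p: "x powr (2 * nu + 2) = x powr (2 * nu + 1) * x"
      using x powr_add[of x "2 * nu + 1" 1] by (simp add: add.commute add.left_commute)
    have rec: "clifford nu (b * x\<^sup>2) = (nu + 1) * clifford (nu + 1) (b * x\<^sup>2) - b * x\<^sup>2 * clifford (nu + 2) (b * x\<^sup>2)"
      using nu by (intro clifford_rec) simp
    have "(F has_real_derivative (2 * nu + 2) * x powr (2 * nu + 2 - 1) / 2 * clifford (nu + 1) (b * x\<^sup>2)
        + x powr (2 * nu + 2) / 2 * (- clifford (nu + 1 + 1) (b * x\<^sup>2) * (b * (2 * x)))) (at x)"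
      unfolding F_def[abs_def] using nu x
      by (auto intro!: derivative_eq_intros clifford_deriv simp: field_simps)
    moreover have "(2 * nu + 2) * x powr (2 * nu + 2 - 1) / 2 * clifford (nu + 1) (b * x\<^sup>2)
        + x powr (2 * nu + 2) / 2 * (- clifford (nu + 1 + 1) (b * x\<^sup>2) * (b * (2 * x)))
        = x powr (2 * nu + 1) * clifford nu (b * x\<^sup>2)"
    proof -
      have 1: "2 * nu + 2 - 1 = 2 * nu + 1" "nu + 1 + 1 = nu + 2" by auto
      show ?thesis unfolding p rec 1 by (simp add: algebra_simps power2_eq_square)
    qed
    ultimately show "(F has_vector_derivative x powr (2 * nu + 1) * clifford nu (b * x\<^sup>2)) (at x)"
      by (simp add: has_real_derivative_iff_has_vector_derivative)
  qed (use e in simp)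
  then show ?thesis by (simp add: F_def)
qed

lemma bessel_coeff_indicator:
  assumes nu: "nu > -1/2" and e: "0 < e" "e < 1" and s: "bessel_zero nu j = s" "s > 0"
  shows "bessel_coeff nu (indicator {0<..<e}) j =
    sqrt 2 / \<bar>besselJ (nu + 1) s\<bar> * (s / 2) powr nu
      * (e powr (2 * nu + 2) / 2 * clifford (nu + 1) (s\<^sup>2 / 4 * e\<^sup>2))"
proof -
  define c where "c = sqrt 2 / \<bar>besselJ (nu + 1) s\<bar> * (s / 2) powr nu"
  define f where "f x = x powr (2 * nu + 1) * clifford nu (s\<^sup>2 / 4 * x\<^sup>2)" for x
  have psi: "bessel_psi nu j x = c * clifford nu (s\<^sup>2 / 4 * x\<^sup>2)" if "x > 0" for x
  proof -
    have "besselJ nu (s * x) = (s / 2) powr nu * x powr nu * clifford nu (s\<^sup>2 / 4 * x\<^sup>2)"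
      using besselJ_eq_clifford[of nu "s * x"] nu s that powr_mult[of "s / 2" x nu]
      by (simp add: power_mult_distrib)
    moreover have "x powr (- nu) * x powr nu = 1" using that by (simp flip: powr_add)
    ultimately show ?thesis unfolding bessel_psi_def s(1) c_def by (simp add: mult_ac)
  qed
  have cont: "continuous_on {0..e} f"
    unfolding f_def using nu by (intro continuous_intros continuous_on_powr') auto
  have "bessel_coeff nu (indicator {0<..<e}) j = (LINT x:{0..e}|lborel. c * f x)"
    unfolding bessel_coeff_def set_lebesgue_integral_def
  proof (rule integral_cong_AE)
    \<comment> \<open>Passing to the closed interval, where the integrand is continuous, changes it
      at most at the endpoints 0 and e.\<close>
    show "AE x in lborel. indicator {0<..<1} x *\<^sub>R (indicator {0<..<e} x * bessel_psi nu j x * x powr (2 * nu + 1))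
        = indicator {0..e} x *\<^sub>R (c * f x)"
      using AE_lborel_singleton[of 0] AE_lborel_singleton[of e]
    proof eventually_elim
      case (elim x)
      then show ?case using e psi[of x] by (auto simp: indicator_def f_def)
    qed
    show "(\<lambda>x. indicator {0..e} x *\<^sub>R (c * f x)) \<in> borel_measurable lborel"
      using borel_measurable_continuous_on_indicator[OF _ cont] by (simp add: mult_ac)
    have "(\<lambda>x. indicator {0<..<e} x *\<^sub>R f x) \<in> borel_measurable borel"
      by (rule borel_measurable_continuous_on_indicator[OF _ continuous_on_subset[OF cont]]) auto
    then have "(\<lambda>x. c * (indicator {0<..<e} x *\<^sub>R f x)) \<in> borel_measurable lborel" by simp
    also have "(\<lambda>x. c * (indicator {0<..<e} x *\<^sub>R f x)) =
       (\<lambda>x. indicator {0<..<1} x *\<^sub>R (indicator {0<..<e} x * bessel_psi nu j x * x powr (2 * nu + 1)))"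
      using e psi by (auto simp: indicator_def f_def fun_eq_iff)
    finally show "(\<lambda>x. indicator {0<..<1} x *\<^sub>R (indicator {0<..<e} x * bessel_psi nu j x * x powr (2 * nu + 1)))
       \<in> borel_measurable lborel" .
  qed
  also have "\<dots> = c * (LINT x:{0..e}|lborel. f x)" by simp
  also have "(LINT x:{0..e}|lborel. f x) = integral {0..e} f"
    by (intro set_borel_integral_eq_integral borel_integrable_atLeastAtMost')
       (use cont in auto)
  also have "\<dots> = e powr (2 * nu + 2) / 2 * clifford (nu + 1) (s\<^sup>2 / 4 * e\<^sup>2)"
    unfolding f_def using clifford_moment[OF nu e(1)] by (rule integral_unique)
  finally show ?thesis by (simp add: c_def)
qed

section \<open>Asymptotics of the profile integral\<close>

text \<open>Euler's Beta integral under u = t^2; the Jacobian 2 t turns t^(2 b) into t^(2 b +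
  1).\<close>

lemma has_integral_beta_square:
  fixes a b :: real
  assumes "a > -1" "b > -1"
  shows "((\<lambda>t. (1 - t\<^sup>2) powr a * t powr (2 * b + 1)) has_integral Beta (b + 1) (a + 1) / 2) {0..1}"
proof -
  define f where "f u = u powr b * (1 - u) powr a" for u :: real
  have img: "(\<lambda>t::real. t\<^sup>2) ` {0<..<1} = {0<..<1}"
  proof (intro equalityI subsetI)
    fix u :: real assume "u \<in> {0<..<1}"
    then have "u = (sqrt u)\<^sup>2" "sqrt u \<in> {0<..<1}" by auto
    then show "u \<in> (\<lambda>t. t\<^sup>2) ` {0<..<1}" by (rule image_eqI)
  qed (auto simp: power_less_one_iff)
  have "(f has_integral Beta (b + 1) (a + 1)) {0..1}"
    unfolding f_def using has_integral_Beta_real[of "b + 1" "a + 1"] assms by simp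
  then have fi: "(f has_integral Beta (b + 1) (a + 1)) {0<..<1}"
    by (simp add: has_integral_Icc_iff_Ioo)
  then have "f absolutely_integrable_on {0<..<1}"
    by (intro nonnegative_absolutely_integrable_1) (auto simp: f_def has_integral_iff)
  then have "f absolutely_integrable_on (\<lambda>t. t\<^sup>2) ` {0<..<1} \<and>
      integral ((\<lambda>t. t\<^sup>2) ` {0<..<1}) f = Beta (b + 1) (a + 1)"
    using fi by (simp add: img integral_unique)
  moreover have "inj_on (\<lambda>t::real. t\<^sup>2) {0<..<1}"
    by (auto simp: inj_on_def)
  ultimately have "(\<lambda>t. \<bar>2 * t\<bar> * f (t\<^sup>2)) absolutely_integrable_on {0<..<1} \<and>
      integral {0<..<1} (\<lambda>t. \<bar>2 * t\<bar> * f (t\<^sup>2)) = Beta (b + 1) (a + 1)"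
    by (subst has_absolute_integral_change_of_variables_1')
       (auto intro!: derivative_eq_intros)
  then have "((\<lambda>t. \<bar>2 * t\<bar> * f (t\<^sup>2)) has_integral Beta (b + 1) (a + 1)) {0<..<1}"
    by (auto simp: has_integral_iff set_lebesgue_integral_eq_integral)
  from has_integral_mult_right[OF this, of "1/2"]
  have "((\<lambda>t. 1/2 * (\<bar>2 * t\<bar> * f (t\<^sup>2))) has_integral Beta (b + 1) (a + 1) / 2) {0<..<1}"
    by simp
  then have "((\<lambda>t. (1 - t\<^sup>2) powr a * t powr (2 * b + 1)) has_integral Beta (b + 1) (a + 1) / 2) {0<..<1}"
  proof (rule has_integral_eq[rotated])
    fix t :: real assume t: "t \<in> {0<..<1}"
    then have "(t\<^sup>2) powr b = t powr (2 * b)"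
      using powr_powr[of t 2 b] by simp
    moreover have "t powr (2 * b + 1) = t powr (2 * b) * t" using t by (simp add: powr_add)
    ultimately show "1/2 * (\<bar>2 * t\<bar> * f (t\<^sup>2)) = (1 - t\<^sup>2) powr a * t powr (2 * b + 1)"
      using t by (simp add: f_def)
  qed
  then show ?thesis by (simp add: has_integral_Icc_iff_Ioo)
qed

text \<open>Serves two expansions: the power series inside Sonine's integral and the Taylor series
  of the profile at t = 1.\<close>

lemma sums_integral_weighted:
  fixes w :: "real \<Rightarrow> real" and f :: "nat \<Rightarrow> real \<Rightarrow> real"
  assumes w: "continuous_on {a..b} w" and f: "\<And>n. continuous_on {a..b} (f n)"
    and M: "\<And>n t. t \<in> {a..b} \<Longrightarrow> \<bar>f n t\<bar> \<le> M n" "summable M"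
  shows "(\<lambda>n. integral {a..b} (\<lambda>t. w t * f n t)) sums integral {a..b} (\<lambda>t. w t * (\<Sum>n. f n t))"
proof -
  have "bounded (w ` {a..b})"
    by (intro compact_imp_bounded compact_continuous_image w) auto
  then obtain W where W: "\<forall>t\<in>{a..b}. \<bar>w t\<bar> \<le> W" unfolding bounded_iff by auto
  have ul: "uniform_limit {a..b} (\<lambda>n t. \<Sum>i<n. w t * f i t) (\<lambda>t. \<Sum>i. w t * f i t) sequentially"
  proof (rule Weierstrass_m_test)
    fix n t assume t: "t \<in> {a..b}"
    have "\<bar>w t\<bar> \<le> \<bar>W\<bar>" using W t by (meson abs_ge_self order_trans)
    then show "norm (w t * f n t) \<le> \<bar>W\<bar> * M n"
      using M(1)[OF t, of n] by (auto simp: abs_mult intro!: mult_mono)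
  qed (use M in auto)
  have cont: "continuous_on {a..b} (\<lambda>t. w t * f i t)" for i
    by (intro continuous_intros w f)
  have "uniform_limit (cbox a b) (\<lambda>n t. \<Sum>i<n. w t * f i t) (\<lambda>t. \<Sum>i. w t * f i t) sequentially"
    using ul by simp
  moreover have "continuous_on (cbox a b) (\<lambda>t. \<Sum>i<n. w t * f i t)" for n
    unfolding cbox_interval using cont by (intro continuous_on_sum) auto
  ultimately obtain I J where IJ: "\<And>n. ((\<lambda>t. \<Sum>i<n. w t * f i t) has_integral I n) (cbox a b)"
      "((\<lambda>t. \<Sum>i. w t * f i t) has_integral J) (cbox a b)" "(I \<longlongrightarrow> J) sequentially"
    by (rule uniform_limit_integral_cbox) auto
  have "I = (\<lambda>n. \<Sum>i<n. integral {a..b} (\<lambda>t. w t * f i t))"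
  proof
    fix n
    have "((\<lambda>t. \<Sum>i<n. w t * f i t) has_integral (\<Sum>i<n. integral {a..b} (\<lambda>t. w t * f i t))) {a..b}"
      using cont by (intro has_integral_sum integrable_integral integrable_continuous_real) auto
    then show "I n = (\<Sum>i<n. integral {a..b} (\<lambda>t. w t * f i t))"
      using IJ(1)[of n] by (simp add: has_integral_unique)
  qed
  moreover have "J = integral {a..b} (\<lambda>t. w t * (\<Sum>n. f n t))"
  proof -
    have "(\<Sum>i. w t * f i t) = w t * (\<Sum>n. f n t)" if "t \<in> {a..b}" for t
      using that M by (intro suminf_mult summable_comparison_test[OF _ M(2)]) auto
    then have "integral {a..b} (\<lambda>t. \<Sum>i. w t * f i t) = integral {a..b} (\<lambda>t. w t * (\<Sum>n. f n t))"
      by (intro integral_cong)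
    then show ?thesis using IJ(2) by (simp add: integral_unique)
  qed
  ultimately show ?thesis using IJ(3) by (simp add: sums_def)
qed

text \<open>Sonine's first integral. Termwise, the Beta integral cancels rGamma(n + nu + 1) from the
  coefficient and puts Gamma(a + 1)/2 * rGamma(n + nu + a + 2) in its place, which is a shift of the
  order by a + 1.\<close>

lemma sonine_integral:
  assumes nu: "nu > -1/2" and a: "a > 0"
  shows "integral {0..1} (\<lambda>t. (1 - t\<^sup>2) powr a * t powr (2 * nu + 1) * clifford nu (y * t\<^sup>2))
    = Gamma (a + 1) / 2 * clifford (nu + a + 1) y"
proof -
  define w where "w t = (1 - t\<^sup>2) powr a * t powr (2 * nu + 1)" for t :: real
  define c where "c n = (-1) ^ n * rGamma (real n + nu + 1) / fact n" for n
  have rp: "rGamma (real n + nu + 1) > 0" for n using nu by (intro rGamma_pos) auto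
  have "continuous_on {0..1} w"
    unfolding w_def using nu a
    by (intro continuous_intros continuous_on_powr') (auto simp: power_le_one)
  moreover have "\<bar>c n * (y * t\<^sup>2) ^ n\<bar> \<le> \<bar>c n\<bar> * \<bar>y\<bar> ^ n" if "t \<in> {0..1}" for n t
  proof -
    have "\<bar>y * t\<^sup>2\<bar> \<le> \<bar>y\<bar> * 1" unfolding abs_mult using that by (intro mult_left_mono) (auto simp: power_le_one)
    then have "\<bar>y * t\<^sup>2\<bar> ^ n \<le> \<bar>y\<bar> ^ n" by (intro power_mono) auto
    then show ?thesis by (simp add: abs_mult power_abs mult_left_mono)
  qed
  moreover have "summable (\<lambda>n. \<bar>c n\<bar> * \<bar>y\<bar> ^ n)"
  proof -
    \<comment> \<open>At the argument -|y| all terms are nonnegative, so plain summability there is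
      absolute summability at y.\<close>
    have "summable (\<lambda>n. c n * (- \<bar>y\<bar>) ^ n)" unfolding c_def using nu by (intro clifford_summable) auto
    moreover have "c n * (- \<bar>y\<bar>) ^ n = \<bar>c n\<bar> * \<bar>y\<bar> ^ n" for n
    proof -
      have "(-1) ^ n * (- \<bar>y\<bar>) ^ n = \<bar>y\<bar> ^ n" by (simp flip: power_mult_distrib)
      then show ?thesis using rp[of n] by (simp add: c_def abs_mult mult_ac)
    qed
    ultimately show ?thesis by simp
  qed
  ultimately have "(\<lambda>n. integral {0..1} (\<lambda>t. w t * (c n * (y * t\<^sup>2) ^ n))) sums
      integral {0..1} (\<lambda>t. w t * (\<Sum>n. c n * (y * t\<^sup>2) ^ n))"
    by (intro sums_integral_weighted) (auto intro!: continuous_intros)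
  moreover have "integral {0..1} (\<lambda>t. w t * (c n * (y * t\<^sup>2) ^ n))
      = Gamma (a + 1) / 2 * ((-1) ^ n * rGamma (real n + (nu + a + 1) + 1) / fact n * y ^ n)" for n
  proof -
    have "w t * (c n * (y * t\<^sup>2) ^ n) = c n * y ^ n * ((1 - t\<^sup>2) powr a * t powr (2 * (nu + real n) + 1))"
      if "t \<in> {0..1}" for t
    proof (cases "t = 0")
      case False
      have "t powr (2 * (nu + real n) + 1) = t powr ((2 * nu + 1) + real (2 * n))" by (simp add: algebra_simps)
      also have "\<dots> = t powr (2 * nu + 1) * t ^ (2 * n)"
        using that False by (subst powr_add, subst powr_realpow) auto
      finally show ?thesis by (simp add: w_def power_mult_distrib power_mult)
    qed (use nu in \<open>simp add: w_def\<close>)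
    then have "integral {0..1} (\<lambda>t. w t * (c n * (y * t\<^sup>2) ^ n))
       = integral {0..1} (\<lambda>t. c n * y ^ n * ((1 - t\<^sup>2) powr a * t powr (2 * (nu + real n) + 1)))"
      by (intro integral_cong)
    also have "\<dots> = c n * y ^ n * (Beta (nu + real n + 1) (a + 1) / 2)"
      using has_integral_beta_square[of a "nu + real n"] nu a
      by (intro integral_unique has_integral_mult_right) auto
    also have "Beta (nu + real n + 1) (a + 1)
       = Gamma (real n + nu + 1) * Gamma (a + 1) * rGamma (real n + (nu + a + 1) + 1)"
      by (simp add: Beta_altdef add_ac)
    also have "c n * y ^ n * (Gamma (real n + nu + 1) * Gamma (a + 1) * rGamma (real n + (nu + a + 1) + 1) / 2)
      = (Gamma (real n + nu + 1) * rGamma (real n + nu + 1))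
        * (Gamma (a + 1) / 2 * ((-1) ^ n * rGamma (real n + (nu + a + 1) + 1) / fact n * y ^ n))"
      by (simp add: c_def field_simps)
    also have "Gamma (real n + nu + 1) * rGamma (real n + nu + 1) = 1"
      using rp[of n] by (simp add: Gamma_def)
    finally show ?thesis by simp
  qed
  ultimately have "(\<lambda>n. Gamma (a + 1) / 2 * ((-1) ^ n * rGamma (real n + (nu + a + 1) + 1) / fact n * y ^ n)) sums
      integral {0..1} (\<lambda>t. w t * (\<Sum>n. c n * (y * t\<^sup>2) ^ n))" by simp
  moreover have "(\<lambda>n. Gamma (a + 1) / 2 * ((-1) ^ n * rGamma (real n + (nu + a + 1) + 1) / fact n * y ^ n)) sums
      (Gamma (a + 1) / 2 * clifford (nu + a + 1) y)"
    unfolding clifford_def using nu a by (intro sums_mult summable_sums clifford_summable) auto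
  ultimately have "integral {0..1} (\<lambda>t. w t * (\<Sum>n. c n * (y * t\<^sup>2) ^ n))
      = Gamma (a + 1) / 2 * clifford (nu + a + 1) y"
    by (rule sums_unique2)
  then show ?thesis by (simp add: w_def c_def clifford_def)
qed

section \<open>Expansion of the profile integral at the edge t = 1\<close>

lemma clifford_bound_unif:
  assumes "mu \<ge> 0" "\<bar>u\<bar> \<le> b"
  shows "\<bar>clifford (mu + real k) u\<bar> \<le> rGamma (mu + 1) * exp b"
proof -
  have "\<bar>clifford (mu + real k) u\<bar> \<le> rGamma (mu + real k + 1) * exp \<bar>u\<bar>"
    using assms by (intro clifford_bound_exp) auto
  also have "\<dots> \<le> rGamma (mu + 1) * exp b"
    using assms rGamma_add_nat_le[of "mu + 1" k] rGamma_pos[of "mu + 1"]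
    by (intro mult_mono) (auto simp: add_ac)
  finally show ?thesis .
qed

text \<open>The sign in the derivative of \<open>clifford\<close> cancels that of the inner
  function, so the k-th derivative of v \<mapsto> \<open>clifford mu (a * (1 - v))\<close> is a^k
  times the function of order mu + k, bounded uniformly in k. For v = 1 - t^2 the argument is a
  t^2.\<close>

lemma clifford_taylor:
  assumes mu: "mu \<ge> 0" and a: "a \<ge> 0" and v: "0 \<le> v" "v \<le> 1"
  shows "(\<lambda>k. a ^ k * clifford (mu + real k) a / fact k * v ^ k) sums clifford mu (a * (1 - v))"
proof -
  define d where "d k t = a ^ k * clifford (mu + real k) (a * (1 - t))" for k t
  \<comment> \<open>The intermediate point of Maclaurin's formula is known only to satisfy |t| \<le>
    |v| \<le> 1; it may be negative, so the argument a(1 - t) ranges up to 2 a.\<close>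
  define C where "C = rGamma (mu + 1) * exp (2 * a)"
  have C: "C \<ge> 0" using mu rGamma_pos[of "mu + 1"] by (simp add: C_def)
  have dd: "(d k has_real_derivative d (Suc k) t) (at t)" for k t
    unfolding d_def[abs_def] using mu
    by (auto intro!: derivative_eq_intros clifford_deriv simp: add_ac)
  have bound: "\<bar>clifford mu (a * (1 - v)) - (\<Sum>k<n. a ^ k * clifford (mu + real k) a / fact k * v ^ k)\<bar>
      \<le> C * (a ^ n / fact n)" for n
  proof -
    obtain t where t: "\<bar>t\<bar> \<le> \<bar>v\<bar>" "d 0 v = (\<Sum>k<n. (d k 0 / fact k) * v ^ k) + (d n t / fact n) * v ^ n"
      using Maclaurin_all_le[of d "d 0" v n] dd by auto
    have "a * \<bar>1 - t\<bar> \<le> a * 2" using a t v by (intro mult_left_mono) auto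
    then have le: "\<bar>a * (1 - t)\<bar> \<le> 2 * a" using a by (simp add: abs_mult)
    have "\<bar>d n t\<bar> \<le> a ^ n * C"
      unfolding d_def C_def abs_mult using a mu by (intro mult_mono clifford_bound_unif le) auto
    then have "\<bar>d n t\<bar> / fact n * v ^ n \<le> a ^ n * C / fact n * 1"
      using a v C by (intro mult_mono divide_right_mono) (auto simp: power_le_one)
    then show ?thesis using t v by (simp add: d_def abs_mult mult_ac)
  qed
  have "(\<lambda>n. a ^ n / fact n) \<longlonglongrightarrow> 0"
    using summable_LIMSEQ_zero[OF summable_exp[of a]] by (simp add: field_simps)
  then have lim: "(\<lambda>n. C * (a ^ n / fact n)) \<longlonglongrightarrow> 0"
    by (rule tendsto_mult_right_zero)
  have "(\<lambda>n. clifford mu (a * (1 - v)) - (\<Sum>k<n. a ^ k * clifford (mu + real k) a / fact k * v ^ k)) \<longlonglongrightarrow> 0"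
    by (rule Lim_null_comparison[OF _ lim]) (use bound in simp)
  then have "(\<lambda>n. clifford mu (a * (1 - v)) - (clifford mu (a * (1 - v)) - (\<Sum>k<n. a ^ k * clifford (mu + real k) a / fact k * v ^ k)))
      \<longlonglongrightarrow> clifford mu (a * (1 - v)) - 0"
    by (intro tendsto_diff tendsto_const)
  then show ?thesis by (simp add: sums_def)
qed

text \<open>The k-th Taylor term carries (1 - t^2)^k, which merely raises the exponent delta of the
  mean to delta + k; Sonine's integral then evaluates it with order nu + delta + 1 + k.\<close>

lemma riesz_profile_integral_sums:
  assumes nu: "nu > -1/2" and delta: "delta > 0" and a: "a \<ge> 0"
  shows "(\<lambda>k. a ^ k / fact k * clifford (nu + 1 + real k) a
            * (Gamma (delta + real k + 1) / 2 * clifford (nu + delta + 1 + real k) y))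
     sums integral {0..1} (riesz_profile nu delta a y)"
proof -
  define w where "w t = (1 - t\<^sup>2) powr delta * t powr (2 * nu + 1) * clifford nu (y * t\<^sup>2)" for t :: real
  define c where "c k = a ^ k / fact k * clifford (nu + 1 + real k) a" for k
  define C where "C = rGamma (nu + 1 + 1) * exp a"
  have C: "C \<ge> 0" using nu by (auto simp: C_def intro!: mult_nonneg_nonneg less_imp_le[OF rGamma_pos])
  have "continuous_on {0..1} w"
    unfolding w_def using nu delta
    by (intro continuous_intros continuous_on_powr') (auto simp: power_le_one)
  moreover have "\<bar>c k * (1 - t\<^sup>2) ^ k\<bar> \<le> C * (a ^ k / fact k)" if "t \<in> {0..1}" for k t
  proof -
    have "\<bar>clifford (nu + 1 + real k) a\<bar> \<le> C"
      unfolding C_def using nu a by (intro clifford_bound_unif) auto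
    then have "a ^ k / fact k * \<bar>clifford (nu + 1 + real k) a\<bar> * (1 - t\<^sup>2) ^ k \<le> a ^ k / fact k * C * 1"
      using that a C by (intro mult_mono mult_left_mono) (auto simp: power_le_one)
    moreover have "(1 - t\<^sup>2) ^ k \<ge> 0" using that by (simp add: power_le_one)
    ultimately show ?thesis using a by (simp add: c_def abs_mult mult_ac)
  qed
  moreover have "summable (\<lambda>k. C * (a ^ k / fact k))"
    using summable_exp[of a] by (intro summable_mult) (simp add: field_simps)
  ultimately have "(\<lambda>k. integral {0..1} (\<lambda>t. w t * (c k * (1 - t\<^sup>2) ^ k))) sums
      integral {0..1} (\<lambda>t. w t * (\<Sum>k. c k * (1 - t\<^sup>2) ^ k))"
    by (intro sums_integral_weighted) (auto intro!: continuous_intros)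
  moreover have "integral {0..1} (\<lambda>t. w t * (\<Sum>k. c k * (1 - t\<^sup>2) ^ k)) = integral {0..1} (riesz_profile nu delta a y)"
  proof (rule integral_cong)
    fix t :: real assume t: "t \<in> {0..1}"
    have "(\<lambda>k. a ^ k * clifford (nu + 1 + real k) a / fact k * (1 - t\<^sup>2) ^ k) sums clifford (nu + 1) (a * (1 - (1 - t\<^sup>2)))"
      using nu a t by (intro clifford_taylor) (auto simp: power_le_one)
    then have "(\<Sum>k. c k * (1 - t\<^sup>2) ^ k) = clifford (nu + 1) (a * t\<^sup>2)"
      by (simp add: c_def sums_iff)
    moreover have "max 0 (1 - t\<^sup>2) = 1 - t\<^sup>2" using t by (simp add: power_le_one)
    ultimately show "w t * (\<Sum>k. c k * (1 - t\<^sup>2) ^ k) = riesz_profile nu delta a y t"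
      by (simp add: w_def riesz_profile_def mult_ac)
  qed
  moreover have "integral {0..1} (\<lambda>t. w t * (c k * (1 - t\<^sup>2) ^ k))
     = a ^ k / fact k * clifford (nu + 1 + real k) a
            * (Gamma (delta + real k + 1) / 2 * clifford (nu + delta + 1 + real k) y)" for k
  proof -
    have "w t * (c k * (1 - t\<^sup>2) ^ k)
       = c k * ((1 - t\<^sup>2) powr (delta + real k) * t powr (2 * nu + 1) * clifford nu (y * t\<^sup>2))"
      if "t \<in> {0..1}" for t
    proof (cases "t = 1")
      case False
      then have "t\<^sup>2 < 1" using that by (simp add: power_less_one_iff)
      then have "(1 - t\<^sup>2) powr (delta + real k) = (1 - t\<^sup>2) powr delta * (1 - t\<^sup>2) ^ k"
        by (subst powr_add, subst powr_realpow) auto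
      then show ?thesis by (simp add: w_def)
    qed (use delta in \<open>simp add: w_def\<close>)
    then have "integral {0..1} (\<lambda>t. w t * (c k * (1 - t\<^sup>2) ^ k))
       = integral {0..1} (\<lambda>t. c k * ((1 - t\<^sup>2) powr (delta + real k) * t powr (2 * nu + 1) * clifford nu (y * t\<^sup>2)))"
      by (intro integral_cong)
    also have "\<dots> = c k * (Gamma (delta + real k + 1) / 2 * clifford (nu + (delta + real k) + 1) y)"
      using sonine_integral[OF nu, of "delta + real k" y] delta by simp
    finally show ?thesis by (simp add: c_def add_ac)
  qed
  ultimately show ?thesis by simp
qed

text \<open>Two seed bounds propagate to all higher orders through the recurrence solved for its
  highest order; the division by y \<ge> 1 is simply dropped. The dependence on k is the explicit
  Pochhammer symbol, while D retains the decay in y. The seed of order lam is allowed an extra sqrt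
  y because it decays slower by that factor; the first division by y absorbs it.\<close>

lemma clifford_recursion_bound:
  assumes lam: "lam > 0" and y: "y \<ge> 1"
    and D: "\<bar>clifford lam y\<bar> \<le> D * sqrt y" "\<bar>clifford (lam + 1) y\<bar> \<le> D"
  shows "\<bar>clifford (lam + 1 + real k) y\<bar> \<le> D * pochhammer (lam + 1) (Suc k)"
proof (induction k rule: induct_nat_012)
  case 0
  have "D \<ge> 0" using D(2) by linarith
  then have "D * 1 \<le> D * (lam + 1)" using lam by (intro mult_left_mono) auto
  then show ?case using D by simp
next
  case 1
  have D0: "D \<ge> 0" using D(2) by linarith
  have sq: "sqrt y \<le> y"
  proof -
    have "1 * sqrt y \<le> sqrt y * sqrt y" using y by (intro mult_right_mono) auto
    then show ?thesis using y by simp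
  qed
  have "y * clifford (lam + 2) y = (lam + 1) * clifford (lam + 1) y - clifford lam y"
    using clifford_rec[of lam y] lam by simp
  also have "\<bar>\<dots>\<bar> \<le> (lam + 1) * D + D * sqrt y"
  proof (rule order_trans[OF abs_triangle_ineq4 add_mono])
    show "\<bar>(lam + 1) * clifford (lam + 1) y\<bar> \<le> (lam + 1) * D"
      unfolding abs_mult using D(2) lam by (intro mult_mono) auto
  qed (rule D(1))
  also have "\<dots> \<le> (lam + 1) * D * y + D * y"
    using sq D0 y lam mult_left_mono[OF y, of "(lam + 1) * D"] by (intro add_mono mult_left_mono) auto
  also have "\<dots> = y * (D * (lam + 2))" by (simp add: algebra_simps)
  finally have "\<bar>clifford (lam + 2) y\<bar> \<le> D * (lam + 2)"
    using y by (simp add: abs_mult)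
  also have "\<dots> \<le> D * ((lam + 1) * (lam + 2))"
    using D0 lam by (intro mult_left_mono) (auto simp: algebra_simps)
  finally show ?case by (simp add: pochhammer_rec' numeral_2_eq_2 algebra_simps)
next
  case (ge2 k)
  let ?p = "pochhammer (lam + 1)"
  have D0: "D \<ge> 0" using D(2) by linarith
  have pp: "?p n > 0" for n using lam by (intro pochhammer_pos) auto
  have step: "?p (Suc n) = ?p n * (lam + 1 + real n)" for n by (simp add: pochhammer_rec' mult.commute)
  have "y * clifford (lam + 1 + real (Suc (Suc k))) y
      = (lam + 1 + real k + 1) * clifford (lam + 1 + real (Suc k)) y - clifford (lam + 1 + real k) y"
    using clifford_rec[of "lam + 1 + real k" y] lam by (simp add: algebra_simps)
  also have "\<bar>\<dots>\<bar> \<le> (lam + 1 + real k + 1) * (D * ?p (Suc (Suc k))) + D * ?p (Suc k)"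
  proof (rule order_trans[OF abs_triangle_ineq4 add_mono])
    show "\<bar>(lam + 1 + real k + 1) * clifford (lam + 1 + real (Suc k)) y\<bar>
        \<le> (lam + 1 + real k + 1) * (D * ?p (Suc (Suc k)))"
      unfolding abs_mult using ge2(2) lam by (intro mult_mono) auto
  qed (rule ge2(1))
  also have "\<dots> \<le> (lam + 1 + real k + 1) * (D * ?p (Suc (Suc k))) + D * ?p (Suc (Suc k))"
  proof -
    have "?p (Suc k) * 1 \<le> ?p (Suc k) * (lam + 1 + real (Suc k))"
      using pp[of "Suc k"] lam by (intro mult_left_mono) auto
    then have "?p (Suc k) \<le> ?p (Suc (Suc k))" using step[of "Suc k"] by simp
    then show ?thesis using D0 by (intro add_left_mono mult_left_mono)
  qed
  also have "\<dots> = D * ?p (Suc (Suc (Suc k)))"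
    unfolding step[of "Suc (Suc k)"] by (simp add: algebra_simps)
  finally have "y * \<bar>clifford (lam + 1 + real (Suc (Suc k))) y\<bar> \<le> D * ?p (Suc (Suc (Suc k)))"
    using y by (simp add: abs_mult)
  moreover have "1 * \<bar>clifford (lam + 1 + real (Suc (Suc k))) y\<bar> \<le> y * \<bar>clifford (lam + 1 + real (Suc (Suc k))) y\<bar>"
    using y by (intro mult_right_mono) auto
  ultimately show ?case by linarith
qed

lemma pochhammer_le_power_fact:
  fixes x :: real
  assumes "x \<ge> 1"
  shows "pochhammer x m \<le> x ^ m * fact m"
proof (induction m)
  case (Suc m)
  have "pochhammer x (Suc m) = pochhammer x m * (x + real m)" by (simp add: pochhammer_rec' mult.commute)
  also have "\<dots> \<le> (x ^ m * fact m) * (x * real (Suc m))"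
  proof (rule mult_mono[OF Suc.IH])
    have "1 * real m \<le> x * real m" using assms by (intro mult_right_mono) auto
    then show "x + real m \<le> x * real (Suc m)" by (simp add: algebra_simps)
  qed (use assms in auto)
  also have "\<dots> = x ^ Suc m * fact (Suc m)" by (simp add: algebra_simps)
  finally show ?case .
qed simp

text \<open>Each step multiplies the left side by (x + m)/(y + m) \<le> 1. It is applied with x =
  delta + 1 and y = nu + 2, to set the Gamma factor of Sonine's integral against the rGamma factor
  of the exponential bound.\<close>

lemma Gamma_rGamma_ratio_le:
  fixes x y :: real
  assumes "0 < x" "x \<le> y"
  shows "Gamma (x + real m) * rGamma (y + real m) \<le> Gamma x * rGamma y"
proof (induction m)
  case (Suc m)
  have G: "Gamma (x + real m + 1) = (x + real m) * Gamma (x + real m)"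
    using assms by (intro Gamma_plus1) auto
  have rG: "rGamma (y + real m + 1) = rGamma (y + real m) / (y + real m)"
    using rGamma_plus1[of "y + real m"] assms by (simp add: field_simps)
  have "Gamma (x + real (Suc m)) * rGamma (y + real (Suc m))
      = (x + real m) / (y + real m) * (Gamma (x + real m) * rGamma (y + real m))"
    using G rG by (simp add: add_ac)
  also have "\<dots> \<le> 1 * (Gamma (x + real m) * rGamma (y + real m))"
    using assms rGamma_pos[of "y + real m"] Gamma_real_pos[of "x + real m"]
    by (intro mult_right_mono) auto
  finally show ?case using Suc by simp
qed simp

text \<open>In the k-th term the factorial from the Pochhammer bound cancels the 1/k! of Taylor's
  formula and the Gamma quotient is bounded, so the tail is a geometric series of ratio a(lam + 1)
  \<le> 1/2, lam = nu + delta + 1. Its orders are at least lam + 1, hence the gain of a factor 1/z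
  over the leading term.\<close>

lemma riesz_profile_integral_leading:
  assumes nu: "nu > -1/2" and delta: "delta > 0" "delta \<le> nu + 1/2"
    and a: "a > 0" "a * (nu + delta + 2) \<le> 1/2"
  obtains K where "K > 0"
    "\<And>z. z \<ge> 2 \<Longrightarrow> \<bar>integral {0..1} (riesz_profile nu delta a (z\<^sup>2 / 4))
        - Gamma (delta + 1) / 2 * clifford (nu + 1) a * clifford (nu + delta + 1) (z\<^sup>2 / 4)\<bar>
        \<le> K * z powr (- (nu + delta + 1) - 3/2)"
proof -
  define lam where "lam = nu + delta + 1"
  have lam: "lam > 0" "lam > -1" "lam + 1 > -1" using nu delta by (auto simp: lam_def)
  obtain C0 where C0: "C0 > 0" "\<And>s. s \<ge> 1 \<Longrightarrow> \<bar>clifford lam (s\<^sup>2 / 4)\<bar> \<le> C0 * s powr (- lam - 1/2)"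
    using clifford_decay[OF lam(2)] by metis
  obtain C1 where C1: "C1 > 0" "\<And>s. s \<ge> 1 \<Longrightarrow> \<bar>clifford (lam + 1) (s\<^sup>2 / 4)\<bar> \<le> C1 * s powr (- (lam + 1) - 1/2)"
    using clifford_decay[OF lam(3)] by metis
  define g where "g = Gamma (delta + 1) * rGamma (nu + 2)"
  have g: "g > 0" using nu delta by (auto simp: g_def intro!: mult_pos_pos Gamma_real_pos rGamma_pos)
  define K where "K = exp a * g / 2 * (2 * C0 + C1)"
  show ?thesis
  proof (rule that[of K])
    show "K > 0" using g C0 C1 by (simp add: K_def)
  next
    fix z :: real assume z: "z \<ge> 2"
    define y where "y = z\<^sup>2 / 4"
    have sy: "sqrt y = z / 2" using z by (simp add: y_def real_sqrt_divide)
    have "2\<^sup>2 \<le> z\<^sup>2" using z by (intro power_mono) auto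
    then have y1: "y \<ge> 1" by (simp add: y_def)
    \<comment> \<open>The 2 in 2 C0 comes from sqrt y = z/2, used to write the bound for order lam
      as D sqrt y.\<close>
    define D where "D = (2 * C0 + C1) * z powr (- lam - 3/2)"
    have D: "D \<ge> 0" using C0 C1 by (simp add: D_def)
    have pw: "z powr (- lam - 1/2) = z powr (- lam - 3/2) * z"
    proof -
      have "- lam - 1/2 = (- lam - 3/2) + 1" by simp
      then show ?thesis using z powr_add[of z "- lam - 3/2" 1] by (simp only:) simp
    qed
    have "\<bar>clifford lam y\<bar> \<le> C0 * (z powr (- lam - 3/2) * z)"
      using C0(2)[of z] z unfolding pw y_def by simp
    also have "\<dots> \<le> D * sqrt y"
      unfolding sy D_def using C1 z by (simp add: algebra_simps)
    finally have D0: "\<bar>clifford lam y\<bar> \<le> D * sqrt y" .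
    have ex: "- (lam + 1) - 1/2 = - lam - 3/2" by simp
    have "\<bar>clifford (lam + 1) y\<bar> \<le> C1 * z powr (- (lam + 1) - 1/2)"
      unfolding y_def by (rule C1(2)) (use z in simp)
    then have "\<bar>clifford (lam + 1) y\<bar> \<le> C1 * z powr (- lam - 3/2)"
      by (simp only: ex)
    also have "\<dots> \<le> D" unfolding D_def using C0 by (intro mult_right_mono) auto
    finally have D1: "\<bar>clifford (lam + 1) y\<bar> \<le> D" .
    define T where "T k = a ^ k / fact k * clifford (nu + 1 + real k) a
            * (Gamma (delta + real k + 1) / 2 * clifford (lam + real k) y)" for k
    have "T sums integral {0..1} (riesz_profile nu delta a y)"
      unfolding T_def lam_def using riesz_profile_integral_sums[OF nu delta(1)] a by simp
    then have tail: "(\<lambda>k. T (Suc k)) sums (integral {0..1} (riesz_profile nu delta a y) - T 0)"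
      by (subst sums_Suc_iff) simp
    have bnd: "norm (T (Suc k)) \<le> exp a * g / 2 * D * (1/2) ^ Suc k" for k
    proof -
      define m where "m = Suc k"
      have P: "\<bar>clifford (nu + 1 + real m) a\<bar> \<le> rGamma (nu + 2 + real m) * exp a"
        using clifford_bound_exp[of "nu + 1 + real m" a] nu a by (simp add: add_ac)
      have Q: "\<bar>clifford (lam + real m) y\<bar> \<le> D * ((lam + 1) ^ m * fact m)"
      proof -
        have "\<bar>clifford (lam + 1 + real k) y\<bar> \<le> D * pochhammer (lam + 1) m"
          unfolding m_def by (rule clifford_recursion_bound[OF lam(1) y1 D0 D1])
        also have "\<dots> \<le> D * ((lam + 1) ^ m * fact m)"
          using D lam by (intro mult_left_mono pochhammer_le_power_fact) auto
        finally show ?thesis by (simp add: m_def add_ac)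
      qed
      have Gp: "Gamma (delta + 1 + real m) > 0" using delta by (intro Gamma_real_pos) auto
      have rGp: "rGamma (nu + 2 + real m) > 0" using nu by (intro rGamma_pos) auto
      have "\<bar>T m\<bar> = a ^ m / fact m * \<bar>clifford (nu + 1 + real m) a\<bar>
            * (Gamma (delta + 1 + real m) / 2 * \<bar>clifford (lam + real m) y\<bar>)"
        unfolding T_def using a Gp by (simp add: abs_mult add_ac)
      also have "\<dots> \<le> a ^ m / fact m * (rGamma (nu + 2 + real m) * exp a)
            * (Gamma (delta + 1 + real m) / 2 * (D * ((lam + 1) ^ m * fact m)))"
        using a P Q Gp rGp by (intro mult_mono mult_left_mono mult_nonneg_nonneg) auto
      also have "\<dots> = exp a * D / 2 * (a * (lam + 1)) ^ m * (Gamma (delta + 1 + real m) * rGamma (nu + 2 + real m))"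
        unfolding power_mult_distrib by (simp add: mult_ac)
      also have "\<dots> \<le> exp a * D / 2 * (1/2) ^ m * g"
      proof (intro mult_mono)
        show "(a * (lam + 1)) ^ m \<le> (1/2) ^ m"
          using a lam by (intro power_mono) (auto simp: lam_def add_ac)
        show "Gamma (delta + 1 + real m) * rGamma (nu + 2 + real m) \<le> g"
          unfolding g_def using delta by (intro Gamma_rGamma_ratio_le) auto
      qed (use D Gp rGp a lam g in auto)
      finally show ?thesis by (simp add: m_def mult_ac)
    qed
    have gs: "(\<lambda>k. exp a * g / 2 * D * (1/2) ^ Suc k) sums (exp a * g / 2 * D * 1)"
      by (intro sums_mult power_half_series)
    have "\<bar>integral {0..1} (riesz_profile nu delta a y) - T 0\<bar> \<le> exp a * g / 2 * D * 1"
      using norm_sums_le[OF tail gs bnd] by (simp only: real_norm_def)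
    also have "\<dots> = K * z powr (- lam - 3/2)" by (simp add: K_def D_def)
    finally show "\<bar>integral {0..1} (riesz_profile nu delta a (z\<^sup>2 / 4))
        - Gamma (delta + 1) / 2 * clifford (nu + 1) a * clifford (nu + delta + 1) (z\<^sup>2 / 4)\<bar>
        \<le> K * z powr (- (nu + delta + 1) - 3/2)"
      by (simp add: T_def y_def lam_def mult_ac)
  qed
qed

lemma riesz_profile_integral_lower:
  assumes nu: "nu > -1/2" and delta: "delta > 0" "delta \<le> nu + 1/2"
  obtains a c th M where "a > 0" "c > 0" "M \<ge> 2"
    "\<And>z. z \<ge> M \<Longrightarrow> \<bar>cos (z - th)\<bar> \<ge> 1/2 \<Longrightarrow>
       \<bar>integral {0..1} (riesz_profile nu delta a (z\<^sup>2 / 4))\<bar> \<ge> c * z powr (- (nu + delta + 3/2))"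
proof -
  define lam where "lam = nu + delta + 1"
  have lam: "lam > 0" "lam > -1" using nu delta by (auto simp: lam_def)
  have "nu + 1 > -1" using nu by simp
  then obtain e where e: "e > 0" "\<And>u. 0 \<le> u \<Longrightarrow> u \<le> e \<Longrightarrow> clifford (nu + 1) u > 0"
    using clifford_pos_near_0 by metis
  \<comment> \<open>The first entry keeps the leading coefficient positive, the second is the ratio
    condition for the geometric tail.\<close>
  define a where "a = min e (1 / (2 * (lam + 1)))"
  have a: "a > 0" using e lam by (simp add: a_def)
  have "a * (lam + 1) \<le> 1 / (2 * (lam + 1)) * (lam + 1)" using lam by (intro mult_right_mono) (auto simp: a_def)
  also have "\<dots> = 1/2" using lam by simp
  finally have "a * (lam + 1) \<le> 1/2" .
  then have a2: "a * (nu + delta + 2) \<le> 1/2" by (simp add: lam_def add_ac)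
  have ca: "clifford (nu + 1) a > 0" using e a by (auto simp: a_def)
  obtain K where K: "K > 0"
    "\<And>z. z \<ge> 2 \<Longrightarrow> \<bar>integral {0..1} (riesz_profile nu delta a (z\<^sup>2 / 4))
        - Gamma (delta + 1) / 2 * clifford (nu + 1) a * clifford lam (z\<^sup>2 / 4)\<bar>
        \<le> K * z powr (- lam - 3/2)"
    using riesz_profile_integral_leading[OF nu delta a a2] unfolding lam_def by metis
  obtain A th K' where A: "A > 0" "K' > 0"
    "\<And>s. s \<ge> 1 \<Longrightarrow> \<bar>clifford lam (s\<^sup>2 / 4) - s powr (- lam - 1/2) * (A * cos (s - th))\<bar> \<le> K' * s powr (- lam - 3/2)"
    using clifford_asymptotics[OF lam(2)] by metis
  define q where "q = Gamma (delta + 1) / 2 * clifford (nu + 1) a"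
  have q: "q > 0" using ca delta by (simp add: q_def)
  \<comment> \<open>From M on, the two error terms together are at most half of the main term, whose
    cosine is at least 1/2 in modulus; this leaves the constant q A/4.\<close>
  define M where "M = max 2 (4 * (q * K' + K) / (q * A))"
  show ?thesis
  proof (rule that[of a "q * A / 4" M th])
    fix z assume z: "z \<ge> M" "\<bar>cos (z - th)\<bar> \<ge> 1/2"
    have z2: "z \<ge> 2" using z by (simp add: M_def)
    have "4 * (q * K' + K) / (q * A) \<le> z" using z by (simp add: M_def)
    then have zz: "4 * (q * K' + K) \<le> q * A * z" using q A by (simp add: field_simps)
    define r where "r = z powr (- lam - 3/2)"
    have r: "r > 0" using z2 by (simp add: r_def)
    have pw: "z powr (- lam - 1/2) = r * z"
    proof -
      have "- lam - 1/2 = (- lam - 3/2) + 1" by simp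
      then show ?thesis using z2 powr_add[of z "- lam - 3/2" 1] unfolding r_def by (simp only:) simp
    qed
    have "A * (1/2) \<le> A * \<bar>cos (z - th)\<bar>" using z A by (intro mult_left_mono) auto
    then have "r * z * (A * (1/2)) \<le> r * z * (A * \<bar>cos (z - th)\<bar>)"
      by (rule mult_left_mono) (use r z2 in auto)
    also have "\<dots> = \<bar>r * z * (A * cos (z - th))\<bar>" using r z2 A by (simp add: abs_mult)
    finally have "r * z * (A * (1/2)) - K' * r \<le> \<bar>clifford lam (z\<^sup>2 / 4)\<bar>"
      using A(3)[of z] z2 unfolding pw r_def[symmetric] by linarith
    then have "q * (r * z * (A * (1/2)) - K' * r) \<le> q * \<bar>clifford lam (z\<^sup>2 / 4)\<bar>"
      using q by (intro mult_left_mono) auto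
    also have "\<dots> = \<bar>q * clifford lam (z\<^sup>2 / 4)\<bar>" using q by (simp add: abs_mult)
    finally have "q * (r * z * (A * (1/2)) - K' * r) - K * r \<le> \<bar>integral {0..1} (riesz_profile nu delta a (z\<^sup>2 / 4))\<bar>"
      using K(2)[OF z2] unfolding q_def[symmetric] r_def[symmetric] by linarith
    moreover have "q * A / 4 * (r * z) \<le> q * (r * z * (A * (1/2)) - K' * r) - K * r"
      using mult_left_mono[OF zz, of "r / 4"] r by (simp add: algebra_simps)
    moreover have "- (nu + delta + 3/2) = - lam - 1/2" by (simp add: lam_def)
    ultimately show "q * A / 4 * z powr (- (nu + delta + 3/2)) \<le> \<bar>integral {0..1} (riesz_profile nu delta a (z\<^sup>2 / 4))\<bar>"
      unfolding pw[symmetric] by (simp only:)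
  qed (use a q A in \<open>auto simp: M_def\<close>)
qed

section \<open>Bochner--Riesz means of short intervals\<close>

lemma finite_bessel_zeros:
  assumes "mu > -1"
  shows "finite {s. 0 < s \<and> s \<le> b \<and> bessel_v mu s = 0}"
proof -
  obtain s0 where "perturbed_oscillator (bessel_v mu) (bessel_w mu) (mu\<^sup>2 - 1/4) s0"
    using bessel_oscillator[OF assms] .
  then interpret perturbed_oscillator "bessel_v mu" "bessel_w mu" "mu\<^sup>2 - 1/4" s0 .
  obtain e where e: "e > 0" "\<And>s. 0 < s \<Longrightarrow> s \<le> e \<Longrightarrow> bessel_v mu s > 0"
    using bessel_v_pos_near_0[OF assms] by metis
  show ?thesis
  proof (rule finite_zeros_of_simple[where w = "bessel_w mu" and e = e])
    fix s assume "s > 0" "bessel_v mu s = 0"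
    then show "bessel_w mu s \<noteq> 0" using energy_pos[of s] by (auto simp: energy_def)
  qed (use dv e in \<open>auto simp: less_imp_le less_imp_neq[symmetric]\<close>)
qed

lemma bessel_zero_bij_betw:
  assumes "nu > -1"
  shows "bij_betw (bessel_zero nu) UNIV {s. 0 < s \<and> bessel_v nu s = 0}"
proof -
  have eq: "{t. 0 < t \<and> besselJ nu t = 0} = {s. 0 < s \<and> bessel_v nu s = 0}"
    using besselJ_eq_0_iff[OF assms] by auto
  have "finite {t. 0 < t \<and> t < b \<and> besselJ nu t = 0}" for b
    by (rule finite_subset[OF _ finite_bessel_zeros[OF assms, of b]])
       (use besselJ_eq_0_iff[OF assms] in auto)
  moreover have "infinite {t. 0 < t \<and> besselJ nu t = 0}"
  proof
    assume "finite {t. 0 < t \<and> besselJ nu t = 0}"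
    then have "bdd_above {t. 0 < t \<and> besselJ nu t = 0}" by (rule bdd_above_finite)
    then obtain b where b: "\<And>t. 0 < t \<Longrightarrow> besselJ nu t = 0 \<Longrightarrow> t \<le> b"
      unfolding bdd_above_def by auto
    obtain s0 where "perturbed_oscillator (bessel_v nu) (bessel_w nu) (nu\<^sup>2 - 1/4) s0"
      using bessel_oscillator[OF assms] .
    then have "\<exists>s>max b 0. bessel_v nu s = 0" by (rule perturbed_oscillator.zeros_unbounded)
    then show False using b besselJ_eq_0_iff[OF assms] by force
  qed
  ultimately show ?thesis unfolding eq[symmetric] by (rule bessel_zero_bij)
qed

text \<open>At a zero s of J_nu the derivative \<open>bessel_w nu s\<close> reduces to its second
  term, a multiple of sqrt s J_(nu+1)(s). So the normalising factor J_(nu+1)(s)^(-2) of the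
  eigenfunctions becomes 1/w^2, the weight in the sums over zeros.\<close>

lemma bochner_riesz_indicator:
  assumes nu: "nu > -1/2" and delta: "delta > 0" and eta: "0 < eta" "eta < R" and z: "z > 0"
  shows "bochner_riesz nu delta R (indicator {0<..<eta / R}) (z / R) =
    eta powr (2 * nu + 2) * (\<Sum>s\<in>{s. 0 < s \<and> s < R \<and> bessel_v nu s = 0}.
      1 / (bessel_w nu s)\<^sup>2 * riesz_profile nu delta (eta\<^sup>2 / 4) (z\<^sup>2 / 4) (s / R) / R)"
proof -
  have nu1: "nu > -1" using nu by simp
  have R: "R > 0" using eta by linarith
  have bij: "bij_betw (bessel_zero nu) UNIV {s. 0 < s \<and> bessel_v nu s = 0}"
    by (rule bessel_zero_bij_betw[OF nu1])
  obtain s0 where "perturbed_oscillator (bessel_v nu) (bessel_w nu) (nu\<^sup>2 - 1/4) s0"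
    using bessel_oscillator[OF nu1] .
  then interpret perturbed_oscillator "bessel_v nu" "bessel_w nu" "nu\<^sup>2 - 1/4" s0 .
  let ?Z = "{s. 0 < s \<and> s < R \<and> bessel_v nu s = 0}"
  define G where "G s = eta powr (2 * nu + 2) *
      (1 / (bessel_w nu s)\<^sup>2 * riesz_profile nu delta (eta\<^sup>2 / 4) (z\<^sup>2 / 4) (s / R) / R)" for s
  have bij': "bij_betw (bessel_zero nu) {j. bessel_zero nu j < R} ?Z"
    by (rule bij_betw_subset[OF bij]) (use bij in \<open>auto simp: bij_betw_def\<close>)
  have summand: "(1 - (bessel_zero nu j)\<^sup>2 / R\<^sup>2) powr delta * bessel_coeff nu (indicator {0<..<eta / R}) j
      * bessel_psi nu j (z / R) = G (bessel_zero nu j)" if j: "bessel_zero nu j < R" for j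
  proof -
    define s where "s = bessel_zero nu j"
    have s: "0 < s" "s < R" "bessel_v nu s = 0"
      using bij j by (auto simp: s_def bij_betw_def)
    define P where "P = clifford (nu + 1) (s\<^sup>2 / 4)"
    define e where "e = eta / R"
    define x where "x = z / R"
    define Q where "Q = clifford (nu + 1) (s\<^sup>2 / 4 * e\<^sup>2) * clifford nu (s\<^sup>2 / 4 * x\<^sup>2)"
    have e: "0 < e" "e < 1" using eta by (auto simp: e_def)
    have x: "x > 0" using z R by (simp add: x_def)
    have cl0: "clifford nu (s\<^sup>2 / 4) = 0" using s by (simp add: bessel_v_eq_0_iff)
    have w0: "bessel_w nu s = - (s powr (nu + 3/2) / 2 * P)"
      by (simp add: bessel_w_def cl0 P_def)
    have "bessel_w nu s \<noteq> 0" using energy_pos[of s] s by (auto simp: energy_def)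
    then have P0: "P \<noteq> 0" using w0 by auto
    have "(s powr (nu + 3/2))\<^sup>2 = s powr (2 * nu + 3)" using s by (simp add: powr_power algebra_simps)
    also have "\<dots> = s powr (2 * nu + 1) * s\<^sup>2" using s powr_add[of s "2 * nu + 1" 2] by (simp add: add.commute)
    finally have w2: "(bessel_w nu s)\<^sup>2 = s powr (2 * nu + 1) * s\<^sup>2 / 4 * P\<^sup>2"
      unfolding w0 by (simp add: power_mult_distrib power_divide)
    have J: "besselJ (nu + 1) s = (s / 2) powr nu * (s / 2) * P"
      using besselJ_eq_clifford[of "nu + 1" s] nu s by (simp add: P_def powr_add)
    have sp: "(s / 2) powr nu > 0" using s by simp
    have coeff: "bessel_coeff nu (indicator {0<..<e}) j =
        sqrt 2 / \<bar>besselJ (nu + 1) s\<bar> * (s / 2) powr nu * (e powr (2 * nu + 2) / 2 * clifford (nu + 1) (s\<^sup>2 / 4 * e\<^sup>2))"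
      using bessel_coeff_indicator[OF nu e] s s_def by simp
    have "besselJ nu (s * x) = (s / 2) powr nu * x powr nu * clifford nu (s\<^sup>2 / 4 * x\<^sup>2)"
      using besselJ_eq_clifford[of nu "s * x"] nu s x powr_mult[of "s / 2" x nu]
      by (simp add: power_mult_distrib)
    moreover have "x powr (- nu) * x powr nu = 1" using x by (simp flip: powr_add)
    ultimately have psi: "bessel_psi nu j x = sqrt 2 / \<bar>besselJ (nu + 1) s\<bar> * (s / 2) powr nu * clifford nu (s\<^sup>2 / 4 * x\<^sup>2)"
      unfolding bessel_psi_def s_def[symmetric] by (simp add: mult_ac)
    have "bessel_coeff nu (indicator {0<..<e}) j * bessel_psi nu j x
        = ((s / 2) powr nu)\<^sup>2 / (besselJ (nu + 1) s)\<^sup>2 * (e powr (2 * nu + 2) * Q)"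
    proof -
      define k where "k = sqrt 2 / \<bar>besselJ (nu + 1) s\<bar> * (s / 2) powr nu"
      have "bessel_coeff nu (indicator {0<..<e}) j * bessel_psi nu j x = k\<^sup>2 / 2 * (e powr (2 * nu + 2) * Q)"
        unfolding coeff psi Q_def k_def[symmetric] by (simp add: power2_eq_square)
      moreover have "k\<^sup>2 = 2 * (((s / 2) powr nu)\<^sup>2 / (besselJ (nu + 1) s)\<^sup>2)"
        by (simp add: k_def power_mult_distrib power_divide)
      ultimately show ?thesis by simp
    qed
    also have "((s / 2) powr nu)\<^sup>2 / (besselJ (nu + 1) s)\<^sup>2 = s powr (2 * nu + 1) / (bessel_w nu s)\<^sup>2"
      unfolding J w2 using sp s P0 by (simp add: power_mult_distrib power_divide field_simps)
    finally have cp: "bessel_coeff nu (indicator {0<..<e}) j * bessel_psi nu j x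
        = s powr (2 * nu + 1) / (bessel_w nu s)\<^sup>2 * (e powr (2 * nu + 2) * Q)" .
    \<comment> \<open>The mass (eta/R)^(2 nu + 2) has one power of R more than the rescaling of s^(2
      nu + 1) uses up; the surplus 1/R is the mesh of the Riemann sum.\<close>
    have t: "s powr (2 * nu + 1) * e powr (2 * nu + 2) = eta powr (2 * nu + 2) * ((s / R) powr (2 * nu + 1) / R)"
    proof -
      have "R powr (2 * nu + 2) = R powr (2 * nu + 1) * R"
        using R powr_add[of R "2 * nu + 1" 1] by (simp add: add.commute add.left_commute)
      then show ?thesis
        using s R eta by (simp add: e_def powr_divide field_simps)
    qed
    have prof: "riesz_profile nu delta (eta\<^sup>2 / 4) (z\<^sup>2 / 4) (s / R)
        = (1 - s\<^sup>2 / R\<^sup>2) powr delta * (s / R) powr (2 * nu + 1) * Q"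
    proof -
      have "s\<^sup>2 / R\<^sup>2 \<le> 1" using s R by (simp add: power_mono)
      then have "max 0 (1 - (s / R)\<^sup>2) = 1 - s\<^sup>2 / R\<^sup>2" by (simp add: power_divide)
      moreover have "eta\<^sup>2 / 4 * (s / R)\<^sup>2 = s\<^sup>2 / 4 * e\<^sup>2" "z\<^sup>2 / 4 * (s / R)\<^sup>2 = s\<^sup>2 / 4 * x\<^sup>2"
        by (auto simp: e_def x_def power_divide)
      ultimately show ?thesis unfolding riesz_profile_def Q_def by (simp only:)
    qed
    have "G s = (1 - s\<^sup>2 / R\<^sup>2) powr delta * ((eta powr (2 * nu + 2) * ((s / R) powr (2 * nu + 1) / R)) / (bessel_w nu s)\<^sup>2 * Q)"
      unfolding G_def prof by (simp add: mult_ac)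
    also have "\<dots> = (1 - s\<^sup>2 / R\<^sup>2) powr delta * (bessel_coeff nu (indicator {0<..<e}) j * bessel_psi nu j x)"
      unfolding t[symmetric] cp by simp
    finally show ?thesis unfolding s_def[symmetric] e_def x_def by (simp add: mult_ac)
  qed
  have "bochner_riesz nu delta R (indicator {0<..<eta / R}) (z / R)
      = (\<Sum>j\<in>{j. bessel_zero nu j < R}. G (bessel_zero nu j))"
    unfolding bochner_riesz_def by (intro sum.cong refl summand) simp
  also have "\<dots> = (\<Sum>s\<in>?Z. G s)" by (rule sum.reindex_bij_betw[OF bij'])
  finally show ?thesis unfolding G_def sum_distrib_left .
qed

lemma bochner_riesz_indicator_approx:
  assumes nu: "nu > -1/2" and delta: "delta > 0" and eta: "eta > 0"
  obtains kap K R0 where "kap > 0" "K > 0"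
    "\<And>R z. R \<ge> R0 \<Longrightarrow> z > 0 \<Longrightarrow>
      \<bar>bochner_riesz nu delta R (indicator {0<..<eta / R}) (z / R)
        - kap * integral {0..1} (riesz_profile nu delta (eta\<^sup>2 / 4) (z\<^sup>2 / 4))\<bar> \<le> K * (1 + z + ln R) / R"
proof -
  have nu1: "nu > -1" using nu by simp
  define a where "a = eta\<^sup>2 / 4"
  have a: "a \<ge> 0" by (simp add: a_def)
  obtain s0 where "perturbed_oscillator (bessel_v nu) (bessel_w nu) (nu\<^sup>2 - 1/4) s0"
    using bessel_oscillator[OF nu1] .
  then interpret perturbed_oscillator "bessel_v nu" "bessel_w nu" "nu\<^sup>2 - 1/4" s0 .
  obtain A D R0 where A: "A > 0" and D: "D > 0"
    and approx: "\<And>R phi H C. R \<ge> R0 \<Longrightarrow> C \<ge> 0 \<Longrightarrow> continuous_on {0..2} phi \<Longrightarrow>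
       (\<And>t. 1 \<le> t \<Longrightarrow> t \<le> 2 \<Longrightarrow> phi t = 0) \<Longrightarrow>
       (\<And>t. 0 \<le> t \<Longrightarrow> t \<le> 2 \<Longrightarrow> \<bar>phi t\<bar> \<le> C) \<Longrightarrow>
       (\<And>s t. 0 \<le> s \<Longrightarrow> s \<le> t \<Longrightarrow> t \<le> 2 \<Longrightarrow> H s \<le> H t \<and> \<bar>phi t - phi s\<bar> \<le> C * (H t - H s)) \<Longrightarrow>
       \<bar>(\<Sum>s\<in>{s. 0 < s \<and> s < R \<and> bessel_v nu s = 0}. 1 / (bessel_w nu s)\<^sup>2 * phi (s / R) / R)
           - 1 / (pi * A\<^sup>2) * integral {0..1} phi\<bar> \<le> D * C * (1 + (H 2 - H 0) + ln R) / R"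
    using sum_over_zeros_approx[OF finite_bessel_zeros[OF nu1]] by blast
  obtain C where C: "C > 0"
    and bd: "\<And>z t. z \<ge> 0 \<Longrightarrow> 0 \<le> t \<Longrightarrow> t \<le> 2 \<Longrightarrow> \<bar>riesz_profile nu delta a (z\<^sup>2 / 4) t\<bar> \<le> C"
    and var: "\<And>z s t. z \<ge> 0 \<Longrightarrow> 0 \<le> s \<Longrightarrow> s \<le> t \<Longrightarrow> t \<le> 2 \<Longrightarrow>
       \<bar>riesz_profile nu delta a (z\<^sup>2 / 4) t - riesz_profile nu delta a (z\<^sup>2 / 4) s\<bar>
         \<le> C * ((max 0 (1 - s\<^sup>2) powr delta - max 0 (1 - t\<^sup>2) powr delta)
                + (t powr (2 * nu + 1) - s powr (2 * nu + 1)) + (1 + z) * (t - s))"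
    using riesz_profile_bounds[OF nu delta a] by blast
  define E where "E = eta powr (2 * nu + 2)"
  have E: "E > 0" using eta by (simp add: E_def)
  define K where "K = E * D * C * (4 + 2 powr (2 * nu + 1))"
  show ?thesis
  proof (rule that[of "E / (pi * A\<^sup>2)" K "max R0 (eta + 1)"])
    show "E / (pi * A\<^sup>2) > 0" using E A by simp
    show "K > 0" using E D C by (simp add: K_def add_pos_nonneg)
  next
    fix R z :: real assume R: "R \<ge> max R0 (eta + 1)" and z: "z > 0"
    have R1: "R \<ge> 1" "R \<ge> R0" "eta < R" using R eta by auto
    \<comment> \<open>The sum of the three monotone terms of the variation bound, the first negated
      because it decreases. Its total increment over [0, 2] is linear in z, which is the source of z
      in the error.\<close>
    define H where "H t = - (max 0 (1 - t\<^sup>2) powr delta) + t powr (2 * nu + 1) + (1 + z) * t" for t :: real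
    define S where "S = (\<Sum>s\<in>{s. 0 < s \<and> s < R \<and> bessel_v nu s = 0}.
        1 / (bessel_w nu s)\<^sup>2 * riesz_profile nu delta a (z\<^sup>2 / 4) (s / R) / R)"
    define U where "U = integral {0..1} (riesz_profile nu delta a (z\<^sup>2 / 4))"
    have "\<bar>S - 1 / (pi * A\<^sup>2) * U\<bar> \<le> D * C * (1 + (H 2 - H 0) + ln R) / R"
      unfolding S_def U_def
    proof (rule approx[OF R1(2)])
      show "continuous_on {0..2} (riesz_profile nu delta a (z\<^sup>2 / 4))"
        by (rule riesz_profile_continuous[OF nu delta])
    next
      fix t :: real assume "1 \<le> t" "t \<le> 2"
      then have "max 0 (1 - t\<^sup>2) = 0" by (simp add: one_le_power)
      then show "riesz_profile nu delta a (z\<^sup>2 / 4) t = 0"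
        by (simp add: riesz_profile_def)
    next
      fix s t :: real assume st: "0 \<le> s" "s \<le> t" "t \<le> 2"
      have sq: "s\<^sup>2 \<le> t\<^sup>2" using st by (intro power_mono)
      have "max 0 (1 - t\<^sup>2) powr delta \<le> max 0 (1 - s\<^sup>2) powr delta"
        using sq delta by (intro powr_mono2) auto
      moreover have "s powr (2 * nu + 1) \<le> t powr (2 * nu + 1)" using st nu by (intro powr_mono2) auto
      moreover have "(1 + z) * s \<le> (1 + z) * t" using st z by (intro mult_left_mono) auto
      ultimately have "H s \<le> H t" by (simp add: H_def)
      moreover have "\<bar>riesz_profile nu delta a (z\<^sup>2 / 4) t - riesz_profile nu delta a (z\<^sup>2 / 4) s\<bar> \<le> C * (H t - H s)"
        using var[of z s t] st z by (simp add: H_def algebra_simps)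
      ultimately show "H s \<le> H t \<and>
          \<bar>riesz_profile nu delta a (z\<^sup>2 / 4) t - riesz_profile nu delta a (z\<^sup>2 / 4) s\<bar> \<le> C * (H t - H s)" ..
    qed (use C bd z in auto)
    also have "H 2 - H 0 = 2 powr (2 * nu + 1) + 2 * (1 + z) + 1"
      using delta nu by (simp add: H_def)
    finally have "E * \<bar>S - 1 / (pi * A\<^sup>2) * U\<bar>
        \<le> E * (D * C * (1 + (2 powr (2 * nu + 1) + 2 * (1 + z) + 1) + ln R) / R)"
      using E by (intro mult_left_mono) auto
    also have "\<dots> \<le> K * (1 + z + ln R) / R"
    proof -
      have "0 \<le> 2 powr (2 * nu + 1) * (z + ln R)" "0 \<le> ln R" using z R1 by auto
      then have "1 + (2 powr (2 * nu + 1) + 2 * (1 + z) + 1) + ln R \<le> (4 + 2 powr (2 * nu + 1)) * (1 + z + ln R)"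
        using z by (simp add: algebra_simps)
      then have "E * D * C / R * (1 + (2 powr (2 * nu + 1) + 2 * (1 + z) + 1) + ln R)
          \<le> E * D * C / R * ((4 + 2 powr (2 * nu + 1)) * (1 + z + ln R))"
        using E D C R1 by (intro mult_left_mono) auto
      then show ?thesis by (simp add: K_def mult_ac)
    qed
    also have "E * \<bar>S - 1 / (pi * A\<^sup>2) * U\<bar> = \<bar>E * S - E / (pi * A\<^sup>2) * U\<bar>"
    proof -
      have "E * \<bar>S - 1 / (pi * A\<^sup>2) * U\<bar> = \<bar>E * (S - 1 / (pi * A\<^sup>2) * U)\<bar>"
        using E by (simp add: abs_mult)
      then show ?thesis by (simp add: right_diff_distrib)
    qed
    also have "E * S = bochner_riesz nu delta R (indicator {0<..<eta / R}) (z / R)"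
      using bochner_riesz_indicator[OF nu delta eta R1(3) z] by (simp add: E_def S_def a_def)
    finally show "\<bar>bochner_riesz nu delta R (indicator {0<..<eta / R}) (z / R)
        - E / (pi * A\<^sup>2) * integral {0..1} (riesz_profile nu delta (eta\<^sup>2 / 4) (z\<^sup>2 / 4))\<bar> \<le> K * (1 + z + ln R) / R"
      by (simp add: U_def a_def)
  qed
qed

text \<open>Used only for finiteness, so the bound may depend on R: \<open>Lp_nu\<close> passes
  through \<open>enn2real\<close>, which would turn an infinite integral into 0 and ruin a lower
  bound.\<close>

lemma bochner_riesz_indicator_bounded:
  assumes nu: "nu > -1/2" and delta: "delta > 0" and eta: "0 < eta" "eta < R"
  obtains B where "\<And>x. x > 0 \<Longrightarrow> \<bar>bochner_riesz nu delta R (indicator {0<..<eta / R}) x\<bar> \<le> B"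
proof -
  have R: "R > 0" using eta by linarith
  have a: "eta\<^sup>2 / 4 \<ge> 0" by simp
  obtain C where C: "C > 0"
    and bd: "\<And>z t. z \<ge> 0 \<Longrightarrow> 0 \<le> t \<Longrightarrow> t \<le> 2 \<Longrightarrow> \<bar>riesz_profile nu delta (eta\<^sup>2 / 4) (z\<^sup>2 / 4) t\<bar> \<le> C"
    using riesz_profile_bounds[OF nu delta a] by metis
  let ?Z = "{s. 0 < s \<and> s < R \<and> bessel_v nu s = 0}"
  show ?thesis
  proof (rule that[of "eta powr (2 * nu + 2) * (\<Sum>s\<in>?Z. 1 / (bessel_w nu s)\<^sup>2 * C / R)"])
    fix x :: real assume x: "x > 0"
    then have z: "R * x > 0" using R by simp
    have "\<bar>\<Sum>s\<in>?Z. 1 / (bessel_w nu s)\<^sup>2 * riesz_profile nu delta (eta\<^sup>2 / 4) ((R * x)\<^sup>2 / 4) (s / R) / R\<bar>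
        \<le> (\<Sum>s\<in>?Z. 1 / (bessel_w nu s)\<^sup>2 * C / R)"
    proof (rule order_trans[OF sum_abs sum_mono])
      fix s assume s: "s \<in> ?Z"
      then have "\<bar>riesz_profile nu delta (eta\<^sup>2 / 4) ((R * x)\<^sup>2 / 4) (s / R)\<bar> \<le> C"
        using R z by (intro bd) (auto simp: field_simps)
      then have "1 / (bessel_w nu s)\<^sup>2 * \<bar>riesz_profile nu delta (eta\<^sup>2 / 4) ((R * x)\<^sup>2 / 4) (s / R)\<bar> / R
          \<le> 1 / (bessel_w nu s)\<^sup>2 * C / R"
        using R by (intro divide_right_mono mult_left_mono) auto
      then show "\<bar>1 / (bessel_w nu s)\<^sup>2 * riesz_profile nu delta (eta\<^sup>2 / 4) ((R * x)\<^sup>2 / 4) (s / R) / R\<bar>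
          \<le> 1 / (bessel_w nu s)\<^sup>2 * C / R"
        using R by (simp add: abs_mult)
    qed
    then show "\<bar>bochner_riesz nu delta R (indicator {0<..<eta / R}) x\<bar>
        \<le> eta powr (2 * nu + 2) * (\<Sum>s\<in>?Z. 1 / (bessel_w nu s)\<^sup>2 * C / R)"
      using bochner_riesz_indicator[OF nu delta eta z] R eta
      by (simp add: abs_mult)
  qed
qed

lemma bochner_riesz_indicator_lower:
  assumes nu: "nu > -1/2" and delta: "delta > 0" "delta \<le> nu + 1/2"
  obtains eta c th M q R1 where "eta > 0" "c > 0" "M \<ge> 2" "0 < q" "q < 1" "R1 \<ge> 1" "R1 > eta"
    "\<And>R z. R \<ge> R1 \<Longrightarrow> M \<le> z \<Longrightarrow> z \<le> R powr q \<Longrightarrow> \<bar>cos (z - th)\<bar> \<ge> 1/2 \<Longrightarrow>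
       \<bar>bochner_riesz nu delta R (indicator {0<..<eta / R}) (z / R)\<bar> \<ge> c * z powr (- (nu + delta + 3/2))"
proof -
  define m where "m = nu + delta + 3/2"
  have m: "m > 0" using nu delta by (simp add: m_def)
  obtain a c th M where a: "a > 0" and c: "c > 0" and M: "M \<ge> 2" and low:
    "\<And>z. z \<ge> M \<Longrightarrow> \<bar>cos (z - th)\<bar> \<ge> 1/2 \<Longrightarrow>
       \<bar>integral {0..1} (riesz_profile nu delta a (z\<^sup>2 / 4))\<bar> \<ge> c * z powr (- m)"
    using riesz_profile_integral_lower[OF nu delta] unfolding m_def by metis
  define eta where "eta = 2 * sqrt a"
  have eta: "eta > 0" using a by (simp add: eta_def)
  have ea: "eta\<^sup>2 / 4 = a" using a by (simp add: eta_def power_mult_distrib)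
  obtain kap K R0 where kap: "kap > 0" and K: "K > 0" and approx:
    "\<And>R z. R \<ge> R0 \<Longrightarrow> z > 0 \<Longrightarrow>
      \<bar>bochner_riesz nu delta R (indicator {0<..<eta / R}) (z / R)
        - kap * integral {0..1} (riesz_profile nu delta a (z\<^sup>2 / 4))\<bar> \<le> K * (1 + z + ln R) / R"
    using bochner_riesz_indicator_approx[OF nu delta(1) eta] unfolding ea by metis
  \<comment> \<open>With q(m + 1) = 1/2 the error R^(q - 1) equals R^(-1/2) R^(-q m), while z \<le>
    R^q gives z^(-m) \<ge> R^(-q m): the main term wins by sqrt R.\<close>
  define q where "q = 1 / (2 * (m + 1))"
  have q: "q > 0" "q < 1" using m by (auto simp: q_def field_simps)
  have qm: "q * (m + 1) = 1/2" using m by (simp add: q_def)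
  define W where "W = K * (2 + 1 / q)"
  have W: "W > 0" using K q by (simp add: W_def add_pos_pos)
  \<comment> \<open>The square makes sqrt R \<ge> 2 W/(kap c), so the error takes at most half of
    the main term.\<close>
  define R1 where "R1 = max (max R0 (eta + 1)) ((2 * W / (kap * c))\<^sup>2)"
  show ?thesis
  proof (rule that[of eta "kap * c / 2" M q R1 th])
    fix R z assume R: "R \<ge> R1" and z: "M \<le> z" "z \<le> R powr q" "\<bar>cos (z - th)\<bar> \<ge> 1/2"
    have R': "R \<ge> R0" "R \<ge> 1" "R \<ge> (2 * W / (kap * c))\<^sup>2"
      using R eta by (auto simp: R1_def)
    have z0: "z \<ge> 2" using z M by linarith
    define B where "B = bochner_riesz nu delta R (indicator {0<..<eta / R}) (z / R)"
    define U where "U = integral {0..1} (riesz_profile nu delta a (z\<^sup>2 / 4))"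
    have "kap * (c * z powr (- m)) \<le> kap * \<bar>U\<bar>"
      using low[OF z(1,3)] kap by (intro mult_left_mono) (auto simp: U_def)
    also have "\<dots> = \<bar>kap * U\<bar>" using kap by (simp add: abs_mult)
    finally have b1: "kap * c * z powr (- m) - K * (1 + z + ln R) / R \<le> \<bar>B\<bar>"
      using approx[OF R'(1), of z] z0 unfolding B_def[symmetric] U_def[symmetric] by (simp add: mult_ac)
    have "ln R \<le> R powr q / q" using R' q by (intro ln_powr_bound) auto
    moreover have "1 \<le> R powr q" using R' q by (intro ge_one_powr_ge_zero) auto
    ultimately have "1 + z + ln R \<le> (2 + 1 / q) * R powr q"
      using z by (simp add: algebra_simps)
    then have "K * (1 + z + ln R) / R \<le> K * ((2 + 1 / q) * R powr q) / R"
      using K R' by (intro divide_right_mono mult_left_mono) auto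
    also have "\<dots> = W * (R powr q / R)" by (simp add: W_def)
    also have "\<dots> \<le> kap * c / 2 * R powr (- (q * m))"
    proof -
      have "sqrt R \<ge> 2 * W / (kap * c)"
        using R'(3) by (intro real_le_rsqrt) auto
      then have "W \<le> kap * c / 2 * sqrt R" using kap c by (simp add: field_simps)
      then have "W * (R powr q / R) \<le> kap * c / 2 * sqrt R * (R powr q / R)"
        using R' by (intro mult_right_mono) auto
      also have "\<dots> = kap * c / 2 * (sqrt R * R powr q / R)" by simp
      also have "sqrt R * R powr q / R = R powr (1/2 + q - 1)"
      proof -
        have "R powr (1/2 + q - 1) = R powr (1/2) * R powr q / R powr 1"
          by (simp only: powr_add powr_diff)
        then show ?thesis using R' by (simp add: powr_half_sqrt)
      qed
      also have "R powr (1/2 + q - 1) = R powr (- (q * m))"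
      proof -
        have "1/2 + q - 1 = - (q * m)" using qm by (simp add: algebra_simps)
        then show ?thesis by (simp only:)
      qed
      finally show ?thesis .
    qed
    also have "\<dots> \<le> kap * c / 2 * z powr (- m)"
    proof -
      have "(R powr q) powr (- m) \<le> z powr (- m)" using z z0 m by (intro powr_mono2') auto
      then have "R powr (- (q * m)) \<le> z powr (- m)" by (simp add: powr_powr)
      then show ?thesis using kap c by (intro mult_left_mono) auto
    qed
    finally show "kap * c / 2 * z powr (- (nu + delta + 3/2))
        \<le> \<bar>bochner_riesz nu delta R (indicator {0<..<eta / R}) (z / R)\<bar>"
    proof -
      have "kap * c * z powr (- m) = 2 * (kap * c / 2 * z powr (- m))" by simp
      moreover assume "K * (1 + z + ln R) / R \<le> kap * c / 2 * z powr (- m)"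
      ultimately show ?thesis using b1 unfolding B_def m_def by linarith
    qed
  qed (use eta kap c M q in \<open>auto simp: R1_def\<close>)
qed

section \<open>From pointwise lower bounds to the logarithm\<close>

lemma sum_inverse_ge_ln:
  assumes "N \<le> N'"
  shows "ln ((real N' + 1) / (real N + 1)) \<le> (\<Sum>n\<in>{N..<N'}. 1 / (real n + 1))"
  using assms
proof (induction N' rule: dec_induct)
  case (step k)
  have "ln ((real k + 2) / (real k + 1)) \<le> (real k + 2) / (real k + 1) - 1"
    by (intro ln_le_minus_one) auto
  also have "\<dots> = 1 / (real k + 1)" by (simp add: field_simps)
  finally have "ln (real k + 2) - ln (real k + 1) \<le> 1 / (real k + 1)" by (simp add: ln_div)
  then show ?case using step by (simp add: ln_div add_ac)
qed simp

text \<open>On the pieces z in [th + pi n, th + pi n + pi/3] the cosine has modulus at least 1/2.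
  They are disjoint and of equal length, so a step function below F on them has as integral a
  multiple of a harmonic sum over n, up to about R^q/pi; it grows like q ln R.\<close>

lemma nn_integral_log_lower:
  fixes th M q :: real
  assumes q: "0 < q" "q < 1"
  obtains c' R2 where "c' > 0"
    "\<And>R c F. R \<ge> R2 \<Longrightarrow> c \<ge> 0 \<Longrightarrow>
      (\<And>z. M \<le> z \<Longrightarrow> z \<le> R powr q \<Longrightarrow> \<bar>cos (z - th)\<bar> \<ge> 1/2 \<Longrightarrow> c / z \<le> F (z / R)) \<Longrightarrow>
      ennreal (c * c' * ln R / R) \<le> (\<integral>\<^sup>+ x\<in>{0<..<1}. ennreal (F x) \<partial>lborel)"
proof -
  define p where "p n = th + pi * real n" for n
  define N where "N = nat \<lceil>\<bar>M\<bar> + 1 + \<bar>th\<bar>\<rceil>"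
  have pN: "p n \<ge> M" "p n \<ge> 1" if "n \<ge> N" for n
  proof -
    have "real n \<ge> \<bar>M\<bar> + 1 + \<bar>th\<bar>" using that unfolding N_def by linarith
    moreover have "1 * real n \<le> pi * real n" using pi_ge_two by (intro mult_right_mono) auto
    ultimately show "p n \<ge> M" "p n \<ge> 1" unfolding p_def by linarith+
  qed
  define K0 where "K0 = \<bar>th\<bar> + 5"
  have K0: "K0 > 0" by (simp add: K0_def)
  have pK: "p n + pi / 3 \<le> K0 * (real n + 1)" for n
  proof -
    have "pi * real n \<le> 4 * real n" using pi_less_4 by (intro mult_right_mono) auto
    moreover have "0 \<le> \<bar>th\<bar> * real n" by simp
    moreover have "pi / 3 \<le> 5" using pi_less_4 by simp
    moreover have "K0 * (real n + 1) = \<bar>th\<bar> * real n + \<bar>th\<bar> + 5 * real n + 5"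
      by (simp add: K0_def algebra_simps)
    ultimately show ?thesis unfolding p_def by linarith
  qed
  \<comment> \<open>The second entry gives R^q \<ge> 2|th| + 1, so that (R^q - th)/pi \<ge> R^q/8.
    The third makes ln(8(N + 1)) at most (q/2) ln R, so the discarded initial windows cost at most
    half of the logarithm.\<close>
  define R2 where "R2 = max (max 2 ((2 * \<bar>th\<bar> + 1) powr (1 / q))) (exp (2 * ln (8 * (real N + 1)) / q))"
  show ?thesis
  proof (rule that[of "pi / 3 / K0 * (q / 2)" R2])
    show "pi / 3 / K0 * (q / 2) > 0" using K0 q by simp
  next
    fix R c F assume R: "R \<ge> R2" and c: "c \<ge> (0::real)"
      and F: "\<And>z. M \<le> z \<Longrightarrow> z \<le> R powr q \<Longrightarrow> \<bar>cos (z - th)\<bar> \<ge> 1/2 \<Longrightarrow> c / z \<le> F (z / R)"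
    have R2: "R \<ge> 2" "R \<ge> (2 * \<bar>th\<bar> + 1) powr (1 / q)" "R \<ge> exp (2 * ln (8 * (real N + 1)) / q)"
      using R by (auto simp: R2_def)
    have "((2 * \<bar>th\<bar> + 1) powr (1 / q)) powr q \<le> R powr q"
      using R2 q by (intro powr_mono2) auto
    then have Rq: "2 * \<bar>th\<bar> + 1 \<le> R powr q" using q by (simp add: powr_powr)
    have Rq1: "R powr q < R"
      using R2 q powr_less_mono[of q 1 R] by simp
    have "ln (exp (2 * ln (8 * (real N + 1)) / q)) \<le> ln R" using R2 by (subst ln_le_cancel_iff) auto
    then have lnR: "ln (8 * (real N + 1)) \<le> q / 2 * ln R" using q by (simp add: field_simps)
    \<comment> \<open>The last n with p n \<le> R^q. Summing over n < N' keeps every piece entirely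
      inside the range z \<le> R^q.\<close>
    define N' where "N' = nat \<lfloor>(R powr q - th) / pi\<rfloor>"
    have x0: "(R powr q - th) / pi \<ge> 0" using Rq by (intro divide_nonneg_pos) auto
    have N': "real N' \<le> (R powr q - th) / pi" "(R powr q - th) / pi \<le> real N' + 1"
      unfolding N'_def using x0 by linarith+
    have pN': "p N' \<le> R powr q" using N'(1) by (simp add: p_def field_simps)
    have "R powr q / 8 \<le> (R powr q - th) / pi"
    proof -
      have "R powr q / 2 / 4 \<le> (R powr q - th) / pi"
        using Rq pi_less_4 by (intro frac_le) auto
      then show ?thesis by simp
    qed
    then have "R powr q / 8 \<le> real N' + 1" using N'(2) by linarith
    then have "R powr q / 8 / (real N + 1) \<le> (real N' + 1) / (real N + 1)" by (intro divide_right_mono) auto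
    then have "ln (R powr q / (8 * (real N + 1))) \<le> ln ((real N' + 1) / (real N + 1))"
      using R2 by (subst ln_le_cancel_iff) auto
    moreover have "ln (R powr q / (8 * (real N + 1))) = q * ln R - ln (8 * (real N + 1))"
      using R2 by (simp add: ln_div ln_powr)
    ultimately have L: "q / 2 * ln R \<le> ln ((real N' + 1) / (real N + 1))" using lnR by linarith
    have H: "q / 2 * ln R \<le> (\<Sum>n\<in>{N..<N'}. 1 / (real n + 1))"
    proof (cases "N \<le> N'")
      case True
      then show ?thesis using L sum_inverse_ge_ln by fastforce
    next
      case False
      then have "ln ((real N' + 1) / (real N + 1)) \<le> 0" by (subst ln_le_zero_iff) auto
      moreover have "(\<Sum>n\<in>{N..<N'}. 1 / (real n + 1)) = 0" using False by simp
      ultimately show ?thesis using L by linarith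
    qed
    define J where "J n = {p n / R..(p n + pi / 3) / R}" for n
    define d where "d n = c / (p n + pi / 3)" for n
    have d0: "d n \<ge> 0" if "n \<ge> N" for n
      unfolding d_def using c pN[OF that] by (intro divide_nonneg_nonneg add_nonneg_nonneg) auto
    have unique: "m = n" if "x \<in> J m" "x \<in> J n" for x m n
    proof -
      have aux: False if "m < n" "x \<in> J m" "x \<in> J n" for m n
      proof -
        have "p n \<le> p m + pi / 3" using that R2 by (auto simp: J_def field_simps)
        moreover have "pi * (real m + 1) \<le> pi * real n" using that by (intro mult_left_mono) auto
        then have "p n \<ge> p m + pi" by (simp add: p_def algebra_simps)
        ultimately show False using pi_gt_zero by linarith
      qed
      then show ?thesis using that by (metis linorder_neqE_nat)
    qed
    have point: "(\<Sum>n\<in>{N..<N'}. ennreal (d n) * indicator (J n) x) \<le> ennreal (F x) * indicator {0<..<1} x" for x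
    proof (cases "\<exists>n\<in>{N..<N'}. x \<in> J n")
      case False
      then have "(\<Sum>n\<in>{N..<N'}. ennreal (d n) * indicator (J n) x) = 0"
        by (intro sum.neutral) auto
      then show ?thesis by simp
    next
      case True
      then obtain n where n: "n \<in> {N..<N'}" "x \<in> J n" by blast
      have "(\<Sum>k\<in>{N..<N'}. ennreal (d k) * indicator (J k) x) = (\<Sum>k\<in>{N..<N'}. if k = n then ennreal (d k) else 0)"
        using n unique by (intro sum.cong) (auto simp: indicator_def)
      also have "\<dots> = ennreal (d n)" using n by simp
      finally have s: "(\<Sum>k\<in>{N..<N'}. ennreal (d k) * indicator (J k) x) = ennreal (d n)" .
      define z where "z = R * x"
      have x: "x = z / R" using R2 by (simp add: z_def)
      have z: "p n \<le> z" "z \<le> p n + pi / 3" using n R2 by (auto simp: J_def z_def field_simps)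
      have "pi * (real n + 1) \<le> pi * real N'" using n by (intro mult_left_mono) auto
      then have "p n + pi \<le> p N'" by (simp add: p_def algebra_simps)
      then have zR: "z \<le> R powr q" using z pN' pi_gt_zero by linarith
      have zM: "M \<le> z" "1 \<le> z" using pN[of n] n z by auto
      have "cos (z - th) = (-1) ^ n * cos (z - p n)"
      proof -
        have "z - th = (z - p n) + real n * pi" by (simp add: p_def)
        then have "cos (z - th) = cos ((z - p n) + real n * pi)" by (simp only:)
        then show ?thesis by (simp add: cos_add)
      qed
      then have "\<bar>cos (z - th)\<bar> = \<bar>cos (z - p n)\<bar>" by (simp add: abs_mult)
      moreover have "cos (pi / 3) \<le> cos (z - p n)"
        using z pi_gt_zero by (subst cos_mono_le_eq) auto
      ultimately have "\<bar>cos (z - th)\<bar> \<ge> 1/2" by (simp add: cos_60)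
      then have "c / z \<le> F x" unfolding x using zM zR by (intro F)
      moreover have "d n \<le> c / z" unfolding d_def using z zM c by (intro divide_left_mono) auto
      ultimately have "d n \<le> F x" by linarith
      moreover have "x \<in> {0<..<1}" using zM zR Rq1 R2 by (auto simp: x field_simps)
      ultimately show ?thesis unfolding s by (simp add: ennreal_leI)
    qed
    have len: "emeasure lborel (J n) = ennreal (pi / 3 / R)" for n
      unfolding J_def using R2 by (subst emeasure_lborel_Icc) (auto simp: field_simps)
    have "c * (pi / 3 / K0 * (q / 2)) * ln R / R = c * (pi / 3) / K0 / R * (q / 2 * ln R)" by simp
    also have "\<dots> \<le> c * (pi / 3) / K0 / R * (\<Sum>n\<in>{N..<N'}. 1 / (real n + 1))"
      using H c K0 R2 by (intro mult_left_mono) auto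
    also have "\<dots> = (\<Sum>n\<in>{N..<N'}. c / (K0 * (real n + 1)) * (pi / 3 / R))"
      unfolding sum_distrib_left by (intro sum.cong) auto
    also have "\<dots> \<le> (\<Sum>n\<in>{N..<N'}. d n * (pi / 3 / R))"
    proof (rule sum_mono)
      fix n assume "n \<in> {N..<N'}"
      then have "p n + pi / 3 > 0" using pN(2)[of n] by (auto intro!: add_pos_pos)
      then have "c / (K0 * (real n + 1)) \<le> d n"
        unfolding d_def using c pK[of n] by (intro divide_left_mono mult_pos_pos) (auto simp: K0)
      then show "c / (K0 * (real n + 1)) * (pi / 3 / R) \<le> d n * (pi / 3 / R)"
        using R2 by (intro mult_right_mono) auto
    qed
    finally have "ennreal (c * (pi / 3 / K0 * (q / 2)) * ln R / R) \<le> ennreal (\<Sum>n\<in>{N..<N'}. d n * (pi / 3 / R))"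
      by (rule ennreal_leI)
    also have "\<dots> = (\<Sum>n\<in>{N..<N'}. ennreal (d n) * ennreal (pi / 3 / R))"
    proof -
      have "ennreal (\<Sum>n\<in>{N..<N'}. d n * (pi / 3 / R)) = (\<Sum>n\<in>{N..<N'}. ennreal (d n * (pi / 3 / R)))"
        using d0 R2 by (intro sum_ennreal[symmetric]) auto
      also have "\<dots> = (\<Sum>n\<in>{N..<N'}. ennreal (d n) * ennreal (pi / 3 / R))"
        using d0 R2 by (intro sum.cong refl ennreal_mult) auto
      finally show ?thesis .
    qed
    also have "\<dots> = (\<Sum>n\<in>{N..<N'}. \<integral>\<^sup>+ x. ennreal (d n) * indicator (J n) x \<partial>lborel)"
    proof (rule sum.cong[OF refl])
      fix n
      have J: "J n \<in> sets lborel" by (simp add: J_def)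
      show "ennreal (d n) * ennreal (pi / 3 / R) = (\<integral>\<^sup>+ x. ennreal (d n) * indicator (J n) x \<partial>lborel)"
        unfolding len[of n, symmetric] by (rule nn_integral_cmult_indicator[OF J, symmetric])
    qed
    also have "\<dots> = (\<integral>\<^sup>+ x. (\<Sum>n\<in>{N..<N'}. ennreal (d n) * indicator (J n) x) \<partial>lborel)"
      by (intro nn_integral_sum[symmetric]) (simp add: J_def)
    also have "\<dots> \<le> (\<integral>\<^sup>+ x\<in>{0<..<1}. ennreal (F x) \<partial>lborel)"
      by (intro nn_integral_mono point)
    finally show "ennreal (c * (pi / 3 / K0 * (q / 2)) * ln R / R) \<le> (\<integral>\<^sup>+ x\<in>{0<..<1}. ennreal (F x) \<partial>lborel)" .
  qed
qed

section \<open>Norms of short intervals and the quotient of norms\<close>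

lemma nn_integral_weight_indicator:
  assumes nu: "nu > -1/2" and e: "0 < e" "e < 1" and p: "p > 0"
  defines "Y \<equiv> \<integral>\<^sup>+ x\<in>{0<..<1}. ennreal (\<bar>indicator {0<..<e} x\<bar> powr p * x powr (2 * nu + 1)) \<partial>lborel"
  shows "0 < Y" "Y \<le> ennreal (e powr (2 * nu + 2))"
proof -
  have "Y \<le> (\<integral>\<^sup>+ x. ennreal (e powr (2 * nu + 1)) * indicator {0<..<e} x \<partial>lborel)"
    unfolding Y_def
  proof (rule nn_integral_mono)
    fix x :: real
    show "ennreal (\<bar>indicator {0<..<e} x\<bar> powr p * x powr (2 * nu + 1)) * indicator {0<..<1} x
        \<le> ennreal (e powr (2 * nu + 1)) * indicator {0<..<e} x"
      using nu e p by (auto simp: indicator_def intro!: ennreal_leI powr_mono2)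
  qed
  also have "\<dots> = ennreal (e powr (2 * nu + 1)) * ennreal e"
    using e by (subst nn_integral_cmult_indicator) auto
  also have "\<dots> = ennreal (e powr (2 * nu + 1) * e)"
    using e by (simp add: ennreal_mult)
  also have "e powr (2 * nu + 1) * e = e powr (2 * nu + 2)"
    using e powr_add[of e "2 * nu + 1" 1] by (simp add: add.commute add.left_commute)
  finally show "Y \<le> ennreal (e powr (2 * nu + 2))" .
  \<comment> \<open>The weight tends to 0 at the origin, so a positive lower bound for it is taken
    on the half (e/2, e).\<close>
  have "0 < ennreal ((e / 2) powr (2 * nu + 1)) * ennreal (e / 2)"
    using e by (simp add: ennreal_zero_less_mult_iff)
  also have "\<dots> = (\<integral>\<^sup>+ x. ennreal ((e / 2) powr (2 * nu + 1)) * indicator {e / 2<..<e} x \<partial>lborel)"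
    using e by (subst nn_integral_cmult_indicator) auto
  also have "\<dots> \<le> Y"
    unfolding Y_def
  proof (rule nn_integral_mono)
    fix x :: real
    show "ennreal ((e / 2) powr (2 * nu + 1)) * indicator {e / 2<..<e} x
        \<le> ennreal (\<bar>indicator {0<..<e} x\<bar> powr p * x powr (2 * nu + 1)) * indicator {0<..<1} x"
      using nu e p by (auto simp: indicator_def intro!: ennreal_leI powr_mono2)
  qed
  finally show "0 < Y" .
qed

lemma mu_nu_Ioo_pos:
  assumes nu: "nu > -1/2" and e: "0 < e" "e < 1"
  shows "mu_nu nu {0<..<e} > 0"
proof -
  have "0 < (\<integral>\<^sup>+ x\<in>{0<..<1}. ennreal (\<bar>indicator {0<..<e} x\<bar> powr 1 * x powr (2 * nu + 1)) \<partial>lborel)"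
    using nn_integral_weight_indicator(1)[OF nu e, of 1] by simp
  also have "\<dots> \<le> mu_nu nu {0<..<e}"
    unfolding mu_nu_def by (intro nn_integral_mono) (auto simp: indicator_def)
  finally show ?thesis .
qed

lemma Lp_nu_indicator_bounds:
  assumes nu: "nu > -1/2" and e: "0 < e" "e < 1" and p: "p > 0"
  shows "0 < Lp_nu nu p (indicator {0<..<e})"
    "Lp_nu nu p (indicator {0<..<e}) \<le> (e powr (2 * nu + 2)) powr (1 / p)"
proof -
  define Y where "Y = (\<integral>\<^sup>+ x\<in>{0<..<1}. ennreal (\<bar>indicator {0<..<e} x\<bar> powr p * x powr (2 * nu + 1)) \<partial>lborel)"
  have Y: "0 < Y" "Y \<le> ennreal (e powr (2 * nu + 2))"
    unfolding Y_def using nn_integral_weight_indicator[OF nu e p] by auto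
  then have Yfin: "Y < \<infinity>" by (auto intro: le_less_trans)
  then have "enn2real Y > 0" using Y by (simp add: enn2real_positive_iff)
  moreover have "enn2real Y \<le> e powr (2 * nu + 2)"
    using Y by (intro enn2real_leI) auto
  moreover have "Lp_nu nu p (indicator {0<..<e}) = enn2real Y powr (1 / p)"
    by (simp add: Lp_nu_def Y_def)
  ultimately show "0 < Lp_nu nu p (indicator {0<..<e})"
    "Lp_nu nu p (indicator {0<..<e}) \<le> (e powr (2 * nu + 2)) powr (1 / p)"
    using p by (auto intro!: powr_mono2)
qed

text \<open>Equality delta = nu + 1/2 is included, so that both claims of the theorem follow from
  it. The integral of |B|^p and the mass of the interval both scale as R^(-(2 nu + 2)); in the
  quotient only the logarithm survives. The witness is e = eta/R.\<close>

lemma bochner_riesz_norm_ratio: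
  assumes nu: "nu > -1/2" and delta: "delta > 0" "delta \<le> nu + 1/2"
  defines "p \<equiv> 4 * (nu + 1) / (2 * nu + 3 + 2 * delta)"
  obtains C where "C > 0"
    "eventually (\<lambda>R. \<exists>e. 0 < e \<and> e < 1 \<and>
       C * ln R powr (1 / p) \<le> Lp_nu nu p (bochner_riesz nu delta R (indicator {0<..<e}))
          / Lp_nu nu p (indicator {0<..<e})) at_top"
proof -
  define m where "m = nu + delta + 3/2"
  have m: "m > 0" using nu delta by (simp add: m_def)
  have p: "p > 0" unfolding p_def using nu delta by simp
  have "2 * nu + 3 + 2 * delta = 2 * m" by (simp add: m_def)
  then have pm: "m * p = 2 * nu + 2" using m by (simp add: p_def)
  obtain eta c th M q R1 where eta: "eta > 0" and c: "c > 0" and M: "M \<ge> 2" and q: "0 < q" "q < 1"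
    and R1: "R1 \<ge> 1" "R1 > eta"
    and low: "\<And>R z. R \<ge> R1 \<Longrightarrow> M \<le> z \<Longrightarrow> z \<le> R powr q \<Longrightarrow> \<bar>cos (z - th)\<bar> \<ge> 1/2 \<Longrightarrow>
       \<bar>bochner_riesz nu delta R (indicator {0<..<eta / R}) (z / R)\<bar> \<ge> c * z powr (- m)"
    using bochner_riesz_indicator_lower[OF nu delta] unfolding m_def by metis
  obtain c' R2 where c': "c' > 0" and log_lower: "\<And>R c F. R \<ge> R2 \<Longrightarrow> c \<ge> 0 \<Longrightarrow>
      (\<And>z. M \<le> z \<Longrightarrow> z \<le> R powr q \<Longrightarrow> \<bar>cos (z - th)\<bar> \<ge> 1/2 \<Longrightarrow> c / z \<le> F (z / R)) \<Longrightarrow>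
      ennreal (c * c' * ln R / R) \<le> (\<integral>\<^sup>+ x\<in>{0<..<1}. ennreal (F x) \<partial>lborel)"
    using nn_integral_log_lower[OF q, of M th] by blast
  \<comment> \<open>The numerator c^p c' comes from integrating the pointwise bound over z; the
    denominator is the mass bound (eta/R)^(2 nu + 2) stripped of its power of R.\<close>
  define k where "k = c powr p * c' / eta powr (2 * nu + 2)"
  have k: "k > 0" using c c' eta by (simp add: k_def)
  have main: "k powr (1 / p) * ln R powr (1 / p)
      \<le> Lp_nu nu p (bochner_riesz nu delta R (indicator {0<..<eta / R})) / Lp_nu nu p (indicator {0<..<eta / R})"
    if R: "R \<ge> max R1 R2" for R
  proof -
    have R': "R \<ge> R1" "R \<ge> R2" "R \<ge> 1" "eta < R" using R R1 by auto
    have e: "0 < eta / R" "eta / R < 1" using eta R' by auto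
    define B where "B = bochner_riesz nu delta R (indicator {0<..<eta / R})"
    define X where "X = (\<integral>\<^sup>+ x\<in>{0<..<1}. ennreal (\<bar>B x\<bar> powr p * x powr (2 * nu + 1)) \<partial>lborel)"
    have "ennreal ((c powr p * R powr (- (2 * nu + 1))) * c' * ln R / R) \<le> X"
      unfolding X_def
    proof (rule log_lower[OF R'(2)])
      fix z assume z: "M \<le> z" "z \<le> R powr q" "1/2 \<le> \<bar>cos (z - th)\<bar>"
      have z0: "z > 0" using z M by linarith
      have "(c * z powr (- m)) powr p \<le> \<bar>B (z / R)\<bar> powr p"
        unfolding B_def using low[OF R'(1) z] p c by (intro powr_mono2) auto
      then have "c powr p * z powr (- (2 * nu + 2)) \<le> \<bar>B (z / R)\<bar> powr p"
        using c pm by (simp add: powr_mult powr_powr)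
      then have "c powr p * z powr (- (2 * nu + 2)) * (z / R) powr (2 * nu + 1)
          \<le> \<bar>B (z / R)\<bar> powr p * (z / R) powr (2 * nu + 1)"
        by (intro mult_right_mono) auto
      moreover have "c powr p * z powr (- (2 * nu + 2)) * (z / R) powr (2 * nu + 1)
          = c powr p * R powr (- (2 * nu + 1)) / z"
      proof -
        have "z powr (2 * nu + 2) = z powr (2 * nu + 1) * z"
          using z0 powr_add[of z "2 * nu + 1" 1] by (simp add: add.commute add.left_commute)
        then show ?thesis using z0 R' unfolding powr_minus
          by (simp add: powr_divide field_simps)
      qed
      ultimately show "c powr p * R powr (- (2 * nu + 1)) / z \<le> \<bar>B (z / R)\<bar> powr p * (z / R) powr (2 * nu + 1)"
        by simp
    qed (use c in simp)
    moreover have "(c powr p * R powr (- (2 * nu + 1))) * c' * ln R / R = c powr p * c' * ln R * R powr (- (2 * nu + 2))"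
    proof -
      have "- (2 * nu + 2) = - (2 * nu + 1) - 1" by simp
      then have "R powr (- (2 * nu + 2)) = R powr (- (2 * nu + 1)) / R"
        using R' by (simp only: powr_diff) simp
      then show ?thesis by simp
    qed
    ultimately have X: "ennreal (c powr p * c' * ln R * R powr (- (2 * nu + 2))) \<le> X"
      by (simp only:)
    obtain b where b: "\<And>x. x > 0 \<Longrightarrow> \<bar>B x\<bar> \<le> b"
      using bochner_riesz_indicator_bounded[OF nu delta(1) eta R'(4)] unfolding B_def by metis
    have "X \<le> (\<integral>\<^sup>+ x. ennreal (b powr p) * indicator {0<..<1::real} x \<partial>lborel)"
      unfolding X_def
    proof (rule nn_integral_mono)
      fix x :: real
      show "ennreal (\<bar>B x\<bar> powr p * x powr (2 * nu + 1)) * indicator {0<..<1} x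
          \<le> ennreal (b powr p) * indicator {0<..<1} x"
      proof (cases "x \<in> {0<..<1}")
        case True
        then have "\<bar>B x\<bar> powr p \<le> b powr p" using b p by (intro powr_mono2) auto
        moreover have "x powr (2 * nu + 1) \<le> 1" using True nu by (intro powr_le1) auto
        ultimately have "\<bar>B x\<bar> powr p * x powr (2 * nu + 1) \<le> b powr p * 1"
          by (intro mult_mono) auto
        then show ?thesis using True by (simp add: ennreal_leI)
      qed simp
    qed
    also have "\<dots> = ennreal (b powr p) * emeasure lborel {0<..<1::real}"
      by (intro nn_integral_cmult_indicator) simp
    also have "\<dots> < \<infinity>" by simp
    finally have Xfin: "X < \<infinity>" .
    have lnR: "ln R \<ge> 0" using R' by simp
    have "c powr p * c' * ln R * R powr (- (2 * nu + 2)) = enn2real (ennreal (c powr p * c' * ln R * R powr (- (2 * nu + 2))))"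
      using c c' lnR by simp
    also have "\<dots> \<le> enn2real X" using X Xfin by (intro enn2real_mono) auto
    finally have XX: "(c powr p * c' * ln R * R powr (- (2 * nu + 2))) powr (1 / p) \<le> Lp_nu nu p B"
      unfolding Lp_nu_def X_def[symmetric] using c c' lnR p by (intro powr_mono2) auto
    note Y = Lp_nu_indicator_bounds[OF nu e p]
    have "k powr (1 / p) * ln R powr (1 / p) * ((eta / R) powr (2 * nu + 2)) powr (1 / p)
        = (k * ln R * (eta / R) powr (2 * nu + 2)) powr (1 / p)"
      using k lnR by (simp add: powr_mult)
    also have "k * ln R * (eta / R) powr (2 * nu + 2) = c powr p * c' * ln R * R powr (- (2 * nu + 2))"
      unfolding k_def powr_minus using eta R' by (simp add: powr_divide field_simps)
    finally have "k powr (1 / p) * ln R powr (1 / p) * ((eta / R) powr (2 * nu + 2)) powr (1 / p) \<le> Lp_nu nu p B"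
      using XX by simp
    moreover have "k powr (1 / p) * ln R powr (1 / p) * Lp_nu nu p (indicator {0<..<eta / R})
        \<le> k powr (1 / p) * ln R powr (1 / p) * ((eta / R) powr (2 * nu + 2)) powr (1 / p)"
      using Y(2) by (intro mult_left_mono) auto
    ultimately show ?thesis unfolding B_def[symmetric] using Y(1) by (simp add: pos_le_divide_eq)
  qed
  show ?thesis
  proof (rule that[of "k powr (1 / p)"])
    show "k powr (1 / p) > 0" using k by simp
    show "eventually (\<lambda>R. \<exists>e. 0 < e \<and> e < 1 \<and>
       k powr (1 / p) * ln R powr (1 / p) \<le> Lp_nu nu p (bochner_riesz nu delta R (indicator {0<..<e}))
          / Lp_nu nu p (indicator {0<..<e})) at_top"
      using eventually_ge_at_top[of "max R1 R2"]
    proof eventually_elim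
      case (elim R)
      then have "0 < eta / R" "eta / R < 1" using eta R1 by auto
      then show ?case using main[OF elim] by blast
    qed
  qed
qed

section \<open>Homogeneity, and the two claims\<close>

lemma bochner_riesz_mult: "bochner_riesz nu delta R (\<lambda>x. c * f x) = (\<lambda>x. c * bochner_riesz nu delta R f x)"
proof -
  have "bessel_coeff nu (\<lambda>x. c * f x) j = c * bessel_coeff nu f j" for j
    unfolding bessel_coeff_def by (simp add: mult.assoc)
  then show ?thesis
    by (simp add: bochner_riesz_def sum_distrib_left mult_ac fun_eq_iff)
qed

lemma borel_measurable_bochner_riesz: "bochner_riesz nu delta R f \<in> borel_measurable borel"
  unfolding bochner_riesz_def[abs_def] bessel_psi_def besselJ_def by measurable

lemma Lp_nu_1_mult:
  assumes "c \<ge> 0" "g \<in> borel_measurable borel"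
  shows "Lp_nu nu 1 (\<lambda>x. c * g x) = c * Lp_nu nu 1 g"
proof -
  note assms(2)[measurable]
  have "(\<integral>\<^sup>+ x\<in>{0<..<1}. ennreal (\<bar>c * g x\<bar> powr 1 * x powr (2 * nu + 1)) \<partial>lborel)
      = (\<integral>\<^sup>+ x. ennreal c * (ennreal (\<bar>g x\<bar> powr 1 * x powr (2 * nu + 1)) * indicator {0<..<1} x) \<partial>lborel)"
    using assms by (intro nn_integral_cong) (simp add: abs_mult ennreal_mult mult_ac)
  also have "\<dots> = ennreal c * (\<integral>\<^sup>+ x\<in>{0<..<1}. ennreal (\<bar>g x\<bar> powr 1 * x powr (2 * nu + 1)) \<partial>lborel)"
    by (rule nn_integral_cmult) measurable
  finally show ?thesis using assms by (simp add: Lp_nu_def enn2real_mult)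
qed

theorem theorem7:
  fixes nu delta :: real
  assumes "nu > -1/2"
  shows "(0 < delta \<and> delta < nu + 1/2 \<longrightarrow>
           (let p0 = 4 * (nu + 1) / (2 * nu + 3 + 2 * delta) in
            \<exists>C>0. eventually (\<lambda>R.
              (SUP E\<in>{E. E \<in> sets lborel \<and> E \<subseteq> {0<..<1} \<and> mu_nu nu E > 0}.
                 ereal (Lp_nu nu p0 (bochner_riesz nu delta R (indicator E))
                        / Lp_nu nu p0 (indicator E)))
              \<ge> ereal (C * ln R powr (1 / p0))) at_top))
       \<and> (delta = nu + 1/2 \<longrightarrow>
           (\<exists>C>0. eventually (\<lambda>R.
              (SUP f\<in>{f. f \<in> borel_measurable lborel \<and> Lp_nu nu 1 f = 1 \<and>
                   (\<integral>\<^sup>+ x\<in>{0<..<1}. ennreal (\<bar>f x\<bar> * x powr (2 * nu + 1)) \<partial>lborel) < \<infinity>}.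
                 ereal (Lp_nu nu 1 (bochner_riesz nu delta R f)))
              \<ge> ereal (C * ln R)) at_top))"
proof (intro conjI impI)
  assume delta: "0 < delta \<and> delta < nu + 1/2"
  define p0 where "p0 = 4 * (nu + 1) / (2 * nu + 3 + 2 * delta)"
  have d: "delta > 0" "delta \<le> nu + 1/2" using delta by auto
  obtain C where C: "C > 0" "eventually (\<lambda>R. \<exists>e. 0 < e \<and> e < 1 \<and>
       C * ln R powr (1 / p0) \<le> Lp_nu nu p0 (bochner_riesz nu delta R (indicator {0<..<e}))
          / Lp_nu nu p0 (indicator {0<..<e})) at_top"
    by (rule bochner_riesz_norm_ratio[OF assms d, folded p0_def])
  have "eventually (\<lambda>R.
              (SUP E\<in>{E. E \<in> sets lborel \<and> E \<subseteq> {0<..<1} \<and> mu_nu nu E > 0}.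
                 ereal (Lp_nu nu p0 (bochner_riesz nu delta R (indicator E))
                        / Lp_nu nu p0 (indicator E)))
              \<ge> ereal (C * ln R powr (1 / p0))) at_top"
    using C(2)
  proof eventually_elim
    case (elim R)
    then obtain e where e: "0 < e" "e < 1" "C * ln R powr (1 / p0)
        \<le> Lp_nu nu p0 (bochner_riesz nu delta R (indicator {0<..<e})) / Lp_nu nu p0 (indicator {0<..<e})"
      by blast
    show ?case
    proof (rule SUP_upper2[of "{0<..<e}"])
      show "{0<..<e} \<in> {E. E \<in> sets lborel \<and> E \<subseteq> {0<..<1} \<and> mu_nu nu E > 0}"
        using e mu_nu_Ioo_pos[OF assms] by auto
    qed (use e in simp)
  qed
  then show "let p0 = 4 * (nu + 1) / (2 * nu + 3 + 2 * delta) in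
            \<exists>C>0. eventually (\<lambda>R.
              (SUP E\<in>{E. E \<in> sets lborel \<and> E \<subseteq> {0<..<1} \<and> mu_nu nu E > 0}.
                 ereal (Lp_nu nu p0 (bochner_riesz nu delta R (indicator E))
                        / Lp_nu nu p0 (indicator E)))
              \<ge> ereal (C * ln R powr (1 / p0))) at_top"
    unfolding Let_def p0_def[symmetric] using C(1) by blast
next
  assume delta: "delta = nu + 1/2"
  have d: "delta > 0" "delta \<le> nu + 1/2" using delta assms by auto
  have p1: "4 * (nu + 1) / (2 * nu + 3 + 2 * delta) = 1"
    using delta assms by (simp add: field_simps)
  obtain C where C: "C > 0" "eventually (\<lambda>R. \<exists>e. 0 < e \<and> e < 1 \<and>
       C * ln R powr (1 / 1) \<le> Lp_nu nu 1 (bochner_riesz nu delta R (indicator {0<..<e}))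
          / Lp_nu nu 1 (indicator {0<..<e})) at_top"
    by (rule bochner_riesz_norm_ratio[OF assms d, unfolded p1])
  have "eventually (\<lambda>R.
              (SUP f\<in>{f. f \<in> borel_measurable lborel \<and> Lp_nu nu 1 f = 1 \<and>
                   (\<integral>\<^sup>+ x\<in>{0<..<1}. ennreal (\<bar>f x\<bar> * x powr (2 * nu + 1)) \<partial>lborel) < \<infinity>}.
                 ereal (Lp_nu nu 1 (bochner_riesz nu delta R f)))
              \<ge> ereal (C * ln R)) at_top"
    \<comment> \<open>For R \<ge> 1 the logarithm is nonnegative, which lets
      \<open>ln R powr (1 / 1)\<close> be read as \<open>ln R\<close>.\<close>
    using C(2) eventually_ge_at_top[of 1]
  proof eventually_elim
    case (elim R)
    then obtain e where e: "0 < e" "e < 1" and low: "C * ln R powr (1 / 1)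
        \<le> Lp_nu nu 1 (bochner_riesz nu delta R (indicator {0<..<e})) / Lp_nu nu 1 (indicator {0<..<e})"
      by blast
    define y where "y = Lp_nu nu 1 (indicator {0<..<e})"
    have y: "y > 0" using Lp_nu_indicator_bounds(1)[OF assms e, of 1] by (simp add: y_def)
    \<comment> \<open>The indicator scaled to unit norm; by linearity of the mean and homogeneity of
      the norm, its image has exactly the quotient of norms as its norm.\<close>
    define f where "f = (\<lambda>x. 1 / y * indicator {0<..<e} x :: real)"
    show ?case
    proof (rule SUP_upper2[of f])
      have "Lp_nu nu 1 f = 1"
        unfolding f_def using y by (subst Lp_nu_1_mult) (auto simp: y_def)
      moreover have "(\<integral>\<^sup>+ x\<in>{0<..<1}. ennreal (\<bar>f x\<bar> * x powr (2 * nu + 1)) \<partial>lborel) < \<infinity>"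
      proof -
        have "(\<integral>\<^sup>+ x\<in>{0<..<1}. ennreal (\<bar>f x\<bar> * x powr (2 * nu + 1)) \<partial>lborel)
            \<le> (\<integral>\<^sup>+ x. ennreal (1 / y) * indicator {0<..<1} (x::real) \<partial>lborel)"
        proof (rule nn_integral_mono)
          fix x :: real
          have "x powr (2 * nu + 1) \<le> 1" if "0 < x" "x < 1" using that assms by (intro powr_le1) auto
          then show "ennreal (\<bar>f x\<bar> * x powr (2 * nu + 1)) * indicator {0<..<1} x
              \<le> ennreal (1 / y) * indicator {0<..<1} x"
            using y by (auto simp: f_def indicator_def intro!: ennreal_leI divide_right_mono)
        qed
        also have "\<dots> < \<infinity>" by (subst nn_integral_cmult_indicator) auto
        finally show ?thesis .
      qed
      ultimately show "f \<in> {f. f \<in> borel_measurable lborel \<and> Lp_nu nu 1 f = 1 \<and>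
                   (\<integral>\<^sup>+ x\<in>{0<..<1}. ennreal (\<bar>f x\<bar> * x powr (2 * nu + 1)) \<partial>lborel) < \<infinity>}"
        by (auto simp: f_def)
    next
      have "bochner_riesz nu delta R f = (\<lambda>x. 1 / y * bochner_riesz nu delta R (indicator {0<..<e}) x)"
        unfolding f_def by (rule bochner_riesz_mult)
      then have "Lp_nu nu 1 (bochner_riesz nu delta R f)
          = 1 / y * Lp_nu nu 1 (bochner_riesz nu delta R (indicator {0<..<e}))"
        using y by (simp only:) (intro Lp_nu_1_mult borel_measurable_bochner_riesz, simp)
      then show "ereal (C * ln R) \<le> ereal (Lp_nu nu 1 (bochner_riesz nu delta R f))"
        using low elim by (simp add: y_def)
    qed
  qed
  then show "\<exists>C>0. eventually (\<lambda>R.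
              (SUP f\<in>{f. f \<in> borel_measurable lborel \<and> Lp_nu nu 1 f = 1 \<and>
                   (\<integral>\<^sup>+ x\<in>{0<..<1}. ennreal (\<bar>f x\<bar> * x powr (2 * nu + 1)) \<partial>lborel) < \<infinity>}.
                 ereal (Lp_nu nu 1 (bochner_riesz nu delta R f)))
              \<ge> ereal (C * ln R)) at_top"
    using C(1) by blast
qed

end
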